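(* Suppose the ellipticity assumption holds on $U$, $|b(x)|\le M_2$ for all $x\in U$ with a constant $M_2\ge 0$, and the functions $r_1,r_2$ are absolutely continuous on $[\theta_0,\infty)$ with $r_1',r_2'\in L^\infty(\Theta,\infty)$ for some number $\Theta\ge\theta_0$. Then there are numbers $C_*'>0$ and $\nu'>0$ (independent of $u$) such that the following statements hold for every $u\in C^2(U)\cap C(\widetilde U)$. (i) Suppose $Lu\le 0$ in $U$ and $u\le 0$ on $\gamma$. Then there are only two possibilities. (a) One has $$u^+(x)\le \max_{y\in \mathcal S_{\theta_0}} u^+(y)\quad\text{and}\quad u^+(x)\le C_*'\Big(\max_{y\in \mathcal S_{\theta_0}} u^+(y)\Big)e^{-\nu' \mathscr L(x)}\quad\text{for all }x\in\widetilde U.$$ (b) For any $\varepsilon>0$, there are numbers $C_1'>0$ depending on $u$ and $\bar\ell_1\ge 0$ depending on $\varepsilon$ such that if $\ell\ge \bar\ell_1$, then $$\sup\Big\{u^+(x):x\in\widehat U_{[(k_*+\varepsilon)^{-1}\ell,\,(k_*+\varepsilon)\ell]}\Big\}\ge C_1'e^{\nu' \ell}.$$ (ii) Suppose $Lu=0$ in $U$ and $u=0$ on $\gamma$. Then there are only two possibilities. (a) One has $$|u(x)|\le \max_{y\in \mathcal S_{\theta_0}} |u(y)|\quad\text{and}\quad |u(x)|\le C_*'\Big(\max_{y\in \mathcal S_{\theta_0}} |u(y)|\Big)e^{-\nu' \mathscr L(x)}\quad\text{for all }x\in\widetilde U.$$ (b) There is a number $C'>0$ depending on $u$ such that for any $\varepsilon>0$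 there exists a number $\bar\ell\ge0$ depending on $\varepsilon$ so that if $\ell\ge\bar\ell$, then $$\sup\Big\{|u(x)|:x\in\widehat U_{[(k_*+\varepsilon)^{-1}\ell,\,(k_*+\varepsilon)\ell]}\Big\}\ge C'e^{\nu' \ell}.$$
   Context: Domain. Let $X(r,\theta)=(r\cos\theta,r\sin\theta)$ for $r\ge0$, $\theta\in\mathbb R$. Fix $\theta_0\in\mathbb R$ and positive continuous functions $r_1,r_2$ on $[\theta_0,\infty)$ with $r_2(\theta+2\pi)<r_1(\theta)<r_2(\theta)$ for all $\theta\ge\theta_0$, and assume there is $r_*>0$ with $\lim_{\theta\to\infty}r_1(\theta)=\lim_{\theta\to\infty}r_2(\theta)=r_*$. Fix $\bar R>0$ with $r_2(\theta)\le\bar R$ for all $\theta\ge\theta_0$. Define $U=\{X(r,\theta):\theta>\theta_0,\ r_1(\theta)<r<r_2(\theta)\}$ (open and bounded), $\widetilde U=\{X(r,\theta):\theta\ge\theta_0,\ r_1(\theta)\le r\le r_2(\theta)\}$, $\gamma=\{X(r_i(\theta),\theta):\theta\ge\theta_0,\ i=1,2\}$, and $\mathcal S_\theta=\{X(r,\theta): r_1(\theta)\le r\le r_2(\theta)\}$ for $\theta\ge\theta_0$. Arc-distance. For $\lambda\in[0,1]$ let $R_\lambda(\theta)=(1-\lambda)r_1(\theta)+\lambda r_2(\theta)$ and $X_\lambda(\theta)=X(R_\lambda(\theta),\theta)$, $\theta\ge\theta_0$; the map $(\lambda,\theta)\mapsto X_\lambda(\theta)$ is a bijection from $[0,1]\times[\theta_0,\infty)$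 onto $\widetilde U$. Let $s_\lambda(\theta)=\int_{\theta_0}^\theta|X_\lambda'(\eta)|\,d\eta$ (Lebesgue integral). For $x\in\widetilde U$ define $\mathscr L(x)=s_\lambda(\theta)$, where $(\lambda,\theta)$ is the unique pair with $x=X_\lambda(\theta)$. For $J\subset[0,\infty)$ let $\widehat U_J=\mathscr L^{-1}(J)\subset\widetilde U$. Let $\mu_0=\max\{\|r_1'\|_{L^\infty(\Theta,\infty)},\|r_2'\|_{L^\infty(\Theta,\infty)}\}$ and $k_*=\dfrac{\bar R+\mu_0}{r_*}>1$. Operator. $A=(a_{ij})$ is a function from $U$ to the real symmetric $2\times2$ matrices, $b:U\to\mathbb R^2$, and $Lu=-\sum_{i,j=1}^2 a_{ij}\frac{\partial^2u}{\partial x_i\partial x_j}+b\cdot\nabla u$ for $u\in C^2(U)$. Ellipticity assumption on $U$: there are constants $c_0>0$, $M_1>0$ such that $\xi^{\rm T}A(x)\xi\ge c_0|\xi|^2$ and $\mathrm{Tr}(A(x))\le M_1$ for all $x\in U$, $\xi\in\mathbb R^2$. Notation: $u^+=\max\{0,u\}$. "There are only two possibilities" means that at least one of (a), (b) holds. In (i)(b) and (ii)(b), $u$ is fixed before the other quantifiers. *)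

theory Defs
  imports "HOL-Analysis.Analysis" "HOL-Probability.Essential_Supremum"
begin

section \<open>Spiral domains\<close>

text \<open>Only the values of \<open>r1\<close>, \<open>r2\<close> on \<open>{\<theta>0..}\<close> matter for the objects below.\<close>

definition polar_point :: "real \<Rightarrow> real \<Rightarrow> real^2" where
  "polar_point r \<theta> = vector [r * cos \<theta>, r * sin \<theta>]"

definition spiral_dom :: "(real \<Rightarrow> real) \<Rightarrow> (real \<Rightarrow> real) \<Rightarrow> real \<Rightarrow> (real^2) set" where
  "spiral_dom r1 r2 \<theta>0 = {polar_point r \<theta> | r \<theta>. \<theta> > \<theta>0 \<and> r1 \<theta> < r \<and> r < r2 \<theta>}"

definition spiral_cl :: "(real \<Rightarrow> real) \<Rightarrow> (real \<Rightarrow> real) \<Rightarrow> real \<Rightarrow> (real^2) set" where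
  "spiral_cl r1 r2 \<theta>0 = {polar_point r \<theta> | r \<theta>. \<theta> \<ge> \<theta>0 \<and> r1 \<theta> \<le> r \<and> r \<le> r2 \<theta>}"

definition spiral_side :: "(real \<Rightarrow> real) \<Rightarrow> (real \<Rightarrow> real) \<Rightarrow> real \<Rightarrow> (real^2) set" where
  "spiral_side r1 r2 \<theta>0 =
     {polar_point (r1 \<theta>) \<theta> | \<theta>. \<theta> \<ge> \<theta>0} \<union> {polar_point (r2 \<theta>) \<theta> | \<theta>. \<theta> \<ge> \<theta>0}"

definition cross_section :: "(real \<Rightarrow> real) \<Rightarrow> (real \<Rightarrow> real) \<Rightarrow> real \<Rightarrow> (real^2) set" where
  "cross_section r1 r2 \<theta> = {polar_point r \<theta> | r. r1 \<theta> \<le> r \<and> r \<le> r2 \<theta>}"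

section \<open>Arc-distance\<close>

definition spiral_curve :: "(real \<Rightarrow> real) \<Rightarrow> (real \<Rightarrow> real) \<Rightarrow> real \<Rightarrow> real \<Rightarrow> real^2" where
  "spiral_curve r1 r2 l \<theta> = polar_point ((1 - l) * r1 \<theta> + l * r2 \<theta>) \<theta>"

definition curve_length ::
  "(real \<Rightarrow> real) \<Rightarrow> (real \<Rightarrow> real) \<Rightarrow> real \<Rightarrow> real \<Rightarrow> real \<Rightarrow> real" where
  "curve_length r1 r2 \<theta>0 l \<theta> =
     (LINT \<eta>:{\<theta>0..\<theta>}|lebesgue. norm (vector_derivative (spiral_curve r1 r2 l) (at \<eta>)))"

text \<open>The definite description is meaningful for \<open>x \<in> spiral_cl r1 r2 \<theta>0\<close> when
  \<open>0 < r1 \<theta>\<close> and \<open>r2 (\<theta> + 2\<pi>) < r1 \<theta> < r2 \<theta>\<close> for all \<open>\<theta> \<ge> \<theta>0\<close>: the pair is then unique.\<close>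

definition arc_dist ::
  "(real \<Rightarrow> real) \<Rightarrow> (real \<Rightarrow> real) \<Rightarrow> real \<Rightarrow> real^2 \<Rightarrow> real" where
  "arc_dist r1 r2 \<theta>0 x =
     (case (THE (l, \<theta>). l \<in> {0..1} \<and> \<theta> \<ge> \<theta>0 \<and> x = spiral_curve r1 r2 l \<theta>)
      of (l, \<theta>) \<Rightarrow> curve_length r1 r2 \<theta>0 l \<theta>)"

definition arc_layer ::
  "(real \<Rightarrow> real) \<Rightarrow> (real \<Rightarrow> real) \<Rightarrow> real \<Rightarrow> real set \<Rightarrow> (real^2) set" where
  "arc_layer r1 r2 \<theta>0 J = {x \<in> spiral_cl r1 r2 \<theta>0. arc_dist r1 r2 \<theta>0 x \<in> J}"

section \<open>Regularity of functions of one real variable\<close>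

definition abs_continuous_on :: "real set \<Rightarrow> (real \<Rightarrow> real) \<Rightarrow> bool" where
  "abs_continuous_on S f \<longleftrightarrow>
     (\<forall>\<epsilon>>0. \<exists>\<delta>>0. \<forall>(n::nat) a b.
        (\<forall>i<n. a i \<le> b i \<and> {a i..b i} \<subseteq> S) \<and>
        disjoint_family_on (\<lambda>i. {a i<..<b i}) {..<n} \<and>
        (\<Sum>i<n. b i - a i) < \<delta> \<longrightarrow>
        (\<Sum>i<n. \<bar>f (b i) - f (a i)\<bar>) < \<epsilon>)"

definition deriv_Linf_norm :: "real \<Rightarrow> (real \<Rightarrow> real) \<Rightarrow> ereal" where
  "deriv_Linf_norm T f = esssup (lebesgue_on {T<..}) (\<lambda>t. ereal \<bar>deriv f t\<bar>)"

text \<open>\<open>deriv f t\<close> has no meaning where \<open>f\<close> is not differentiable, so differentiability almost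
  everywhere, which is automatic for absolutely continuous \<open>f\<close>, is included here.\<close>

definition deriv_Linf :: "real \<Rightarrow> (real \<Rightarrow> real) \<Rightarrow> bool" where
  "deriv_Linf T f \<longleftrightarrow>
     (AE t in lebesgue_on {T<..}. f differentiable (at t)) \<and>
     deriv f \<in> borel_measurable (lebesgue_on {T<..}) \<and>
     deriv_Linf_norm T f < \<infinity>"

text \<open>The constant \<open>k\<^sub>* = (R + \<mu>\<^sub>0) / r\<^sub>*\<close>, where \<open>\<mu>\<^sub>0\<close> is the larger of the two norms.\<close>

definition layer_ratio ::
  "(real \<Rightarrow> real) \<Rightarrow> (real \<Rightarrow> real) \<Rightarrow> real \<Rightarrow> real \<Rightarrow> real \<Rightarrow> real" where
  "layer_ratio r1 r2 T R rstar =
     (R + real_of_ereal (max (deriv_Linf_norm T r1) (deriv_Linf_norm T r2))) / rstar"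

section \<open>Second order operators\<close>

definition partial_deriv :: "'n::finite \<Rightarrow> (real^'n \<Rightarrow> real) \<Rightarrow> real^'n \<Rightarrow> real" where
  "partial_deriv i u x = frechet_derivative u (at x) (axis i 1)"

text \<open>To be used for open \<open>S\<close>, since the derivatives are taken at \<open>at x\<close>.\<close>

definition C2_on :: "(real^'n::finite) set \<Rightarrow> (real^'n \<Rightarrow> real) \<Rightarrow> bool" where
  "C2_on S u \<longleftrightarrow>
     (\<forall>x\<in>S. u differentiable (at x)) \<and>
     (\<forall>i. \<forall>x\<in>S. partial_deriv i u differentiable (at x)) \<and>
     (\<forall>i j. continuous_on S (partial_deriv i (partial_deriv j u)))"

definition elliptic_op ::
  "(real^'n::finite \<Rightarrow> real^'n^'n) \<Rightarrow> (real^'n \<Rightarrow> real^'n) \<Rightarrow> (real^'n \<Rightarrow> real) \<Rightarrow> real^'n \<Rightarrow> real" where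
  "elliptic_op A b u x =
     - (\<Sum>i\<in>UNIV. \<Sum>j\<in>UNIV. A x $ i $ j * partial_deriv i (partial_deriv j u) x)
     + b x \<bullet> (\<chi> i. partial_deriv i u x)"

end

theory Submission
  imports Defs
begin

text \<open>
  The idea is to measure everything by the angle \<open>\<theta>\<close>, in which the problem has explicit barriers,
  and to translate to arc-distance only at the end.

  On late turns the domain lies in a thin annulus about the circle of radius \<open>rstar\<close>, and there a
  function that is strongly concave in the radius dominates every other term of the operator. For \<open>N\<close> large,
  depending only on \<open>c0\<close>, \<open>M1\<close>, \<open>M2\<close> and \<open>rstar\<close>, and \<open>\<theta>\<close> so large that \<open>r\<close> is close to \<open>rstar\<close>, both functions
  \<open>(2 - N * (r\<^sup>2 - rstar\<^sup>2)\<^sup>2) * exp \<theta>\<close> and \<open>(2 - N * (r\<^sup>2 - rstar\<^sup>2)\<^sup>2) * exp (- \<theta>)\<close> are strict supersolutions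
  (\<open>exponential_barrier\<close>). The lemma \<open>comparison\<close> turns supersolutions of the form \<open>f (r\<^sup>2) * g \<theta>\<close> into bounds. Its
  proof maximises over the parameters \<open>(l, \<theta>)\<close> of the spiral, where \<open>\<theta>\<close> is single valued, and compares
  second derivatives along straight lines at an interior maximum. With \<open>g = 1\<close> it also gives the
  maximum principle on the whole domain (\<open>maximum_principle\<close>).

  Let \<open>M \<theta>\<close> be the maximum of \<open>u\<^sup>+\<close>, or of \<open>\<bar>u\<bar>\<close>, over the cross-section at angle \<open>\<theta>\<close>. The barriers
  give \<open>M \<theta> \<le> 2 * (M S * exp (S - \<theta>) + M T * exp (\<theta> - T))\<close> for \<open>S \<le> \<theta> \<le> T\<close> on late turns. Either \<open>M \<theta> \<ge> c * exp \<theta>\<close>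
  for some \<open>c > 0\<close> and all large \<open>\<theta>\<close>, or the second term can be made to vanish by a suitable choice of \<open>T\<close>; then \<open>M\<close>
  decays exponentially, and by the maximum principle it never exceeds its initial value
  (\<open>phragmen_lindeloef_dichotomy\<close>).

  With \<open>\<mu>\<close> the essential bound on the derivatives, arc-distance is at most
  \<open>c + (Rbar + \<mu>) * (\<theta> - \<theta>0)\<close>, and for every \<open>\<kappa> < rstar\<close> at least \<open>\<kappa> * (\<theta> - T)\<close> with a suitable \<open>T\<close>. So the rate
  \<open>1 / (Rbar + \<mu>)\<close> works in the first alternative, and in the second one the cross-section at angle
  \<open>l / rstar\<close> lies in the required layer (\<open>section_in_arc_layer\<close>).

  These length estimates are only as good as the integrability of the speed, and on the first turns
  the derivatives need not be bounded. What is needed is that an absolutely continuous function has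
  a locally integrable derivative almost everywhere (\<open>abs_continuous_derivative\<close>). The variation function
  writes it as a difference of continuous monotone functions, for which Vitali's covering theorem and
  the Lebesgue--Stieltjes measure give Lebesgue's theorem (\<open>mono_differentiable_ae\<close>); Fatou's lemma
  gives integrability.
\<close>

section \<open>Differentiability of monotone functions\<close>

text \<open>Vitali's covering theorem on the line, with intervals that need not be centred at the covered
  points; difference quotients of a function produce such intervals.\<close>

lemma vitali_intervals:
  fixes S G :: "real set" and P :: "real \<Rightarrow> real \<Rightarrow> bool"
  assumes "open G" "S \<subseteq> G"
    and fine: "\<And>x d. x \<in> S \<Longrightarrow> d > 0 \<Longrightarrow> \<exists>s t. s < t \<and> s \<le> x \<and> x \<le> t \<and> t - s < d \<and> P s t"
  obtains C where "countable C" "\<And>s t. (s, t) \<in> C \<Longrightarrow> s < t \<and> {s..t} \<subseteq> G \<and> P s t"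
    "disjoint_family_on (\<lambda>(s, t). {s..t}) C" "negligible (S - (\<Union>(s, t)\<in>C. {s..t}))"
proof -
  define K where "K = {(s, t). s < t \<and> {s..t} \<subseteq> G \<and> P s t}"
  define a where "a = (\<lambda>(s::real, t). (s + t) / 2)"
  define r where "r = (\<lambda>(s::real, t). (t - s) / 2)"
  have cb: "cball (a i) (r i) = (case i of (s, t) \<Rightarrow> {s..t})" for i
    by (auto simp: a_def r_def cball_eq_atLeastAtMost field_simps split: prod.splits)
  have rK: "0 < r i" if "i \<in> K" for i using that by (auto simp: K_def r_def)
  have cov: "\<exists>i. i \<in> K \<and> x \<in> cball (a i) (r i) \<and> r i < d" if x: "x \<in> S" and d: "d > 0" for x d
  proof -
    obtain e where e: "e > 0" "ball x e \<subseteq> G" using x assms openE by blast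
    obtain s t where st: "s < t" "s \<le> x" "x \<le> t" "t - s < min d e" "P s t"
      using fine[OF x, of "min d e"] d e by auto
    have "{s..t} \<subseteq> ball x e" using st by (auto simp: dist_real_def)
    then have "(s, t) \<in> K" using e st by (auto simp: K_def)
    then show ?thesis using st by (intro exI[of _ "(s,t)"]) (auto simp: cb, auto simp: r_def)
  qed
  obtain C where C: "countable C" "C \<subseteq> K"
     "pairwise (\<lambda>i j. disjnt (cball (a i) (r i)) (cball (a j) (r j))) C"
     "negligible (S - (\<Union>i \<in> C. cball (a i) (r i)))"
    by (rule Vitali_covering_theorem_cballs[of K r S a, OF rK cov])
  show thesis
  proof (rule that[of C])
    show "disjoint_family_on (\<lambda>(s, t). {s..t}) C"
      using C(3) by (auto simp: disjoint_family_on_def pairwise_def disjnt_def cb split: prod.splits)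
  qed (use C in \<open>auto simp: K_def cb\<close>)
qed

lemma countable_negligible: "countable S \<Longrightarrow> negligible (S :: real set)"
  using negligible_iff_null_sets null_sets_completionI countable_imp_null_set_lborel by blast

lemma outer_lebesgue_open:
  fixes S :: "real set"
  assumes "S \<subseteq> H" "open H" "e > 0" "outer_measure_of lebesgue S < \<infinity>"
  obtains G where "open G" "S \<subseteq> G" "G \<subseteq> H" "emeasure lborel G \<le> outer_measure_of lebesgue S + ennreal e"
proof -
  obtain E where E: "E \<in> sets lebesgue" "S \<subseteq> E" "outer_measure_of lebesgue S = emeasure lebesgue E"
    using outer_measure_of_attain[of S lebesgue] by auto
  obtain T where T: "open T" "E \<subseteq> T" "T - E \<in> lmeasurable" "emeasure lebesgue (T - E) < ennreal e"
    using sets_lebesgue_outer_open[OF E(1) assms(3)] by auto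
  have "emeasure lebesgue T = emeasure lebesgue (E \<union> (T - E))"
    using T by (intro arg_cong[where f="emeasure lebesgue"]) auto
  also have "\<dots> \<le> emeasure lebesgue E + emeasure lebesgue (T - E)"
    using E T by (intro emeasure_subadditive) auto
  finally have *: "emeasure lebesgue T \<le> outer_measure_of lebesgue S + ennreal e"
    using T(4) E(3) by (metis add_left_mono le_less order_trans)
  show thesis
  proof (rule that[of "T \<inter> H"])
    have "emeasure lborel (T \<inter> H) \<le> emeasure lborel T"
      using T assms by (intro emeasure_mono) auto
    also have "\<dots> = emeasure lebesgue T" using T by simp
    finally show "emeasure lborel (T \<inter> H) \<le> outer_measure_of lebesgue S + ennreal e"
      using * by order
  qed (use T E assms in auto)
qed

lemma negligible_iff_outer_lebesgue:
  "negligible (S :: real set) \<longleftrightarrow> outer_measure_of lebesgue S = 0"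
proof
  assume "negligible S"
  then show "outer_measure_of lebesgue S = 0"
    by (metis negligible_iff_null_sets null_setsD1 null_setsD2 outer_measure_of_eq)
next
  assume 0: "outer_measure_of lebesgue S = 0"
  obtain E where "E \<in> sets lebesgue" "S \<subseteq> E" "outer_measure_of lebesgue S = emeasure lebesgue E"
    using outer_measure_of_attain[of S lebesgue] by auto
  with 0 show "negligible S"
    by (metis negligible_iff_null_sets null_setsI negligible_subset)
qed

lemma outer_lebesgue_le_of_negligible_diff:
  fixes S T :: "real set"
  assumes "negligible (S - T)"
  shows "outer_measure_of lebesgue S \<le> outer_measure_of lebesgue T"
proof -
  obtain E where E: "E \<in> sets lebesgue" "T \<subseteq> E" "outer_measure_of lebesgue T = emeasure lebesgue E"
    using outer_measure_of_attain[of T lebesgue] by auto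
  have N: "S - T \<in> null_sets lebesgue" using assms negligible_iff_null_sets by blast
  have "outer_measure_of lebesgue S \<le> outer_measure_of lebesgue (E \<union> (S - T))"
    using E by (intro outer_measure_of_mono) auto
  also have "\<dots> = emeasure lebesgue (E \<union> (S - T))"
    using E N by (intro outer_measure_of_eq sets.Un) auto
  also have "\<dots> = emeasure lebesgue E" using N E by (intro emeasure_Un_null_set) auto
  finally show ?thesis using E by simp
qed

context
  fixes F :: "real \<Rightarrow> real"
  assumes mono: "mono F" and cont: "continuous_on UNIV F"
begin

lemma interval_measure_Icc:
  "s \<le> t \<Longrightarrow> emeasure (interval_measure F) {s..t} = ennreal (F t - F s)"
  using emeasure_interval_measure_Icc[of s t F] mono cont by (auto simp: mono_def)

lemma emeasure_disjoint_intervals: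
  assumes C: "countable C" "disjoint_family_on (\<lambda>(s, t). {s..t}) C" "\<And>s t. (s, t) \<in> C \<Longrightarrow> s < (t::real)"
    and M: "sets M = sets (borel :: real measure)"
  shows "emeasure M (\<Union>(s, t)\<in>C. {s..t}) = (\<integral>\<^sup>+x. (case x of (s,t) \<Rightarrow> emeasure M {s..t}) \<partial>count_space C)"
proof -
  have "emeasure M (\<Union>i\<in>C. case i of (s, t) \<Rightarrow> {s..t})
      = (\<integral>\<^sup>+x. emeasure M (case x of (s,t) \<Rightarrow> {s..t}) \<partial>count_space C)"
    using C M by (intro emeasure_UN_countable) auto
  then show ?thesis by (simp add: case_prod_unfold)
qed

text \<open>For a continuous monotone \<open>F\<close> the Lebesgue--Stieltjes measure turns increments over disjoint
  intervals into a countably additive quantity. If arbitrarily short intervals of slope at least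
  \<open>q\<close> sit at each point of \<open>S\<close>, a disjoint Vitali subfamily compares the two measures.\<close>

lemma outer_le_interval_measure_of_steep:
  assumes G: "open G" "S \<subseteq> G" and q: "q \<ge> 0"
    and fine: "\<And>x d. x \<in> S \<Longrightarrow> d > 0 \<Longrightarrow>
      \<exists>s t. s < t \<and> s \<le> x \<and> x \<le> t \<and> t - s < d \<and> q * (t - s) \<le> F t - F s"
  shows "ennreal q * outer_measure_of lebesgue S \<le> emeasure (interval_measure F) G"
proof -
  obtain C where C: "countable C" "\<And>s t. (s, t) \<in> C \<Longrightarrow> s < t \<and> {s..t} \<subseteq> G \<and> q * (t - s) \<le> F t - F s"
    "disjoint_family_on (\<lambda>(s, t). {s..t}) C" "negligible (S - (\<Union>(s, t)\<in>C. {s..t}))"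
    by (rule vitali_intervals[OF G fine]) auto
  let ?T = "\<Union>(s, t)\<in>C. {s..t}"
  have T: "?T \<in> sets borel" using C(1) by (intro sets.countable_UN') auto
  have "outer_measure_of lebesgue S \<le> emeasure lborel ?T"
    using outer_lebesgue_le_of_negligible_diff[OF C(4)] T by simp
  then have "ennreal q * outer_measure_of lebesgue S \<le> ennreal q * emeasure lborel ?T"
    by (intro mult_left_mono) auto
  also have "\<dots> = ennreal q * (\<integral>\<^sup>+x. (case x of (s,t) \<Rightarrow> emeasure lborel {s..t}) \<partial>count_space C)"
    using C by (subst emeasure_disjoint_intervals) auto
  also have "\<dots> = (\<integral>\<^sup>+x. ennreal q * (case x of (s,t) \<Rightarrow> emeasure lborel {s..t}) \<partial>count_space C)"
    by (simp add: nn_integral_cmult)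
  also have "\<dots> \<le> (\<integral>\<^sup>+x. (case x of (s,t) \<Rightarrow> emeasure (interval_measure F) {s..t}) \<partial>count_space C)"
  proof (intro nn_integral_mono, clarsimp)
    fix s t assume "(s, t) \<in> C"
    with C(2) have "s < t" "q * (t - s) \<le> F t - F s" by auto
    then show "ennreal q * emeasure lborel {s..t} \<le> emeasure (interval_measure F) {s..t}"
      using q by (auto simp: interval_measure_Icc ennreal_mult' [symmetric] intro!: ennreal_leI)
  qed
  also have "\<dots> = emeasure (interval_measure F) ?T"
    using C by (subst emeasure_disjoint_intervals) auto
  also have "\<dots> \<le> emeasure (interval_measure F) G"
    using G C(2) by (intro emeasure_mono) auto
  finally show ?thesis .
qed

text \<open>The counterpart for small slopes. The intervals are returned with their endpoints removed, so
  that the result can serve as the open set of a second Vitali selection.\<close>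

lemma open_cover_of_flat:
  assumes G: "open G" "S \<subseteq> G" and p: "p \<ge> 0"
    and fine: "\<And>x d. x \<in> S \<Longrightarrow> d > 0 \<Longrightarrow>
      \<exists>s t. s < t \<and> s \<le> x \<and> x \<le> t \<and> t - s < d \<and> F t - F s \<le> p * (t - s)"
  obtains T where "open T" "T \<subseteq> G" "negligible (S - T)"
    "emeasure (interval_measure F) T \<le> ennreal p * emeasure lborel G"
proof -
  obtain C where C: "countable C" "\<And>s t. (s, t) \<in> C \<Longrightarrow> s < t \<and> {s..t} \<subseteq> G \<and> F t - F s \<le> p * (t - s)"
    "disjoint_family_on (\<lambda>(s, t). {s..t}) C" "negligible (S - (\<Union>(s, t)\<in>C. {s..t}))"
    by (rule vitali_intervals[OF G fine]) auto
  let ?T = "\<Union>(s, t)\<in>C. {s..t}"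
  have T: "?T \<in> sets borel" using C(1) by (intro sets.countable_UN') auto
  show thesis
  proof (rule that[of "\<Union>(s, t)\<in>C. {s<..<t}"])
    show "open (\<Union>(s, t)\<in>C. {s<..<t})" by auto
    show "(\<Union>(s, t)\<in>C. {s<..<t}) \<subseteq> G" using C(2) by force
    have "S - (\<Union>(s, t)\<in>C. {s<..<t}) \<subseteq> (S - ?T) \<union> (fst ` C \<union> snd ` C)"
      by (force simp: less_le)
    moreover have "negligible ((S - ?T) \<union> (fst ` C \<union> snd ` C))"
      using C by (intro negligible_Un[OF C(4)] countable_negligible) auto
    ultimately show "negligible (S - (\<Union>(s, t)\<in>C. {s<..<t}))"
      by (rule negligible_subset[rotated])
    have "emeasure (interval_measure F) (\<Union>(s, t)\<in>C. {s<..<t}) \<le> emeasure (interval_measure F) ?T"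
      using T by (intro emeasure_mono UN_mono) auto
    also have "\<dots> = (\<integral>\<^sup>+x. (case x of (s,t) \<Rightarrow> emeasure (interval_measure F) {s..t}) \<partial>count_space C)"
      using C by (subst emeasure_disjoint_intervals) auto
    also have "\<dots> \<le> (\<integral>\<^sup>+x. ennreal p * (case x of (s,t) \<Rightarrow> emeasure lborel {s..t}) \<partial>count_space C)"
    proof (intro nn_integral_mono, clarsimp)
      fix s t assume "(s, t) \<in> C"
      with C(2) have "s < t" "F t - F s \<le> p * (t - s)" by auto
      then show "emeasure (interval_measure F) {s..t} \<le> ennreal p * emeasure lborel {s..t}"
        using p by (auto simp: interval_measure_Icc ennreal_mult' [symmetric] intro!: ennreal_leI)
    qed
    also have "\<dots> = ennreal p * (\<integral>\<^sup>+x. (case x of (s,t) \<Rightarrow> emeasure lborel {s..t}) \<partial>count_space C)"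
      by (simp add: nn_integral_cmult)
    also have "\<dots> = ennreal p * emeasure lborel ?T"
      using C by (subst emeasure_disjoint_intervals) auto
    also have "\<dots> \<le> ennreal p * emeasure lborel G"
      using G C(2) by (intro mult_left_mono emeasure_mono) auto
    finally show "emeasure (interval_measure F) (\<Union>(s, t)\<in>C. {s<..<t}) \<le> ennreal p * emeasure lborel G" .
  qed
qed

lemma outer_bounded_finite: "S \<subseteq> {a<..<b} \<Longrightarrow> outer_measure_of lebesgue S < \<infinity>" for a b :: real
proof -
  assume "S \<subseteq> {a<..<b}"
  then have "outer_measure_of lebesgue S \<le> outer_measure_of lebesgue {a<..<b}"
    by (rule outer_measure_of_mono)
  also have "\<dots> = emeasure lborel {a<..<b}" by simp
  also have "\<dots> < \<infinity>" by (cases "a \<le> b") auto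
  finally show ?thesis .
qed

text \<open>Let \<open>e\<close> be the outer measure of \<open>S\<close>. Covering \<open>S\<close> by flat intervals inside an open set of measure
  at most \<open>e + \<epsilon>\<close>, and then by steep intervals inside those, gives \<open>q * e \<le> p * (e + \<epsilon>)\<close>, which forces
  \<open>e = 0\<close> because \<open>p < q\<close>.\<close>

lemma negligible_gap_set:
  assumes S: "S \<subseteq> {a<..<b}" and pq: "0 \<le> p" "p < q"
    and lower: "\<And>x d. x \<in> S \<Longrightarrow> d > 0 \<Longrightarrow>
      \<exists>s t. s < t \<and> s \<le> x \<and> x \<le> t \<and> t - s < d \<and> F t - F s \<le> p * (t - s)"
    and upper: "\<And>x d. x \<in> S \<Longrightarrow> d > 0 \<Longrightarrow>
      \<exists>s t. s < t \<and> s \<le> x \<and> x \<le> t \<and> t - s < d \<and> q * (t - s) \<le> F t - F s"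
  shows "negligible S"
proof -
  define e where "e = outer_measure_of lebesgue S"
  have fin: "e < \<infinity>" using outer_bounded_finite[OF S] by (simp add: e_def)
  have key: "ennreal q * e \<le> ennreal p * (e + ennreal \<epsilon>)" if "\<epsilon> > 0" for \<epsilon>
  proof -
    obtain G where G: "open G" "S \<subseteq> G" "G \<subseteq> {a<..<b}" "emeasure lborel G \<le> e + ennreal \<epsilon>"
      by (rule outer_lebesgue_open[OF S open_greaterThanLessThan \<open>\<epsilon> > 0\<close> fin[unfolded e_def], folded e_def])
    obtain T where T: "open T" "T \<subseteq> G" "negligible (S - T)"
      "emeasure (interval_measure F) T \<le> ennreal p * emeasure lborel G"
      by (rule open_cover_of_flat[OF G(1,2) pq(1) lower]) auto
    have "e \<le> outer_measure_of lebesgue (S \<inter> T)"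
      unfolding e_def using T(3) by (intro outer_lebesgue_le_of_negligible_diff) (simp add: Diff_Int)
    then have "ennreal q * e \<le> ennreal q * outer_measure_of lebesgue (S \<inter> T)"
      by (intro mult_left_mono) auto
    also have "\<dots> \<le> emeasure (interval_measure F) T"
      using pq upper by (intro outer_le_interval_measure_of_steep T) auto
    also have "\<dots> \<le> ennreal p * (e + ennreal \<epsilon>)"
      using T(4) G(4) by (meson mult_left_mono order_trans zero_le)
    finally show ?thesis .
  qed
  obtain e' where e': "e = ennreal e'" "e' \<ge> 0" using fin by (cases e) auto
  have "q * e' \<le> p * (e' + \<epsilon>)" if "\<epsilon> > 0" for \<epsilon>
    using key[OF that] that e' pq
    by (simp add: ennreal_plus[symmetric] ennreal_mult'[symmetric] del: ennreal_plus)
  then have "(q - p) * e' \<le> p * \<epsilon>" if "\<epsilon> > 0" for \<epsilon> using that by (force simp: algebra_simps)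
  then have "\<forall>\<^sub>F \<epsilon> in at_right 0. (q - p) * e' \<le> p * \<epsilon>"
    by (auto simp: eventually_at_right_field intro!: exI[of _ 1])
  moreover have "((\<lambda>\<epsilon>. p * \<epsilon>) \<longlongrightarrow> p * 0) (at_right 0)" by (intro tendsto_intros)
  ultimately have "(q - p) * e' \<le> 0"
    using tendsto_lowerbound[of "\<lambda>\<epsilon>. p * \<epsilon>" "p * 0" "at_right 0"] by simp
  with pq e' have "e' = 0" by (simp add: mult_le_0_iff)
  then show ?thesis by (simp add: negligible_iff_outer_lebesgue e'[unfolded e_def])
qed

text \<open>The measure of \<open>S\<close> times any \<open>K\<close> is at most the total increment of \<open>F\<close>.\<close>

lemma negligible_infinite_slope_set:
  assumes S: "S \<subseteq> {a<..<b}" 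
    and upper: "\<And>x d K. x \<in> S \<Longrightarrow> d > 0 \<Longrightarrow> K \<ge> 0 \<Longrightarrow>
      \<exists>s t. s < t \<and> s \<le> x \<and> x \<le> t \<and> t - s < d \<and> K * (t - s) \<le> F t - F s"
  shows "negligible S"
proof -
  define e where "e = outer_measure_of lebesgue S"
  have fin: "e < \<infinity>" using outer_bounded_finite[OF S] by (simp add: e_def)
  obtain e' where e': "e = ennreal e'" "e' \<ge> 0" using fin by (cases e) auto
  define V where "V = max 0 (F b - F a)"
  have "K * e' \<le> V" if K: "K \<ge> 0" for K
  proof -
    have "ennreal K * e \<le> emeasure (interval_measure F) {a<..<b}"
      unfolding e_def using S K upper by (intro outer_le_interval_measure_of_steep) auto
    also have "\<dots> \<le> emeasure (interval_measure F) {a..b}" by (intro emeasure_mono) auto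
    also have "\<dots> \<le> ennreal V"
      by (cases "a \<le> b") (auto simp: interval_measure_Icc V_def intro: ennreal_leI)
    finally show ?thesis using e' K by (auto simp: ennreal_mult'[symmetric] V_def)
  qed
  from this[of "(V + 1) / e'"] have "e' = 0"
    using e' by (cases "e' = 0") (auto simp: V_def divide_simps)
  then show ?thesis by (simp add: negligible_iff_outer_lebesgue e'[unfolded e_def])
qed

lemma slope_nonneg: "h \<noteq> 0 \<Longrightarrow> 0 \<le> (F (x + h) - F x) / h"
  using monoD[OF mono, of x "x + h"] monoD[OF mono, of "x + h" x]
  by (cases "h > 0") (auto simp: divide_nonneg_nonneg intro: divide_nonpos_nonpos)

lemma interval_of_slope:
  assumes fr: "\<exists>\<^sub>F h in at 0. P ((F (x + h) - F x) / h)" and d: "d > (0::real)"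
  shows "\<exists>s t. s < t \<and> s \<le> x \<and> x \<le> t \<and> t - s < d \<and> P ((F t - F s) / (t - s))"
proof -
  have "\<exists>h. h \<noteq> 0 \<and> dist h 0 < d \<and> P ((F (x + h) - F x) / h)"
    using fr d unfolding frequently_def eventually_at by auto
  then obtain h where h: "h \<noteq> 0" "\<bar>h\<bar> < d" "P ((F (x + h) - F x) / h)"
    by (auto simp: dist_real_def)
  show ?thesis
  proof (cases "h > 0")
    case True then show ?thesis using h by (intro exI[of _ x] exI[of _ "x + h"]) auto
  next
    case False
    moreover have "(F (x + h) - F x) / h = (F x - F (x + h)) / (x - (x + h))"
      using h by (auto simp: field_simps)
    ultimately show ?thesis using h by (intro exI[of _ "x + h"] exI[of _ x]) auto
  qed
qed

lemma mono_differentiable_ae_bounded: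
  "negligible {x \<in> {a<..<b}. \<not> F differentiable (at x)}"
proof -
  \<comment> \<open>A point without derivative either has unbounded difference quotients or admits rationals \<open>p < q\<close>
    strictly between the lower and the upper limit of the quotients.\<close>
  define Q where "Q = (\<lambda>x h. (F (x + h) - F x) / h)"
  define E where "E = (\<lambda>p q. {x \<in> {a<..<b}. (\<exists>\<^sub>F h in at 0. Q x h < p) \<and> (\<exists>\<^sub>F h in at 0. Q x h > q)})"
  define I where "I = {x \<in> {a<..<b}. \<forall>K. \<exists>\<^sub>F h in at 0. Q x h > K}"
  have conv: "\<exists>s t. s < t \<and> s \<le> x \<and> x \<le> t \<and> t - s < d \<and> q * (t - s) \<le> F t - F s"
    if "\<exists>\<^sub>F h in at 0. Q x h > q" "d > 0" for x d q
    using interval_of_slope[of "\<lambda>y. y > q" x d] that unfolding Q_def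
    by (auto simp: less_divide_eq) (meson le_less)
  have conv': "\<exists>s t. s < t \<and> s \<le> x \<and> x \<le> t \<and> t - s < d \<and> F t - F s \<le> p * (t - s)"
    if "\<exists>\<^sub>F h in at 0. Q x h < p" "d > 0" for x d p
    using interval_of_slope[of "\<lambda>y. y < p" x d] that unfolding Q_def
    by (auto simp: divide_less_eq) (meson le_less)
  have nE: "negligible (E p q)" if "p < q" for p q
  proof (cases "p \<ge> 0")
    case True
    show ?thesis
      by (rule negligible_gap_set[of _ a b p q]) (use that True conv conv' in \<open>auto simp: E_def\<close>)
  next
    case False
    have "\<forall>\<^sub>F h in at 0. \<not> Q x h < p" for x
      using False unfolding Q_def eventually_at
      by (intro exI[of _ 1]) (auto simp: not_less intro!: order_trans[OF _ slope_nonneg])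
    then have "E p q = {}" by (auto simp: E_def frequently_def)
    then show ?thesis by simp
  qed
  have nI: "negligible I"
    by (rule negligible_infinite_slope_set[of _ a b]) (use conv in \<open>auto simp: I_def\<close>)
  define B where "B = I \<union> (\<Union>pq\<in>{pq :: rat \<times> rat. fst pq < snd pq}. E (of_rat (fst pq)) (of_rat (snd pq)))"
  have "negligible B" unfolding B_def
    by (intro negligible_Un nI negligible_countable_Union)
       (auto intro!: nE countable_image simp: of_rat_less)
  moreover have "F differentiable (at x)" if x: "x \<in> {a<..<b}" "x \<notin> B" for x
  proof -
    let ?q = "\<lambda>h. ereal (Q x h)"
    obtain K where K: "\<forall>\<^sub>F h in at 0. Q x h \<le> K"
      using x by (auto simp: B_def I_def frequently_def not_less)
    have "\<not> Liminf (at 0) ?q < Limsup (at 0) ?q"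
    proof
      assume "Liminf (at 0) ?q < Limsup (at 0) ?q"
      then obtain p where p: "Liminf (at 0) ?q < ereal (of_rat p)" "ereal (of_rat p) < Limsup (at 0) ?q"
        using ereal_dense3 by blast
      then obtain q where q: "ereal (of_rat p) < ereal (of_rat q)" "ereal (of_rat q) < Limsup (at 0) ?q"
        using ereal_dense3 by blast
      have "\<exists>\<^sub>F h in at 0. Q x h < of_rat p"
      proof (rule ccontr)
        assume "\<not> ?thesis"
        then have "\<forall>\<^sub>F h in at 0. ereal (of_rat p) \<le> ?q h" by (simp add: frequently_def not_less)
        then have "ereal (of_rat p) \<le> Liminf (at 0) ?q" by (rule Liminf_bounded)
        with p show False by simp
      qed
      moreover have "\<exists>\<^sub>F h in at 0. Q x h > of_rat q"
      proof (rule ccontr)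
        assume "\<not> ?thesis"
        then have "\<forall>\<^sub>F h in at 0. ?q h \<le> ereal (of_rat q)" by (simp add: frequently_def not_less)
        then have "Limsup (at 0) ?q \<le> ereal (of_rat q)" by (rule Limsup_bounded)
        with q show False by simp
      qed
      moreover have "p < q" using q by (simp add: of_rat_less)
      ultimately have "x \<in> B" using x by (auto simp: B_def E_def intro!: bexI[of _ "(p, q)"])
      with x show False by simp
    qed
    then have eq: "Liminf (at 0) ?q = Limsup (at 0) ?q"
      using Liminf_le_Limsup[of "at (0::real)" ?q] by (auto simp: le_less)
    have "Limsup (at 0) ?q \<le> ereal K" using K by (intro Limsup_bounded) simp
    moreover have "ereal 0 \<le> Liminf (at 0) ?q"
      unfolding Q_def eventually_at
      by (intro Liminf_bounded, unfold eventually_at, intro exI[of _ 1]) (auto intro!: slope_nonneg)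
    ultimately obtain l where l: "Limsup (at 0) ?q = ereal l"
      using eq by (cases "Limsup (at 0) ?q") auto
    then have "(?q \<longlongrightarrow> ereal l) (at 0)" using eq by (intro Liminf_eq_Limsup) auto
    then have "(Q x \<longlongrightarrow> l) (at 0)" by simp
    then have "(F has_real_derivative l) (at x)" unfolding Q_def DERIV_def .
    then show ?thesis using real_differentiable_def by blast
  qed
  then have "{x \<in> {a<..<b}. \<not> F differentiable (at x)} \<subseteq> B" by auto
  ultimately show ?thesis by (rule negligible_subset)
qed

text \<open>Lebesgue's differentiation theorem for continuous monotone functions.\<close>

theorem mono_differentiable_ae: "negligible {x. \<not> F differentiable (at x)}"
proof -
  have "\<exists>n::nat. - real n < x \<and> x < real n" for x :: real
    using reals_Archimedean2[of "\<bar>x\<bar>"] by (metis abs_less_iff minus_less_iff)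
  then have "{x. \<not> F differentiable (at x)} \<subseteq> (\<Union>n::nat. {x \<in> {-real n<..<real n}. \<not> F differentiable (at x)})"
    by auto
  moreover have "negligible (\<Union>n::nat. {x \<in> {-real n<..<real n}. \<not> F differentiable (at x)})"
    by (intro negligible_Union_nat mono_differentiable_ae_bounded)
  ultimately show ?thesis by (rule negligible_subset[rotated])
qed

end

section \<open>Derivatives of absolutely continuous functions\<close>

definition interval_family :: "real \<Rightarrow> real \<Rightarrow> nat \<Rightarrow> (nat \<Rightarrow> real) \<Rightarrow> (nat \<Rightarrow> real) \<Rightarrow> bool" where
  "interval_family x y n l u \<longleftrightarrow> (\<forall>i<n. l i \<le> u i \<and> {l i..u i} \<subseteq> {x..y}) \<and>
     disjoint_family_on (\<lambda>i. {l i<..<u i}) {..<n}"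

text \<open>Families may be empty and may contain degenerate intervals, as in the definition of absolute
  continuity; hence \<open>0\<close> always belongs to this set.\<close>

definition variation_sums :: "(real \<Rightarrow> real) \<Rightarrow> real \<Rightarrow> real \<Rightarrow> real set" where
  "variation_sums f x y = {\<Sum>i<n. \<bar>f (u i) - f (l i)\<bar> | n l u. interval_family x y n l u}"

lemma variation_sums_zero: "0 \<in> variation_sums f x y"
  unfolding variation_sums_def interval_family_def
  by (intro CollectI exI[of _ "0::nat"]) (auto simp: disjoint_family_on_def)

lemma variation_sums_mono: "y \<le> z \<Longrightarrow> variation_sums f x y \<subseteq> variation_sums f x z"
proof -
  assume "y \<le> z"
  then have "interval_family x y n l u \<Longrightarrow> interval_family x z n l u" for n l u
    unfolding interval_family_def by force
  then show ?thesis unfolding variation_sums_def by blast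
qed

text \<open>Each interval is cut at \<open>y\<close>. Clipping its endpoints to \<open>y\<close> by \<open>min\<close> and \<open>max\<close> keeps the number of
  intervals, at the price of degenerate ones, which contribute nothing.\<close>

lemma variation_sums_split:
  assumes "s \<in> variation_sums f x z" "x \<le> y" "y \<le> z"
  obtains s1 s2 where "s1 \<in> variation_sums f x y" "s2 \<in> variation_sums f y z" "s \<le> s1 + s2"
proof -
  obtain n l u where F: "interval_family x z n l u" and s: "s = (\<Sum>i<n. \<bar>f (u i) - f (l i)\<bar>)"
    using assms(1) by (auto simp: variation_sums_def)
  have le: "l i \<le> u i" "x \<le> l i" "u i \<le> z" if "i < n" for i
    using F that by (auto simp: interval_family_def)
  have dj: "{l i<..<u i} \<inter> {l j<..<u j} = {}" if "i < n" "j < n" "i \<noteq> j" for i j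
    using F that by (auto simp: interval_family_def disjoint_family_on_def)
  have "interval_family x y n (\<lambda>i. min (l i) y) (\<lambda>i. min (u i) y)"
    unfolding interval_family_def disjoint_family_on_def
  proof (intro conjI allI ballI impI)
    fix i j assume "i \<in> {..<n}" "j \<in> {..<n}" "i \<noteq> j"
    then have "{l i<..<u i} \<inter> {l j<..<u j} = {}" using dj by auto
    moreover have "{min (l i) y<..<min (u i) y} \<subseteq> {l i<..<u i}" for i by auto
    ultimately show "{min (l i) y<..<min (u i) y} \<inter> {min (l j) y<..<min (u j) y} = {}" by blast
  qed (use le assms in force)+
  moreover have "interval_family y z n (\<lambda>i. max (l i) y) (\<lambda>i. max (u i) y)"
    unfolding interval_family_def disjoint_family_on_def
  proof (intro conjI allI ballI impI)
    fix i j assume "i \<in> {..<n}" "j \<in> {..<n}" "i \<noteq> j"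
    then have "{l i<..<u i} \<inter> {l j<..<u j} = {}" using dj by auto
    moreover have "{max (l i) y<..<max (u i) y} \<subseteq> {l i<..<u i}" for i by auto
    ultimately show "{max (l i) y<..<max (u i) y} \<inter> {max (l j) y<..<max (u j) y} = {}" by blast
  qed (use le assms in force)+
  moreover have "s \<le> (\<Sum>i<n. \<bar>f (min (u i) y) - f (min (l i) y)\<bar>) + (\<Sum>i<n. \<bar>f (max (u i) y) - f (max (l i) y)\<bar>)"
    unfolding s sum.distrib[symmetric]
    by (intro sum_mono) (auto simp: min_def max_def)
  ultimately show thesis using that unfolding variation_sums_def by blast
qed

lemma variation_sums_append:
  assumes "s \<in> variation_sums f x y" "x \<le> y" "y \<le> z"
  shows "s + \<bar>f z - f y\<bar> \<in> variation_sums f x z"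
proof -
  obtain n l u where F: "interval_family x y n l u" and s: "s = (\<Sum>i<n. \<bar>f (u i) - f (l i)\<bar>)"
    using assms(1) by (auto simp: variation_sums_def)
  let ?l = "l(n := y)" and ?u = "u(n := z)"
  have in_xy: "x \<le> l i" "l i \<le> u i" "u i \<le> y" if "i < n" for i
    using F that by (auto simp: interval_family_def)
  have "interval_family x z (Suc n) ?l ?u"
    unfolding interval_family_def
  proof (intro conjI allI impI)
    show "disjoint_family_on (\<lambda>i. {?l i<..<?u i}) {..<Suc n}"
      using F in_xy unfolding interval_family_def disjoint_family_on_def
      by (auto simp: less_Suc_eq) fastforce+
  qed (use in_xy assms in \<open>force simp: less_Suc_eq\<close>)+
  moreover have "s + \<bar>f z - f y\<bar> = (\<Sum>i<Suc n. \<bar>f (?u i) - f (?l i)\<bar>)"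
    unfolding s by simp
  ultimately show ?thesis unfolding variation_sums_def by blast
qed

lemma interval_family_length:
  assumes "interval_family x y n l u" "x \<le> y"
  shows "(\<Sum>i<n. u i - l i) \<le> y - x"
proof -
  have le: "l i \<le> u i" "x \<le> l i" "u i \<le> y" if "i < n" for i
    using assms that by (auto simp: interval_family_def)
  have "(\<Sum>i<n. u i - l i) = (\<Sum>i<n. measure lborel {l i<..<u i})"
    using le by (intro sum.cong) auto
  also have "\<dots> = measure lborel (\<Union>i<n. {l i<..<u i})"
    using assms le by (intro measure_finite_Union[symmetric]) (auto simp: interval_family_def)
  also have "\<dots> \<le> measure lborel {x..y}"
  proof (intro measure_mono_fmeasurable UN_least)
    show "{l i<..<u i} \<subseteq> {x..y}" if "i \<in> {..<n}" for i
      using le[of i] that by (auto intro: order_trans less_imp_le)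
    show "{x..y} \<in> fmeasurable lborel" by (intro fmeasurableI) (auto simp: assms)
  qed auto
  also have "\<dots> = y - x" using assms by simp
  finally show ?thesis .
qed

lemma variation_sums_small:
  assumes "abs_continuous_on {a..} f" "\<epsilon> > 0"
  obtains \<delta> where "\<delta> > 0" "\<And>x y s. a \<le> x \<Longrightarrow> x \<le> y \<Longrightarrow> y - x < \<delta> \<Longrightarrow> s \<in> variation_sums f x y \<Longrightarrow> s < \<epsilon>"
proof -
  obtain \<delta> where \<delta>: "\<delta> > 0" "\<forall>(n::nat) l u. (\<forall>i<n. l i \<le> u i \<and> {l i..u i} \<subseteq> {a..}) \<and>
      disjoint_family_on (\<lambda>i. {l i<..<u i}) {..<n} \<and> (\<Sum>i<n. u i - l i) < \<delta> \<longrightarrow>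
        (\<Sum>i<n. \<bar>f (u i) - f (l i)\<bar>) < \<epsilon>"
    using assms(1)[unfolded abs_continuous_on_def, rule_format, OF assms(2)] by blast
  show thesis
  proof (rule that[OF \<delta>(1)])
    fix x y s assume *: "a \<le> x" "x \<le> y" "y - x < \<delta>" "s \<in> variation_sums f x y"
    then obtain n l u where F: "interval_family x y n l u" and s: "s = (\<Sum>i<n. \<bar>f (u i) - f (l i)\<bar>)"
      by (auto simp: variation_sums_def)
    show "s < \<epsilon>" unfolding s
    proof (rule \<delta>(2)[rule_format], intro conjI)
      show "(\<Sum>i<n. u i - l i) < \<delta>" using interval_family_length[OF F] * by simp
      show "disjoint_family_on (\<lambda>i. {l i<..<u i}) {..<n}" using F by (simp add: interval_family_def)
      show "\<forall>i<n. l i \<le> u i \<and> {l i..u i} \<subseteq> {a..}" using F * unfolding interval_family_def by force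
    qed
  qed
qed

text \<open>Absolute continuity bounds the variation over each interval of some fixed length by \<open>1\<close>, and
  finitely many such intervals reach from \<open>a\<close> to \<open>x\<close>.\<close>

lemma variation_sums_bdd:
  assumes "abs_continuous_on {a..} f" "a \<le> x"
  shows "bdd_above (variation_sums f a x)"
proof -
  obtain \<delta> where \<delta>: "\<delta> > 0" "\<And>x y s. a \<le> x \<Longrightarrow> x \<le> y \<Longrightarrow> y - x < \<delta> \<Longrightarrow> s \<in> variation_sums f x y \<Longrightarrow> s < 1"
    using variation_sums_small[OF assms(1), of 1] by auto
  have *: "\<forall>s \<in> variation_sums f a (a + real k * (\<delta> / 2)). s \<le> real (k + 1)" for k
  proof (induction k)
    case 0
    then show ?case using \<delta> by force
  next
    case (Suc k)
    show ?case
    proof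
      fix s assume s: "s \<in> variation_sums f a (a + real (Suc k) * (\<delta> / 2))"
      obtain s1 s2 where "s1 \<in> variation_sums f a (a + real k * (\<delta> / 2))"
         "s2 \<in> variation_sums f (a + real k * (\<delta> / 2)) (a + real (Suc k) * (\<delta> / 2))" "s \<le> s1 + s2"
        using variation_sums_split[OF s, of "a + real k * (\<delta> / 2)"] \<delta>(1) by (auto simp: algebra_simps)
      moreover from this have "s2 < 1" using \<delta> by (intro \<delta>(2)) (auto simp: algebra_simps)
      ultimately show "s \<le> real (Suc k + 1)" using Suc by fastforce
    qed
  qed
  obtain k where "(x - a) / (\<delta> / 2) \<le> real k" using real_arch_simple by blast
  then have "x \<le> a + real k * (\<delta> / 2)" using \<delta> by (simp add: field_simps)
  then have "variation_sums f a x \<subseteq> variation_sums f a (a + real k * (\<delta> / 2))"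
    by (rule variation_sums_mono)
  with * show ?thesis by (intro bdd_aboveI[of _ "real (k + 1)"]) blast
qed

text \<open>The function \<open>V\<close> is the total variation of \<open>f\<close> over \<open>{a..x}\<close>. Extending \<open>f\<close> by its value at \<open>a\<close> to
  the left of \<open>a\<close> makes everything global on the line.\<close>

lemma abs_continuous_variation:
  assumes ac: "abs_continuous_on {a..} f"
  obtains V where "mono V" "continuous_on UNIV V"
    "\<And>x y. x \<le> y \<Longrightarrow> \<bar>f (max a y) - f (max a x)\<bar> \<le> V y - V x"
proof -
  define W where "W = (\<lambda>x. Sup (variation_sums f a x))"
  have W_upper: "s \<le> W x" if "s \<in> variation_sums f a x" "a \<le> x" for s x
    unfolding W_def using that variation_sums_bdd[OF ac] by (intro cSup_upper) auto
  have W_diff: "\<bar>f y - f x\<bar> \<le> W y - W x" if "a \<le> x" "x \<le> y" for x y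
  proof -
    have "W x \<le> W y - \<bar>f y - f x\<bar>"
      unfolding W_def[of] using variation_sums_zero
    proof (intro cSup_least)
      fix s assume "s \<in> variation_sums f a x"
      then have "s + \<bar>f y - f x\<bar> \<le> W y"
        using that by (intro W_upper variation_sums_append) auto
      then show "s \<le> Sup (variation_sums f a y) - \<bar>f y - f x\<bar>" by (simp add: W_def)
    qed auto
    then show ?thesis by simp
  qed
  have cont: "continuous_on {a..} W"
    unfolding continuous_on_iff
  proof (intro ballI allI impI)
    fix x and e :: real assume x: "x \<in> {a..}" and e: "e > 0"
    obtain \<delta> where \<delta>: "\<delta> > 0" "\<And>x y s. a \<le> x \<Longrightarrow> x \<le> y \<Longrightarrow> y - x < \<delta> \<Longrightarrow> s \<in> variation_sums f x y \<Longrightarrow> s < e / 2"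
      using variation_sums_small[OF ac, of "e / 2"] e by auto
    have small: "W y - W x \<le> e / 2" if xy: "a \<le> x" "x \<le> y" "y - x < \<delta>" for x y
    proof -
      have "W y \<le> W x + e / 2"
        unfolding W_def[of]
      proof (rule cSup_least)
        fix s assume "s \<in> variation_sums f a y"
        then obtain s1 s2 where s: "s1 \<in> variation_sums f a x" "s2 \<in> variation_sums f x y" "s \<le> s1 + s2"
          using variation_sums_split[of s f a y x] xy by blast
        then have "s1 \<le> W x" "s2 < e / 2" using W_upper \<delta> that by auto
        then show "s \<le> Sup (variation_sums f a x) + e / 2" using s by (simp add: W_def)
      qed (use variation_sums_zero in auto)
      then show ?thesis by simp
    qed
    show "\<exists>d>0. \<forall>x'\<in>{a..}. dist x' x < d \<longrightarrow> dist (W x') (W x) < e"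
    proof (intro exI[of _ \<delta>] conjI ballI impI)
      fix x' assume "x' \<in> {a..}" "dist x' x < \<delta>"
      then show "dist (W x') (W x) < e"
        using small[of x x'] small[of x' x] W_diff[of x x'] W_diff[of x' x] x e
        by (cases "x \<le> x'") (auto simp: dist_real_def)
    qed (use \<delta> in auto)
  qed
  show thesis
  proof (rule that[of "\<lambda>x. W (max a x)"])
    have m: "max a x \<le> max a y" if "x \<le> y" for x y :: real using that by auto
    show "\<bar>f (max a y) - f (max a x)\<bar> \<le> W (max a y) - W (max a x)" if "x \<le> y" for x y
      using that by (intro W_diff) auto
    then show "mono (\<lambda>x. W (max a x))" by (intro monoI) (smt (verit))
    show "continuous_on UNIV (\<lambda>x. W (max a x))"
      by (intro continuous_on_compose2[OF cont] continuous_intros) auto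
  qed
qed

text \<open>With an antiderivative \<open>P\<close> of \<open>V\<close> the integral equals the difference of the slopes of \<open>P\<close> over
  \<open>{t..t + h}\<close> and \<open>{s..s + h}\<close>, which are values of \<open>V\<close>. The bound is uniform in \<open>h\<close>, as Fatou's lemma
  requires.\<close>

lemma nn_integral_slope_le:
  fixes V :: "real \<Rightarrow> real"
  assumes V: "mono V" "continuous_on UNIV V" and st: "s \<le> t" and h: "0 < h" "h \<le> 1"
  shows "(\<integral>\<^sup>+x. ennreal ((V (x + h) - V x) / h) * indicator {s..t} x \<partial>lborel) \<le> ennreal (V (t + 1) - V s)"
proof -
  have "isCont V x" for x using V(2) by (simp add: continuous_on_eq_continuous_at)
  then obtain P where P: "\<And>x. (P has_vector_derivative V x) (at x)"
    using einterval_antiderivative[of "-\<infinity>" "\<infinity>" V] by auto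
  then have D: "(P has_real_derivative V x) (at x)" for x
    by (simp add: has_real_derivative_iff_has_vector_derivative)
  let ?G = "\<lambda>x. (P (x + h) - P x) / h"
  have "(\<integral>\<^sup>+x. ennreal ((V (x + h) - V x) / h) * indicator {s..t} x \<partial>lborel) = ennreal (?G t - ?G s)"
  proof (rule nn_integral_FTC_Icc)
    have "V \<in> borel_measurable borel" using V by (simp add: borel_measurable_continuous_onI)
    then show "(\<lambda>x. (V (x + h) - V x) / h) \<in> borel_measurable borel" by measurable
    show "(?G has_real_derivative (V (x + h) - V x) / h) (at x)" for x
    proof -
      have "((\<lambda>x. P (x + h)) has_real_derivative V (x + h)) (at x)"
        by (rule DERIV_shift[THEN iffD1, OF D])
      then show ?thesis using D by (intro DERIV_cdivide DERIV_diff)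
    qed
    show "0 \<le> (V (x + h) - V x) / h" for x using V h by (simp add: monoD)
  qed (use st in auto)
  also have "\<dots> \<le> ennreal (V (t + 1) - V s)"
  proof (rule ennreal_leI)
    obtain y where y: "y > t" "y < t + h" "P (t + h) - P t = (t + h - t) * V y"
      using MVT2[of t "t + h" P V] D h by auto
    obtain z where z: "z > s" "z < s + h" "P (s + h) - P s = (s + h - s) * V z"
      using MVT2[of s "s + h" P V] D h by auto
    have "V y \<le> V (t + 1)" "V s \<le> V z" using y z h by (auto intro!: monoD[OF V(1)])
    then show "?G t - ?G s \<le> V (t + 1) - V s" using y z h by (simp add: diff_divide_distrib)
  qed
  finally show ?thesis .
qed

text \<open>Both \<open>V\<close> and \<open>V - F\<close> are monotone and continuous, so \<open>F\<close> is differentiable almost everywhere.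
  Its difference quotients are dominated by those of \<open>V\<close>, and Fatou's lemma makes the derivative
  locally integrable. The limit of the quotients along \<open>1/(n+1)\<close> is a Borel version of it.\<close>

lemma dominated_by_mono_derivative:
  fixes F V :: "real \<Rightarrow> real"
  assumes V: "mono V" "continuous_on UNIV V" and FV: "\<And>x y. x \<le> y \<Longrightarrow> \<bar>F y - F x\<bar> \<le> V y - V x"
  obtains D where "D \<in> borel_measurable borel" "\<And>s t. set_integrable lborel {s..t} D"
    "negligible {x. \<not> (F has_real_derivative D x) (at x)}"
proof -
  have contF: "continuous_on UNIV F"
    unfolding continuous_on_iff
  proof (intro ballI allI impI)
    fix x e :: real assume "e > 0"
    then obtain d where "d > 0" "\<And>y. dist y x < d \<Longrightarrow> dist (V y) (V x) < e"
      using V(2) unfolding continuous_on_iff by blast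
    moreover have "dist (F y) (F x) \<le> dist (V y) (V x)" for y
      using FV[of x y] FV[of y x] unfolding dist_real_def by linarith
    ultimately show "\<exists>d>0. \<forall>x'\<in>UNIV. dist x' x < d \<longrightarrow> dist (F x') (F x) < e"
      by (meson le_less_trans)
  qed
  have "mono (\<lambda>x. V x - F x)" using FV by (intro monoI) (smt (verit))
  then have n: "negligible ({x. \<not> V differentiable (at x)} \<union> {x. \<not> (\<lambda>x. V x - F x) differentiable (at x)})"
    by (intro negligible_Un mono_differentiable_ae V continuous_intros contF)
  have neg: "negligible {x. \<not> F differentiable (at x)}"
  proof (rule negligible_subset[OF n], rule subsetI, rule ccontr)
    fix x assume "x \<in> {x. \<not> F differentiable (at x)}"
      "x \<notin> {x. \<not> V differentiable (at x)} \<union> {x. \<not> (\<lambda>x. V x - F x) differentiable (at x)}"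
    then have "\<not> F differentiable (at x)" "V differentiable (at x)" "(\<lambda>x. V x - F x) differentiable (at x)"
      by auto
    then have "(\<lambda>x. V x - (V x - F x)) differentiable (at x)"
      by (metis differentiable_diff)
    then have "F differentiable (at x)" by simp
    then show False using \<open>\<not> F differentiable (at x)\<close> by simp
  qed
  define h where "h = (\<lambda>n. inverse (real (Suc n)))"
  have h: "0 < h n" "h n \<le> 1" for n by (auto simp: h_def divide_simps)
  have h0: "filterlim h (at 0) sequentially"
    unfolding filterlim_at
  proof
    show "h \<longlonglongrightarrow> 0" unfolding h_def by (rule LIMSEQ_inverse_real_of_nat)
    show "\<forall>\<^sub>F x in sequentially. h x \<in> UNIV \<and> h x \<noteq> 0"
      using h(1) by (intro always_eventually) (simp add: less_imp_neq[symmetric])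
  qed
  define Q where "Q = (\<lambda>n x. (F (x + h n) - F x) / h n)"
  define D where "D = (\<lambda>x. lim (\<lambda>n. Q n x))"
  have Fm: "F \<in> borel_measurable borel" using contF by (simp add: borel_measurable_continuous_onI)
  have Qm[measurable]: "Q n \<in> borel_measurable borel" for n unfolding Q_def using Fm by measurable
  have Dm[measurable]: "D \<in> borel_measurable borel" unfolding D_def by measurable
  have Qlim: "(\<lambda>n. Q n x) \<longlonglongrightarrow> y" if "(F has_real_derivative y) (at x)" for x y
    using filterlim_compose[OF that[unfolded DERIV_def] h0] by (simp add: Q_def)
  have D: "(F has_real_derivative D x) (at x)" if diff: "F differentiable (at x)" for x
  proof -
    obtain y where y: "(F has_real_derivative y) (at x)"
      using diff by (auto simp: real_differentiable_def)
    then have "D x = y" unfolding D_def by (intro limI Qlim)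
    then show ?thesis using y by simp
  qed
  have ae: "AE x in lborel. F differentiable (at x)"
  proof -
    have "{x. \<not> F differentiable (at x)} \<in> null_sets lebesgue"
      using neg unfolding negligible_iff_null_sets .
    from AE_not_in[OF this] show ?thesis unfolding AE_completion_iff by simp
  qed
  show thesis
  proof (rule that[OF Dm])
    show "negligible {x. \<not> (F has_real_derivative D x) (at x)}"
      using D by (intro negligible_subset[OF neg]) auto
    show "set_integrable lborel {s..t} D" for s t
    proof (cases "s \<le> t")
      case True
      have "(\<integral>\<^sup>+x. ennreal (norm (indicator {s..t} x *\<^sub>R D x)) \<partial>lborel)
          = (\<integral>\<^sup>+x. liminf (\<lambda>n. ennreal \<bar>Q n x\<bar> * indicator {s..t} x) \<partial>lborel)"
      proof (rule nn_integral_cong_AE)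
        show "AE x in lborel. ennreal (norm (indicator {s..t} x *\<^sub>R D x)) = liminf (\<lambda>n. ennreal \<bar>Q n x\<bar> * indicator {s..t} x)"
          using ae
        proof eventually_elim
          case (elim x)
          then have "(\<lambda>n. ennreal \<bar>Q n x\<bar>) \<longlonglongrightarrow> ennreal \<bar>D x\<bar>"
            by (intro tendsto_ennrealI tendsto_rabs Qlim D)
          then have "liminf (\<lambda>n. ennreal \<bar>Q n x\<bar>) = ennreal \<bar>D x\<bar>"
            by (intro lim_imp_Liminf) auto
          then show ?case by (auto simp: indicator_def Liminf_const)
        qed
      qed
      also have "\<dots> \<le> liminf (\<lambda>n. \<integral>\<^sup>+x. ennreal \<bar>Q n x\<bar> * indicator {s..t} x \<partial>lborel)"
        by (intro nn_integral_liminf) measurable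
      also have "\<dots> \<le> liminf (\<lambda>n. ennreal (V (t + 1) - V s))"
      proof (intro Liminf_mono always_eventually allI)
        fix n
        have "(\<integral>\<^sup>+x. ennreal \<bar>Q n x\<bar> * indicator {s..t} x \<partial>lborel)
          \<le> (\<integral>\<^sup>+x. ennreal ((V (x + h n) - V x) / h n) * indicator {s..t} x \<partial>lborel)"
          using FV h[of n]
          by (intro nn_integral_mono mult_right_mono ennreal_leI) (auto simp: Q_def abs_divide divide_right_mono)
        also have "\<dots> \<le> ennreal (V (t + 1) - V s)"
          by (rule nn_integral_slope_le[OF V True h])
        finally show "(\<integral>\<^sup>+x. ennreal \<bar>Q n x\<bar> * indicator {s..t} x \<partial>lborel) \<le> ennreal (V (t + 1) - V s)" .
      qed
      also have "\<dots> < \<infinity>" by (simp add: Liminf_const)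
      finally show ?thesis unfolding set_integrable_def by (intro integrableI_bounded) auto
    qed (simp add: set_integrable_def)
  qed
qed

theorem abs_continuous_derivative:
  assumes ac: "abs_continuous_on {a..} f"
  obtains D where "D \<in> borel_measurable borel" "\<And>s t. set_integrable lborel {s..t} D"
    "negligible {x \<in> {a..}. \<not> (f has_real_derivative D x) (at x)}"
proof -
  obtain V where V: "mono V" "continuous_on UNIV V"
    "\<And>x y. x \<le> y \<Longrightarrow> \<bar>f (max a y) - f (max a x)\<bar> \<le> V y - V x"
    using abs_continuous_variation[OF ac] by blast
  obtain D where D: "D \<in> borel_measurable borel" "\<And>s t. set_integrable lborel {s..t} D"
    "negligible {x. \<not> ((\<lambda>x. f (max a x)) has_real_derivative D x) (at x)}"
    using dominated_by_mono_derivative[OF V] by metis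
  have "(f has_real_derivative D x) (at x)"
    if "a < x" "((\<lambda>x. f (max a x)) has_real_derivative D x) (at x)" for x
  proof (rule has_field_derivative_transform_within_open[OF that(2)])
    show "open {a<..}" "x \<in> {a<..}" using that by auto
  qed auto
  then have "{x \<in> {a..}. \<not> (f has_real_derivative D x) (at x)} \<subseteq>
      {a} \<union> {x. \<not> ((\<lambda>x. f (max a x)) has_real_derivative D x) (at x)}" by force
  moreover have "negligible ({a} \<union> {x. \<not> ((\<lambda>x. f (max a x)) has_real_derivative D x) (at x)})"
    using D(3) by (intro negligible_Un) auto
  ultimately have "negligible {x \<in> {a..}. \<not> (f has_real_derivative D x) (at x)}"
    by (rule negligible_subset[rotated])
  then show thesis using that D by blast
qed

section \<open>Geometry of the spiral\<close>

lemma polar_point_nth [simp]: "polar_point r \<theta> $ 1 = r * cos \<theta>" "polar_point r \<theta> $ 2 = r * sin \<theta>"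
  by (simp_all add: polar_point_def)

lemma norm_real2: "norm (x :: real^2) = sqrt ((x $ 1)\<^sup>2 + (x $ 2)\<^sup>2)"
  by (simp add: norm_vec_def L2_set_def sum_2)

lemma norm_polar_point: "norm (polar_point r \<theta>) = \<bar>r\<bar>"
proof -
  have "(r * cos \<theta>)\<^sup>2 + (r * sin \<theta>)\<^sup>2 = r\<^sup>2 * ((sin \<theta>)\<^sup>2 + (cos \<theta>)\<^sup>2)" by algebra
  then show ?thesis by (simp add: norm_real2)
qed

lemma polar_point_eq_iff:
  assumes "r > 0" "r' > 0"
  shows "polar_point r \<theta> = polar_point r' \<theta>' \<longleftrightarrow> r = r' \<and> (\<exists>n::int. \<theta>' = \<theta> + 2 * pi * n)"
proof (cases "r = r'")
  case True
  have "polar_point r \<theta> = polar_point r \<theta>' \<longleftrightarrow> sin \<theta>' = sin \<theta> \<and> cos \<theta>' = cos \<theta>"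
    using assms by (auto simp: vec_eq_iff forall_2)
  then show ?thesis using True sin_cos_eq_iff by auto
next
  case False
  then have "polar_point r \<theta> \<noteq> polar_point r' \<theta>'"
    using norm_polar_point[of r \<theta>] norm_polar_point[of r' \<theta>'] assms by force
  then show ?thesis using False by simp
qed

lemma continuous_on_polar_point [continuous_intros]:
  fixes S :: "'a::t2_space set"
  assumes "continuous_on S f" "continuous_on S g"
  shows "continuous_on S (\<lambda>x. polar_point (f x) (g x))"
proof -
  have "polar_point r \<theta> = (\<chi> i. if i = 1 then r * cos \<theta> else r * sin \<theta>)" for r \<theta>
    by (simp add: vec_eq_iff forall_2)
  moreover have "continuous_on S (\<lambda>x. \<chi> i. if i = (1::2) then f x * cos (g x) else f x * sin (g x))"
  proof (rule continuous_on_vec_lambda)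
    show "continuous_on S (\<lambda>x. if i = 1 then f x * cos (g x) else f x * sin (g x))" for i :: 2
      by (cases "i = 1") (auto intro!: continuous_intros assms)
  qed
  ultimately show ?thesis by simp
qed

locale spiral =
  fixes r1 r2 :: "real \<Rightarrow> real" and \<theta>0 rstar :: real
  assumes cont_r1: "continuous_on {\<theta>0..} r1" and cont_r2: "continuous_on {\<theta>0..} r2"
    and r1_pos: "\<And>\<theta>. \<theta> \<ge> \<theta>0 \<Longrightarrow> 0 < r1 \<theta>"
    and turns_apart: "\<And>\<theta>. \<theta> \<ge> \<theta>0 \<Longrightarrow> r2 (\<theta> + 2 * pi) < r1 \<theta>"
    and r1_less_r2: "\<And>\<theta>. \<theta> \<ge> \<theta>0 \<Longrightarrow> r1 \<theta> < r2 \<theta>"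
    and rstar_pos: "rstar > 0"
    and lim_r1: "(r1 \<longlongrightarrow> rstar) at_top" and lim_r2: "(r2 \<longlongrightarrow> rstar) at_top"
begin

definition rad :: "real \<Rightarrow> real \<Rightarrow> real" where
  "rad l \<theta> = (1 - l) * r1 \<theta> + l * r2 \<theta>"

abbreviation curve :: "real \<Rightarrow> real \<Rightarrow> real^2" where
  "curve \<equiv> spiral_curve r1 r2"

lemma curve_eq: "curve l \<theta> = polar_point (rad l \<theta>) \<theta>"
  by (simp add: spiral_curve_def rad_def)

lemma rad_alt: "rad l \<theta> = r1 \<theta> + l * (r2 \<theta> - r1 \<theta>)"
  by (simp add: rad_def algebra_simps)

lemma rad_bounds:
  assumes "l \<in> {0..1}" "\<theta> \<ge> \<theta>0"
  shows "r1 \<theta> \<le> rad l \<theta>" "rad l \<theta> \<le> r2 \<theta>"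
proof -
  have d: "0 \<le> r2 \<theta> - r1 \<theta>" using r1_less_r2[of \<theta>] assms by simp
  show "r1 \<theta> \<le> rad l \<theta>" unfolding rad_alt using d assms by simp
  have "l * (r2 \<theta> - r1 \<theta>) \<le> 1 * (r2 \<theta> - r1 \<theta>)" using d assms by (intro mult_right_mono) auto
  then show "rad l \<theta> \<le> r2 \<theta>" unfolding rad_alt by simp
qed

lemma rad_pos: "l \<in> {0..1} \<Longrightarrow> \<theta> \<ge> \<theta>0 \<Longrightarrow> rad l \<theta> > 0"
  using rad_bounds r1_pos by fastforce

lemma rad_interior_bounds:
  assumes "l \<in> {0<..<1}" "\<theta> \<ge> \<theta>0"
  shows "r1 \<theta> < rad l \<theta>" "rad l \<theta> < r2 \<theta>"
proof -
  have d: "0 < r2 \<theta> - r1 \<theta>" using r1_less_r2[of \<theta>] assms by simp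
  show "r1 \<theta> < rad l \<theta>" unfolding rad_alt using d assms by simp
  have "l * (r2 \<theta> - r1 \<theta>) < 1 * (r2 \<theta> - r1 \<theta>)" using d assms by (intro mult_strict_right_mono) auto
  then show "rad l \<theta> < r2 \<theta>" unfolding rad_alt by simp
qed

lemma rad_surj:
  assumes "\<theta> \<ge> \<theta>0" "r1 \<theta> \<le> r" "r \<le> r2 \<theta>"
  obtains l where "l \<in> {0..1}" "r = rad l \<theta>"
proof (rule that[of "(r - r1 \<theta>) / (r2 \<theta> - r1 \<theta>)"])
  have d: "0 < r2 \<theta> - r1 \<theta>" using r1_less_r2[of \<theta>] assms by simp
  then show "r = rad ((r - r1 \<theta>) / (r2 \<theta> - r1 \<theta>)) \<theta>" by (simp add: rad_alt)
  show "(r - r1 \<theta>) / (r2 \<theta> - r1 \<theta>) \<in> {0..1}" using d assms by (simp add: divide_le_eq)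
qed

lemma spiral_cl_eq: "spiral_cl r1 r2 \<theta>0 = {curve l \<theta> | l \<theta>. l \<in> {0..1} \<and> \<theta> \<ge> \<theta>0}"
proof -
  have "\<exists>l' \<theta>'. polar_point r \<theta> = curve l' \<theta>' \<and> l' \<in> {0..1} \<and> \<theta>' \<ge> \<theta>0"
    if "\<theta> \<ge> \<theta>0" "r1 \<theta> \<le> r" "r \<le> r2 \<theta>" for r \<theta>
    using rad_surj[OF that] that curve_eq by metis
  then show ?thesis using rad_bounds by (auto simp: spiral_cl_def curve_eq) blast
qed

lemma cross_section_eq: "\<theta> \<ge> \<theta>0 \<Longrightarrow> cross_section r1 r2 \<theta> = (\<lambda>l. curve l \<theta>) ` {0..1}"
proof -
  assume t: "\<theta> \<ge> \<theta>0"
  have "polar_point r \<theta> \<in> (\<lambda>l. curve l \<theta>) ` {0..1}"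
    if "r1 \<theta> \<le> r" "r \<le> r2 \<theta>" for r
    using rad_surj[OF t that] curve_eq by (metis imageI)
  then show ?thesis using rad_bounds t by (auto simp: cross_section_def curve_eq)
qed

lemma curve_interior: "l \<in> {0<..<1} \<Longrightarrow> \<theta> > \<theta>0 \<Longrightarrow> curve l \<theta> \<in> spiral_dom r1 r2 \<theta>0"
  using rad_interior_bounds[of l \<theta>] by (auto simp: spiral_dom_def curve_eq)

lemma curve_side: "l = 0 \<or> l = 1 \<Longrightarrow> \<theta> \<ge> \<theta>0 \<Longrightarrow> curve l \<theta> \<in> spiral_side r1 r2 \<theta>0"
  by (auto simp: spiral_side_def curve_eq rad_def)

text \<open>Every later turn stays strictly inside the earlier ones. This is what makes the pair
  \<open>(l, \<theta>)\<close> unique, and with it the arc-distance well defined.\<close>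

lemma later_turn_inside:
  assumes "\<theta> \<ge> \<theta>0"
  shows "r2 (\<theta> + 2 * pi * real (Suc k)) < r1 \<theta>"
proof (induction k)
  case 0
  then show ?case using turns_apart[OF assms] by simp
next
  case (Suc k)
  have t: "\<theta> + 2 * pi * real (Suc k) \<ge> \<theta>0"
    by (rule order_trans[OF assms]) simp
  have "r2 (\<theta> + 2 * pi * real (Suc (Suc k))) = r2 (\<theta> + 2 * pi * real (Suc k) + 2 * pi)"
    by (simp add: algebra_simps)
  also have "\<dots> < r1 (\<theta> + 2 * pi * real (Suc k))" by (rule turns_apart[OF t])
  also have "\<dots> < r2 (\<theta> + 2 * pi * real (Suc k))" by (rule r1_less_r2[OF t])
  finally show ?case using Suc by simp
qed

lemma curve_inj:
  assumes "l \<in> {0..1}" "\<theta> \<ge> \<theta>0" "l' \<in> {0..1}" "\<theta>' \<ge> \<theta>0" "curve l \<theta> = curve l' \<theta>'"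
  shows "l = l' \<and> \<theta> = \<theta>'"
proof -
  have *: "n \<le> 0" if "l \<in> {0..1}" "\<theta> \<ge> \<theta>0" "l' \<in> {0..1}" "\<theta>' \<ge> \<theta>0" "rad l \<theta> = rad l' \<theta>'"
    "\<theta>' = \<theta> + 2 * pi * of_int n" for l \<theta> l' \<theta>' and n :: int
  proof (rule ccontr)
    assume "\<not> n \<le> 0"
    then obtain k where "n = int (Suc k)" by (metis gr0_implies_Suc not_le zero_less_imp_eq_int)
    then have "r2 \<theta>' < r1 \<theta>" using later_turn_inside[OF that(2), of k] that(6) by simp
    then show False using rad_bounds that by (metis leD le_less_trans)
  qed
  obtain n :: int where n: "rad l \<theta> = rad l' \<theta>'" "\<theta>' = \<theta> + 2 * pi * of_int n"
    using assms rad_pos unfolding curve_eq by (metis polar_point_eq_iff)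
  have "n \<le> 0" using *[OF assms(1-4) n] .
  moreover have "- n \<le> 0" 
  proof (rule *[OF assms(3,4,1,2) n(1)[symmetric]])
    show "\<theta> = \<theta>' + 2 * pi * real_of_int (- n)" unfolding n(2) by simp
  qed
  ultimately have t: "\<theta> = \<theta>'" using n by simp
  have "r2 \<theta> - r1 \<theta> > 0" using r1_less_r2 assms by simp
  with n(1) t show ?thesis by (simp add: rad_alt)
qed

lemma arc_dist_curve:
  assumes "l \<in> {0..1}" "\<theta> \<ge> \<theta>0"
  shows "arc_dist r1 r2 \<theta>0 (curve l \<theta>) = curve_length r1 r2 \<theta>0 l \<theta>"
proof -
  have "(THE (l', \<theta>'). l' \<in> {0..1} \<and> \<theta>' \<ge> \<theta>0 \<and> curve l \<theta> = curve l' \<theta>') = (l, \<theta>)"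
  proof (rule the_equality)
    fix p assume p: "case p of (l', \<theta>') \<Rightarrow> l' \<in> {0..1} \<and> \<theta>' \<ge> \<theta>0 \<and> curve l \<theta> = curve l' \<theta>'"
    obtain l' \<theta>' where "p = (l', \<theta>')" by (cases p)
    then show "p = (l, \<theta>)" using p curve_inj[OF assms, of l' \<theta>'] by simp
  qed (use assms in simp)
  then show ?thesis by (simp add: arc_dist_def)
qed

lemma continuous_on_rad [continuous_intros]:
  assumes "continuous_on S f" "continuous_on S g" "\<And>x. x \<in> S \<Longrightarrow> g x \<ge> \<theta>0"
  shows "continuous_on S (\<lambda>x. rad (f x) (g x))"
  unfolding rad_def using assms
  by (intro continuous_intros continuous_on_compose2[OF cont_r1] continuous_on_compose2[OF cont_r2]) auto

end

section \<open>Length of the spiral curves\<close>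

lemma norm_polar_frame: "norm (vector [a * cos \<theta> - c * sin \<theta>, a * sin \<theta> + c * cos \<theta>] :: real^2) = sqrt (a\<^sup>2 + c\<^sup>2)"
proof -
  have "(a * cos \<theta> - c * sin \<theta>)\<^sup>2 + (a * sin \<theta> + c * cos \<theta>)\<^sup>2 = (a\<^sup>2 + c\<^sup>2) * ((sin \<theta>)\<^sup>2 + (cos \<theta>)\<^sup>2)" by algebra
  then show ?thesis by (simp add: norm_real2)
qed

lemma polar_curve_has_vector_derivative:
  assumes "(R has_real_derivative D) (at \<eta>)"
  shows "((\<lambda>\<eta>. polar_point (R \<eta>) \<eta>) has_vector_derivative
    vector [D * cos \<eta> - R \<eta> * sin \<eta>, D * sin \<eta> + R \<eta> * cos \<eta>]) (at \<eta>)"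
proof -
  have e: "vector [a, c] = a *\<^sub>R axis 1 1 + c *\<^sub>R (axis 2 1 :: real^2)" for a c :: real
    by (simp add: vec_eq_iff forall_2 axis_def)
  have 1: "((\<lambda>\<eta>. R \<eta> * cos \<eta>) has_vector_derivative (D * cos \<eta> - R \<eta> * sin \<eta>)) (at \<eta>)"
    unfolding has_real_derivative_iff_has_vector_derivative[symmetric]
    using assms by (auto intro!: derivative_eq_intros)
  have 2: "((\<lambda>\<eta>. R \<eta> * sin \<eta>) has_vector_derivative (D * sin \<eta> + R \<eta> * cos \<eta>)) (at \<eta>)"
    unfolding has_real_derivative_iff_has_vector_derivative[symmetric]
    using assms by (auto intro!: derivative_eq_intros)
  show ?thesis unfolding polar_point_def e
    by (intro has_vector_derivative_add has_vector_derivative_scaleR[OF _ has_vector_derivative_const, simplified] 1[unfolded has_real_derivative_iff_has_vector_derivative[symmetric]] 2[unfolded has_real_derivative_iff_has_vector_derivative[symmetric]])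
qed

text \<open>The functions \<open>D1\<close> and \<open>D2\<close> are Borel versions of the almost everywhere defined derivatives of \<open>r1\<close>
  and \<open>r2\<close>. The bound \<open>\<mu>\<close> is available only beyond \<open>\<Theta>\<close>; on the initial part of the spiral there is nothing
  but local integrability.\<close>

locale rectifiable_spiral = spiral +
  fixes D1 D2 :: "real \<Rightarrow> real" and Rbar \<mu> \<Theta> :: real
  assumes r2_le: "\<And>\<theta>. \<theta> \<ge> \<theta>0 \<Longrightarrow> r2 \<theta> \<le> Rbar"
    and D_meas: "D1 \<in> borel_measurable borel" "D2 \<in> borel_measurable borel"
    and D_int: "\<And>s t. set_integrable lborel {s..t} D1" "\<And>s t. set_integrable lborel {s..t} D2"
    and D_deriv: "negligible {x \<in> {\<theta>0..}. \<not> (r1 has_real_derivative D1 x) (at x)}"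
       "negligible {x \<in> {\<theta>0..}. \<not> (r2 has_real_derivative D2 x) (at x)}"
    and D_bound: "AE x in lebesgue. \<Theta> < x \<longrightarrow> \<bar>D1 x\<bar> \<le> \<mu> \<and> \<bar>D2 x\<bar> \<le> \<mu>" "\<mu> \<ge> 0"
begin

definition speed :: "real \<Rightarrow> real \<Rightarrow> real" where
  "speed l \<eta> = norm (vector_derivative (curve l) (at \<eta>))"

lemma AE_derivatives:
  "AE x in lebesgue. x \<ge> \<theta>0 \<longrightarrow> (r1 has_real_derivative D1 x) (at x) \<and> (r2 has_real_derivative D2 x) (at x)"
proof -
  have "{x \<in> {\<theta>0..}. \<not> (r1 has_real_derivative D1 x) (at x)} \<in> null_sets lebesgue"
    "{x \<in> {\<theta>0..}. \<not> (r2 has_real_derivative D2 x) (at x)} \<in> null_sets lebesgue"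
    using D_deriv unfolding negligible_iff_null_sets .
  from this[THEN AE_not_in] show ?thesis by eventually_elim auto
qed

lemma AE_speed:
  "AE x in lebesgue. x \<ge> \<theta>0 \<longrightarrow> speed l x = sqrt (((1 - l) * D1 x + l * D2 x)\<^sup>2 + (rad l x)\<^sup>2)"
  using AE_derivatives
proof eventually_elim
  case (elim x)
  show ?case
  proof
    assume "\<theta>0 \<le> x"
    with elim have d: "(r1 has_real_derivative D1 x) (at x)" "(r2 has_real_derivative D2 x) (at x)" by auto
    have "(rad l has_real_derivative (1 - l) * D1 x + l * D2 x) (at x)"
      unfolding rad_def[abs_def] by (intro DERIV_add DERIV_cmult d)
    from polar_curve_has_vector_derivative[OF this]
    have "vector_derivative (curve l) (at x) =
       vector [((1 - l) * D1 x + l * D2 x) * cos x - rad l x * sin x,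
               ((1 - l) * D1 x + l * D2 x) * sin x + rad l x * cos x]"
      by (intro vector_derivative_at) (simp add: curve_eq[abs_def])
    then show "speed l x = sqrt (((1 - l) * D1 x + l * D2 x)\<^sup>2 + (rad l x)\<^sup>2)"
      by (simp add: speed_def norm_polar_frame)
  qed
qed

lemma D_int_lebesgue: "set_integrable lebesgue {s..t} D1" "set_integrable lebesgue {s..t} D2"
  using D_int[of s t] D_meas unfolding set_integrable_def
  by (simp_all add: integrable_completion)

lemma AE_speed_le:
  assumes "l \<in> {0..1}"
  shows "AE x in lebesgue. x \<ge> \<theta>0 \<longrightarrow> speed l x \<le> \<bar>D1 x\<bar> * indicator {..\<Theta>} x + \<bar>D2 x\<bar> * indicator {..\<Theta>} x + (Rbar + \<mu>)"
  using AE_speed[of l] D_bound(1)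
proof eventually_elim
  case (elim x)
  show ?case
  proof
    assume x: "\<theta>0 \<le> x"
    then have "speed l x \<le> \<bar>(1 - l) * D1 x + l * D2 x\<bar> + \<bar>rad l x\<bar>"
      using elim sqrt_sum_squares_le_sum_abs by simp
    moreover have "\<bar>rad l x\<bar> \<le> Rbar"
      using rad_bounds[OF assms x] rad_pos[OF assms x] r2_le[OF x] by simp
    moreover have *: "\<bar>(1 - l) * D1 x + l * D2 x\<bar> \<le> (1 - l) * \<bar>D1 x\<bar> + l * \<bar>D2 x\<bar>"
      using assms by (intro abs_triangle_ineq[THEN order_trans]) (simp add: abs_mult)
    moreover have "(1 - l) * \<bar>D1 x\<bar> \<le> 1 * \<bar>D1 x\<bar>" "l * \<bar>D2 x\<bar> \<le> 1 * \<bar>D2 x\<bar>"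
      using assms by (intro mult_right_mono; simp)+
    moreover have "(1 - l) * \<bar>D1 x\<bar> + l * \<bar>D2 x\<bar> \<le> (1 - l) * \<mu> + l * \<mu>" if "\<Theta> < x"
      using assms elim that by (intro add_mono mult_left_mono) auto
    moreover have "(1 - l) * \<mu> + l * \<mu> = \<mu>" by (simp add: algebra_simps)
    ultimately show "speed l x \<le> \<bar>D1 x\<bar> * indicator {..\<Theta>} x + \<bar>D2 x\<bar> * indicator {..\<Theta>} x + (Rbar + \<mu>)"
      using D_bound(2) by (cases "\<Theta> < x") (simp_all add: indicator_def)
  qed
qed

lemma curve_length_speed: "curve_length r1 r2 \<theta>0 l \<theta> = (LINT \<eta>:{\<theta>0..\<theta>}|lebesgue. speed l \<eta>)"
  by (simp add: curve_length_def speed_def)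

lemma set_integrable_D_indicator:
  "set_integrable lebesgue {s..t} (\<lambda>x. \<bar>D1 x\<bar> * indicator {..\<Theta>} x)"
  "set_integrable lebesgue {s..t} (\<lambda>x. \<bar>D2 x\<bar> * indicator {..\<Theta>} x)"
proof -
  have "set_integrable lebesgue {s..t} (\<lambda>x. \<bar>D x\<bar> * indicator {..\<Theta>} x)" if "set_integrable lebesgue {s..t} D" for D :: "real \<Rightarrow> real"
  proof -
    have "integrable lebesgue (\<lambda>x. indicator {..\<Theta>} x *\<^sub>R \<bar>indicator {s..t} x *\<^sub>R D x\<bar>)"
      using integrable_mult_indicator[OF _ Bochner_Integration.integrable_abs[OF that[unfolded set_integrable_def]], of "{..\<Theta>}"]
      by simp
    then show ?thesis unfolding set_integrable_def
      by (simp add: abs_mult mult_ac)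
  qed
  then show "set_integrable lebesgue {s..t} (\<lambda>x. \<bar>D1 x\<bar> * indicator {..\<Theta>} x)"
    "set_integrable lebesgue {s..t} (\<lambda>x. \<bar>D2 x\<bar> * indicator {..\<Theta>} x)"
    using D_int_lebesgue by auto
qed

lemma set_integrable_const_Icc: "set_integrable lebesgue {s..t :: real} (\<lambda>x. c :: real)"
  unfolding set_integrable_def by (intro integrable_indicator) (auto simp: emeasure_lborel_Icc_eq)

text \<open>A Bochner integral of a non-integrable function is zero, so without this fact no lower bound on
  the length would hold.\<close>

lemma speed_integrable:
  assumes "l \<in> {0..1}"
  shows "set_integrable lebesgue {\<theta>0..\<theta>} (speed l)"
proof (rule set_integrable_bound)
  let ?g = "\<lambda>x. \<bar>D1 x\<bar> * indicator {..\<Theta>} x + \<bar>D2 x\<bar> * indicator {..\<Theta>} x + (Rbar + \<mu>)"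
  show "set_integrable lebesgue {\<theta>0..\<theta>} ?g"
    by (intro set_integral_add set_integrable_D_indicator set_integrable_const_Icc)
  have "rad l \<in> borel_measurable (restrict_space borel {\<theta>0..\<theta>})"
    by (intro borel_measurable_continuous_on_restrict continuous_intros) auto
  then have [measurable]: "(\<lambda>x. indicator {\<theta>0..\<theta>} x * rad l x) \<in> borel_measurable borel"
    by (subst (asm) borel_measurable_restrict_space_iff) (auto simp: mult.commute)
  note [measurable] = D_meas
  let ?f = "\<lambda>x. indicator {\<theta>0..\<theta>} x * sqrt (((1 - l) * D1 x + l * D2 x)\<^sup>2 + (indicator {\<theta>0..\<theta>} x * rad l x)\<^sup>2)"
  have "?f \<in> borel_measurable borel" by measurable
  then have "?f \<in> borel_measurable lebesgue" by (simp add: measurable_completion)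
  moreover have "AE x in lebesgue. ?f x = indicator {\<theta>0..\<theta>} x *\<^sub>R speed l x"
    using AE_speed[of l] by eventually_elim (auto simp: indicator_def)
  ultimately show "set_borel_measurable lebesgue {\<theta>0..\<theta>} (speed l)"
    unfolding set_borel_measurable_def by (rule borel_measurable_AE)
  show "AE x in lebesgue. x \<in> {\<theta>0..\<theta>} \<longrightarrow> norm (speed l x) \<le> norm (?g x)"
    using AE_speed_le[OF assms]
    by eventually_elim (auto simp: speed_def intro: order_trans[OF _ abs_ge_self])
qed

text \<open>The constant \<open>c\<close> absorbs the initial part of the spiral, uniformly in \<open>l\<close>.\<close>

lemma curve_length_upper:
  obtains c where "\<And>l \<theta>. l \<in> {0..1} \<Longrightarrow> \<theta> \<ge> \<theta>0 \<Longrightarrow> curve_length r1 r2 \<theta>0 l \<theta> \<le> c + (Rbar + \<mu>) * (\<theta> - \<theta>0)"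
proof -
  let ?h = "\<lambda>x. \<bar>D1 x\<bar> * indicator {..\<Theta>} x + \<bar>D2 x\<bar> * indicator {..\<Theta>} x"
  have int: "set_integrable lebesgue {s..t} ?h" for s t
    by (intro set_integral_add set_integrable_D_indicator)
  let ?c = "LINT x:{\<theta>0..max \<theta>0 \<Theta>}|lebesgue. ?h x"
  have "curve_length r1 r2 \<theta>0 l \<theta> \<le> ?c + (Rbar + \<mu>) * (\<theta> - \<theta>0)"
    if l: "l \<in> {0..1}" and \<theta>: "\<theta> \<ge> \<theta>0" for l \<theta>
  proof -
    have "curve_length r1 r2 \<theta>0 l \<theta> \<le> (LINT x:{\<theta>0..\<theta>}|lebesgue. ?h x + (Rbar + \<mu>))"
      unfolding curve_length_speed using AE_speed_le[OF l]
      by (intro set_integral_mono_AE speed_integrable l set_integral_add(1) int set_integrable_const_Icc) auto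
    also have "\<dots> = (LINT x:{\<theta>0..\<theta>}|lebesgue. ?h x) + (LINT x:{\<theta>0..\<theta>}|lebesgue. Rbar + \<mu>)"
      by (intro set_integral_add(2) int set_integrable_const_Icc)
    also have "(LINT x:{\<theta>0..\<theta>}|lebesgue. Rbar + \<mu>) = (Rbar + \<mu>) * (\<theta> - \<theta>0)"
      using \<theta> by (simp add: set_lebesgue_integral_def)
    also have "(LINT x:{\<theta>0..\<theta>}|lebesgue. ?h x) \<le> ?c"
      using int[of \<theta>0 \<theta>] int[of \<theta>0 "max \<theta>0 \<Theta>"] unfolding set_lebesgue_integral_def set_integrable_def
      by (intro integral_mono) (auto simp: indicator_def)
    finally show ?thesis by simp
  qed
  then show thesis using that by blast
qed

text \<open>The speed is at least the radius, and the radius is eventually larger than \<open>k\<close>.\<close>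

lemma curve_length_lower:
  assumes k: "0 \<le> k" "k < rstar"
  obtains T where "T \<ge> \<theta>0" "\<And>l \<theta>. l \<in> {0..1} \<Longrightarrow> \<theta> \<ge> \<theta>0 \<Longrightarrow> k * (\<theta> - T) \<le> curve_length r1 r2 \<theta>0 l \<theta>"
proof -
  have "\<forall>\<^sub>F \<theta> in at_top. k < r1 \<theta>" by (rule order_tendstoD(1)[OF lim_r1 k(2)])
  then obtain T0 where T0: "\<And>\<theta>. \<theta> \<ge> T0 \<Longrightarrow> k < r1 \<theta>" by (auto simp: eventually_at_top_linorder)
  define T where "T = max T0 \<theta>0"
  have "k * (\<theta> - T) \<le> curve_length r1 r2 \<theta>0 l \<theta>" if l: "l \<in> {0..1}" and \<theta>: "\<theta> \<ge> \<theta>0" for l \<theta>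
  proof (cases "T \<le> \<theta>")
    case True
    have "k * (\<theta> - T) = (LINT x:{T..\<theta>}|lebesgue. k)"
      using True by (simp add: set_lebesgue_integral_def)
    also have "\<dots> \<le> curve_length r1 r2 \<theta>0 l \<theta>"
      using speed_integrable[OF l, of \<theta>] set_integrable_const_Icc[of T \<theta> k]
      unfolding curve_length_speed set_lebesgue_integral_def set_integrable_def
    proof (intro integral_mono_AE)
      show "AE x in lebesgue. indicator {T..\<theta>} x *\<^sub>R k \<le> indicator {\<theta>0..\<theta>} x *\<^sub>R speed l x"
        using AE_speed[of l]
      proof eventually_elim
        case (elim x)
        show ?case
        proof (cases "x \<in> {T..\<theta>}")
          case True
          then have x: "x \<ge> \<theta>0" "x \<ge> T0" "x \<le> \<theta>" by (auto simp: T_def)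
          have "k \<le> rad l x" using T0[OF x(2)] rad_bounds(1)[OF l x(1)] by simp
          also have "\<dots> \<le> sqrt (((1 - l) * D1 x + l * D2 x)\<^sup>2 + (rad l x)\<^sup>2)"
            by (rule real_le_rsqrt) simp
          finally show ?thesis using elim x True by simp
        next
          case False
          then show ?thesis by (simp add: speed_def)
        qed
      qed
    qed
    finally show ?thesis .
  next
    case False
    then have "k * (\<theta> - T) \<le> 0" using k by (simp add: mult_nonneg_nonpos)
    also have "0 \<le> curve_length r1 r2 \<theta>0 l \<theta>"
      unfolding curve_length_speed set_lebesgue_integral_def
      by (intro integral_nonneg_AE) (simp add: speed_def)
    finally show ?thesis .
  qed
  then show thesis using that[of T] by (auto simp: T_def)
qed

end

section \<open>Comparison with functions of radius and angle\<close>

text \<open>If \<open>D\<close> were positive, \<open>f'\<close> would be positive just to the right of \<open>0\<close> and \<open>f\<close> would increase there.\<close>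

lemma second_derivative_test_max:
  fixes f f' :: "real \<Rightarrow> real"
  assumes d1: "\<forall>\<^sub>F t in nhds 0. (f has_real_derivative f' t) (at t)"
    and d2: "(f' has_real_derivative D) (at 0)"
    and max: "\<forall>\<^sub>F t in nhds 0. f t \<le> f 0"
  shows "f' 0 = 0 \<and> D \<le> 0"
proof
  obtain d where d: "d > 0" "\<And>t. \<bar>t\<bar> < d \<Longrightarrow> (f has_real_derivative f' t) (at t) \<and> f t \<le> f 0"
    using eventually_conj[OF d1 max] unfolding eventually_nhds_metric by (auto simp: dist_real_def)
  show 0: "f' 0 = 0"
    using d by (intro DERIV_local_max[of f "f' 0" 0 d]) auto
  show "D \<le> 0"
  proof (rule ccontr)
    assume "\<not> D \<le> 0"
    then obtain e where e: "e > 0" "\<And>h. 0 < h \<Longrightarrow> h < e \<Longrightarrow> f' 0 < f' (0 + h)"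
      using DERIV_pos_inc_right[OF d2] by auto
    define h where "h = min d e / 2"
    have h: "0 < h" "h < d" "h < e" using d e by (auto simp: h_def)
    obtain z where z: "z > 0" "z < h" "f h - f 0 = (h - 0) * f' z"
      using MVT2[of 0 h f f'] d h by auto
    have "f' z > 0" using e(2)[of z] z h 0 by simp
    then have "f h - f 0 > 0" unfolding z(3) using h by simp
    then show False using d(2)[of h] h by auto
  qed
qed

definition gradient :: "(real^'n::finite \<Rightarrow> real) \<Rightarrow> real^'n \<Rightarrow> real^'n" where
  "gradient u x = (\<chi> i. partial_deriv i u x)"

lemma frechet_derivative_gradient:
  fixes u :: "real^'n::finite \<Rightarrow> real"
  assumes "u differentiable (at x)"
  shows "frechet_derivative u (at x) v = v \<bullet> gradient u x"
proof -
  have lin: "linear (frechet_derivative u (at x))" using assms by (rule linear_frechet_derivative)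
  have "frechet_derivative u (at x) v = frechet_derivative u (at x) (\<Sum>i\<in>UNIV. v $ i *\<^sub>R axis i 1)"
    by (simp add: basis_expansion scalar_mult_eq_scaleR[symmetric])
  also have "\<dots> = (\<Sum>i\<in>UNIV. v $ i * partial_deriv i u x)"
    unfolding linear_sum[OF lin] linear_cmul[OF lin] by (simp add: partial_deriv_def)
  finally have "frechet_derivative u (at x) v = (\<Sum>i\<in>UNIV. v $ i * partial_deriv i u x)" .
  then show ?thesis by (simp add: gradient_def inner_vec_def)
qed

lemma differentiable_along_line:
  fixes u :: "real^'n::finite \<Rightarrow> real"
  assumes "u differentiable (at (x + t *\<^sub>R v))"
  shows "((\<lambda>t. u (x + t *\<^sub>R v)) has_real_derivative v \<bullet> gradient u (x + t *\<^sub>R v)) (at t)"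
proof -
  have "((\<lambda>t. x + t *\<^sub>R v) has_derivative (\<lambda>h. h *\<^sub>R v)) (at t)"
    by (auto intro!: derivative_eq_intros)
  moreover have "(u has_derivative frechet_derivative u (at (x + t *\<^sub>R v))) (at (x + t *\<^sub>R v))"
    using assms frechet_derivative_works by blast
  ultimately have "((\<lambda>t. u (x + t *\<^sub>R v)) has_derivative (\<lambda>h. frechet_derivative u (at (x + t *\<^sub>R v)) (h *\<^sub>R v))) (at t)"
    by (rule has_derivative_compose)
  moreover have "(\<lambda>h. frechet_derivative u (at (x + t *\<^sub>R v)) (h *\<^sub>R v)) = (*) (v \<bullet> gradient u (x + t *\<^sub>R v))"
    by (simp add: frechet_derivative_gradient[OF assms] fun_eq_iff)
  ultimately show ?thesis unfolding has_field_derivative_def by simp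
qed

lemma C2_second_derivative_along_line:
  fixes u :: "real^'n::finite \<Rightarrow> real"
  assumes "C2_on S u" "x \<in> S"
  shows "((\<lambda>t. v \<bullet> gradient u (x + t *\<^sub>R v)) has_real_derivative
     (\<Sum>i\<in>UNIV. \<Sum>j\<in>UNIV. v $ i * v $ j * partial_deriv i (partial_deriv j u) x)) (at 0)"
proof -
  have "((\<lambda>t. \<Sum>j\<in>UNIV. v $ j * partial_deriv j u (x + t *\<^sub>R v)) has_real_derivative
     (\<Sum>j\<in>UNIV. v $ j * (v \<bullet> gradient (partial_deriv j u) (x + 0 *\<^sub>R v)))) (at 0)"
    using assms by (intro DERIV_sum DERIV_cmult differentiable_along_line) (auto simp: C2_on_def)
  moreover have "(\<Sum>j\<in>UNIV. v $ j * (v \<bullet> gradient (partial_deriv j u) (x + 0 *\<^sub>R v))) =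
     (\<Sum>i\<in>UNIV. \<Sum>j\<in>UNIV. v $ i * v $ j * partial_deriv i (partial_deriv j u) x)"
    by (subst sum.swap) (simp add: gradient_def inner_vec_def sum_distrib_left mult_ac)
  ultimately show ?thesis by (simp add: gradient_def inner_vec_def)
qed

lemma elliptic_op_gradient:
  "elliptic_op A b u x = - (\<Sum>i\<in>UNIV. \<Sum>j\<in>UNIV. A x $ i $ j * partial_deriv i (partial_deriv j u) x)
     + b x \<bullet> gradient u x"
  by (simp add: elliptic_op_def gradient_def)

lemma
  assumes "open S" "C2_on S u"
  shows elliptic_op_uminus: "x \<in> S \<Longrightarrow> elliptic_op A b (\<lambda>x. - u x) x = - elliptic_op A b u x"
    and C2_on_uminus: "C2_on S (\<lambda>x. - u x)"
proof -
  have p: "partial_deriv i (\<lambda>x. - w x) y = - partial_deriv i w y" if "w differentiable (at y)" for w :: "real^'a \<Rightarrow> real" and y i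
  proof -
    have "(w has_derivative frechet_derivative w (at y)) (at y)" using that frechet_derivative_works by blast
    then have "((\<lambda>x. - w x) has_derivative (\<lambda>h. - frechet_derivative w (at y) h)) (at y)"
      by (rule has_derivative_minus)
    from frechet_derivative_at[OF this, symmetric] show ?thesis by (simp add: partial_deriv_def)
  qed
  have c: "(\<forall>x\<in>S. u differentiable (at x))" "\<And>i. \<forall>x\<in>S. partial_deriv i u differentiable (at x)"
    "\<And>i j. continuous_on S (partial_deriv i (partial_deriv j u))"
    using assms(2) by (auto simp: C2_on_def)
  have p1: "partial_deriv i (\<lambda>x. - u x) y = - partial_deriv i u y" if "y \<in> S" for y i
    using p c that by blast
  have D: "(partial_deriv j (\<lambda>x. - u x) has_derivative (\<lambda>h. - frechet_derivative (partial_deriv j u) (at y) h)) (at y)"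
    if "y \<in> S" for y j
  proof (rule has_derivative_transform_within_open)
    show "((\<lambda>x. - partial_deriv j u x) has_derivative (\<lambda>h. - frechet_derivative (partial_deriv j u) (at y) h)) (at y)"
      using c(2) that frechet_derivative_works by (intro has_derivative_minus) blast
  qed (use assms that p1 in auto)
  have p2: "partial_deriv i (partial_deriv j (\<lambda>x. - u x)) y = - partial_deriv i (partial_deriv j u) y" if "y \<in> S" for y i j
    using frechet_derivative_at[OF D[OF that], symmetric] by (simp add: partial_deriv_def)
  show "elliptic_op A b (\<lambda>x. - u x) x = - elliptic_op A b u x" if "x \<in> S"
    using that by (simp add: elliptic_op_def p1 p2 sum_negf inner_vec_def)
  show "C2_on S (\<lambda>x. - u x)"
    unfolding C2_on_def
  proof (intro conjI allI ballI)
    fix i j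
    have "continuous_on S (\<lambda>y. - partial_deriv i (partial_deriv j u) y)"
      by (intro continuous_intros c)
    then show "continuous_on S (partial_deriv i (partial_deriv j (\<lambda>x. - u x)))"
      by (rule continuous_on_eq) (simp add: p2)
    show "partial_deriv i (\<lambda>x. - u x) differentiable (at y)" if "y \<in> S" for y
      using D[OF that] unfolding differentiable_def by blast
    show "(\<lambda>x. - u x) differentiable (at y)" if "y \<in> S" for y
      using c(1) that by (intro differentiable_minus) blast
  qed
qed

text \<open>A Cholesky factorisation. It writes the second order part of the operator as a sum of two second
  directional derivatives, so that one-variable calculus along lines suffices at a maximum.\<close>

lemma pos_def_2_decompose:
  fixes A :: "real^2^2"
  assumes "transpose A = A" "\<And>\<xi>. c * (norm \<xi>)\<^sup>2 \<le> \<xi> \<bullet> (A *v \<xi>)" "c > 0"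
  obtains v w :: "real^2" where "\<And>i j. A $ i $ j = v $ i * v $ j + w $ i * w $ j"
proof -
  have sym: "A $ 2 $ 1 = A $ 1 $ 2" 
  proof -
    have "A $ 2 $ 1 = transpose A $ 1 $ 2" by (simp add: transpose_def)
    then show ?thesis by (simp add: assms(1))
  qed
  have q: "\<xi> \<bullet> (A *v \<xi>) = A $ 1 $ 1 * (\<xi> $ 1)\<^sup>2 + 2 * A $ 1 $ 2 * \<xi> $ 1 * \<xi> $ 2 + A $ 2 $ 2 * (\<xi> $ 2)\<^sup>2" for \<xi>
    by (simp add: inner_vec_def matrix_vector_mult_def sum_2 sym power2_eq_square algebra_simps)
  have pos: "\<xi> \<bullet> (A *v \<xi>) \<ge> 0" for \<xi>
    using assms(3) by (intro order_trans[OF _ assms(2)]) simp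
  have a: "A $ 1 $ 1 > 0"
    using assms(2)[of "vector [1, 0]"] assms(3) by (simp add: q norm_real2)
  have "0 \<le> A $ 1 $ 1 * (A $ 1 $ 1 * A $ 2 $ 2 - (A $ 1 $ 2)\<^sup>2)"
    using pos[of "vector [- (A $ 1 $ 2), A $ 1 $ 1]"] unfolding q by (simp add: power2_eq_square algebra_simps)
  then have det: "0 \<le> A $ 2 $ 2 - (A $ 1 $ 2)\<^sup>2 / A $ 1 $ 1"
    using a by (simp add: zero_le_mult_iff field_simps)
  let ?v = "vector [sqrt (A $ 1 $ 1), A $ 1 $ 2 / sqrt (A $ 1 $ 1)] :: real^2"
  let ?w = "vector [0, sqrt (A $ 2 $ 2 - (A $ 1 $ 2)\<^sup>2 / A $ 1 $ 1)] :: real^2"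
  have "A $ i $ j = ?v $ i * ?v $ j + ?w $ i * ?w $ j" for i j
  proof -
    have "i = 1 \<or> i = 2" "j = 1 \<or> j = 2" using exhaust_2 by auto
    then show ?thesis using a det sym by (auto simp: power2_eq_square)
  qed
  then show thesis using that by blast
qed

definition radial_part :: "real \<Rightarrow> real^2 \<Rightarrow> real" where
  "radial_part \<theta> v = v $ 1 * cos \<theta> + v $ 2 * sin \<theta>"

definition angular_part :: "real \<Rightarrow> real^2 \<Rightarrow> real" where
  "angular_part \<theta> v = v $ 2 * cos \<theta> - v $ 1 * sin \<theta>"

text \<open>A straight line through a point, in polar coordinates about the origin. The arctangent gives a
  continuous choice of the angle near that point, which is all that a local comparison needs.\<close>

lemma polar_line:
  assumes "r + t * radial_part \<theta> v > 0"
  shows "polar_point r \<theta> + t *\<^sub>R v =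
    polar_point (sqrt ((r + t * radial_part \<theta> v)\<^sup>2 + (t * angular_part \<theta> v)\<^sup>2))
      (\<theta> + arctan (t * angular_part \<theta> v / (r + t * radial_part \<theta> v)))"
proof -
  define a z where "a = r + t * radial_part \<theta> v" and "z = t * angular_part \<theta> v"
  have a: "a > 0" using assms by (simp add: a_def)
  have s: "sqrt (a\<^sup>2 + z\<^sup>2) = a * sqrt (1 + (z / a)\<^sup>2)"
  proof -
    have "a\<^sup>2 + z\<^sup>2 = a\<^sup>2 * (1 + (z / a)\<^sup>2)" using a by (simp add: field_simps)
    then show ?thesis using a by (simp add: real_sqrt_mult)
  qed
  have "1 + (z / a)\<^sup>2 > 0" by (intro add_pos_nonneg) auto
  then have n: "sqrt (1 + (z / a)\<^sup>2) \<noteq> 0" by simp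
  have C: "sqrt (a\<^sup>2 + z\<^sup>2) * cos (arctan (z / a)) = a"
    using a n by (simp add: s cos_arctan)
  have S: "sqrt (a\<^sup>2 + z\<^sup>2) * sin (arctan (z / a)) = z"
    using a n by (simp add: s sin_arctan)
  have one: "cos \<theta> * cos \<theta> = 1 - sin \<theta> * sin \<theta>"
    using sin_cos_squared_add[of \<theta>] by (simp add: power2_eq_square)
  have "sqrt (a\<^sup>2 + z\<^sup>2) * cos (\<theta> + arctan (z / a)) = a * cos \<theta> - z * sin \<theta>"
  proof -
    have "sqrt (a\<^sup>2 + z\<^sup>2) * cos (\<theta> + arctan (z / a)) =
        (sqrt (a\<^sup>2 + z\<^sup>2) * cos (arctan (z / a))) * cos \<theta> - (sqrt (a\<^sup>2 + z\<^sup>2) * sin (arctan (z / a))) * sin \<theta>"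
      unfolding cos_add by algebra
    then show ?thesis unfolding C S .
  qed
  moreover have "a * cos \<theta> - z * sin \<theta> = r * cos \<theta> + t * v $ 1"
    unfolding a_def z_def radial_part_def angular_part_def using one by algebra
  moreover have "sqrt (a\<^sup>2 + z\<^sup>2) * sin (\<theta> + arctan (z / a)) = a * sin \<theta> + z * cos \<theta>"
  proof -
    have "sqrt (a\<^sup>2 + z\<^sup>2) * sin (\<theta> + arctan (z / a)) =
        (sqrt (a\<^sup>2 + z\<^sup>2) * cos (arctan (z / a))) * sin \<theta> + (sqrt (a\<^sup>2 + z\<^sup>2) * sin (arctan (z / a))) * cos \<theta>"
      unfolding sin_add by algebra
    then show ?thesis unfolding C S .
  qed
  moreover have "a * sin \<theta> + z * cos \<theta> = r * sin \<theta> + t * v $ 2"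
    unfolding a_def z_def radial_part_def angular_part_def using one by algebra
  ultimately have "polar_point r \<theta> + t *\<^sub>R v = polar_point (sqrt (a\<^sup>2 + z\<^sup>2)) (\<theta> + arctan (z / a))"
    by (simp add: vec_eq_iff forall_2)
  then show ?thesis unfolding a_def z_def .
qed

lemma polar_line_angle_derivative:
  fixes r p q t :: real
  assumes "r + t * p > 0"
  shows "((\<lambda>t. \<theta> + arctan (t * q / (r + t * p))) has_real_derivative r * q / ((r + t * p)\<^sup>2 + (t * q)\<^sup>2)) (at t)"
proof -
  have pos: "(r + t * p)\<^sup>2 + (t * q)\<^sup>2 > 0" using assms by (intro add_pos_nonneg) auto
  have e: "inverse (1 + (t * q / (r + t * p))\<^sup>2) * ((q * (r + t * p) - t * q * p) / ((r + t * p) * (r + t * p)))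
      = r * q / ((r + t * p)\<^sup>2 + (t * q)\<^sup>2)"
  proof -
    have "1 + (t * q / (r + t * p))\<^sup>2 = ((r + t * p)\<^sup>2 + (t * q)\<^sup>2) / (r + t * p)\<^sup>2"
      using assms by (simp add: power_divide add_divide_distrib)
    moreover have "q * (r + t * p) - t * q * p = r * q" by (simp add: algebra_simps)
    ultimately show ?thesis using assms pos by (simp add: power2_eq_square)
  qed
  have "((\<lambda>t. t * q / (r + t * p)) has_real_derivative ((q * (r + t * p) - t * q * p) / ((r + t * p) * (r + t * p)))) (at t)"
    using assms by (auto intro!: derivative_eq_intros)
  from DERIV_chain2[OF DERIV_arctan this] have "((\<lambda>t. arctan (t * q / (r + t * p))) has_real_derivative r * q / ((r + t * p)\<^sup>2 + (t * q)\<^sup>2)) (at t)"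
    unfolding e .
  from DERIV_add[OF DERIV_const this] show ?thesis by simp
qed

text \<open>The first and second derivative at \<open>0\<close> of \<open>f (r\<^sup>2) * g \<theta>\<close> along the line through the point with polar
  coordinates \<open>(r, \<theta>)\<close> whose direction has radial component \<open>p\<close> and angular component \<open>q\<close>. Using the
  squared radius keeps the radial profile smooth and the formulas rational.\<close>

lemma polar_product_along_line:
  fixes f f1 f2 g g1 g2 :: "real \<Rightarrow> real" and r p q \<theta> :: real
  assumes f: "\<And>x. (f has_real_derivative f1 x) (at x)" "\<And>x. (f1 has_real_derivative f2 x) (at x)"
    and g: "\<And>x. (g has_real_derivative g1 x) (at x)" "\<And>x. (g1 has_real_derivative g2 x) (at x)"
    and r: "r > 0"
  defines "\<rho> \<equiv> \<lambda>t. (r + t * p)\<^sup>2 + (t * q)\<^sup>2"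
    and "\<alpha> \<equiv> \<lambda>t. \<theta> + arctan (t * q / (r + t * p))"
  defines "d \<equiv> \<lambda>t. f1 (\<rho> t) * (2 * p * (r + t * p) + 2 * t * q\<^sup>2) * g (\<alpha> t) + f (\<rho> t) * (g1 (\<alpha> t) * (r * q / \<rho> t))"
  shows "r + t * p > 0 \<Longrightarrow> ((\<lambda>t. f (\<rho> t) * g (\<alpha> t)) has_real_derivative d t) (at t)"
    and "d 0 = 2 * r * f1 (r\<^sup>2) * g \<theta> * p + f (r\<^sup>2) * g1 \<theta> * q / r"
    and "(d has_real_derivative 4 * r\<^sup>2 * f2 (r\<^sup>2) * g \<theta> * p\<^sup>2 + 2 * f1 (r\<^sup>2) * g \<theta> * (p\<^sup>2 + q\<^sup>2)
       + 4 * f1 (r\<^sup>2) * g1 \<theta> * (p * q) + f (r\<^sup>2) * g2 \<theta> * q\<^sup>2 / r\<^sup>2 - 2 * f (r\<^sup>2) * g1 \<theta> * (p * q) / r\<^sup>2) (at 0)"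
proof -
  have \<rho>: "(\<rho> has_real_derivative 2 * p * (r + t * p) + 2 * t * q\<^sup>2) (at t)" for t
    unfolding \<rho>_def by (auto intro!: derivative_eq_intros simp: power2_eq_square algebra_simps)
  have \<alpha>: "(\<alpha> has_real_derivative r * q / \<rho> t) (at t)" if "r + t * p > 0" for t
    unfolding \<alpha>_def \<rho>_def using that by (rule polar_line_angle_derivative)
  note chain = DERIV_chain2
  show "((\<lambda>t. f (\<rho> t) * g (\<alpha> t)) has_real_derivative d t) (at t)" if "r + t * p > 0"
  proof -
    have "((\<lambda>t. f (\<rho> t) * g (\<alpha> t)) has_real_derivative
      (f1 (\<rho> t) * (2 * p * (r + t * p) + 2 * t * q\<^sup>2)) * g (\<alpha> t) + (g1 (\<alpha> t) * (r * q / \<rho> t)) * f (\<rho> t)) (at t)"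
      by (intro DERIV_mult chain[OF f(1) \<rho>] chain[OF g(1) \<alpha>] that)
    then show ?thesis by (simp add: d_def mult.commute)
  qed
  have z: "\<rho> 0 = r\<^sup>2" "\<alpha> 0 = \<theta>" by (auto simp: \<rho>_def \<alpha>_def)
  show "d 0 = 2 * r * f1 (r\<^sup>2) * g \<theta> * p + f (r\<^sup>2) * g1 \<theta> * q / r"
    using r by (simp add: d_def z power2_eq_square)
  have r0: "r + 0 * p > 0" using r by simp
  have lin: "((\<lambda>t. 2 * p * (r + t * p) + 2 * t * q\<^sup>2) has_real_derivative 2 * (p\<^sup>2 + q\<^sup>2)) (at 0)"
    by (auto intro!: derivative_eq_intros simp: power2_eq_square algebra_simps)
  have quo: "((\<lambda>t. r * q / \<rho> t) has_real_derivative - (2 * p * q / r\<^sup>2)) (at 0)"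
  proof -
    have "((\<lambda>t. r * q / \<rho> t) has_real_derivative (0 * \<rho> 0 - r * q * (2 * p * (r + 0 * p) + 2 * 0 * q\<^sup>2)) / (\<rho> 0 * \<rho> 0)) (at 0)"
      using r by (intro DERIV_divide DERIV_const \<rho>) (simp add: z)
    then show ?thesis using r by (simp add: z power2_eq_square field_simps)
  qed
  have "(d has_real_derivative
      ((f2 (\<rho> 0) * (2 * p * (r + 0 * p) + 2 * 0 * q\<^sup>2)) * (2 * p * (r + 0 * p) + 2 * 0 * q\<^sup>2) + 2 * (p\<^sup>2 + q\<^sup>2) * f1 (\<rho> 0)) * g (\<alpha> 0)
       + g1 (\<alpha> 0) * (r * q / \<rho> 0) * (f1 (\<rho> 0) * (2 * p * (r + 0 * p) + 2 * 0 * q\<^sup>2))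
       + (f1 (\<rho> 0) * (2 * p * (r + 0 * p) + 2 * 0 * q\<^sup>2) * (g1 (\<alpha> 0) * (r * q / \<rho> 0))
         + (g2 (\<alpha> 0) * (r * q / \<rho> 0) * (r * q / \<rho> 0) + - (2 * p * q / r\<^sup>2) * g1 (\<alpha> 0)) * f (\<rho> 0))) (at 0)"
    unfolding d_def
    by (intro DERIV_add DERIV_mult chain[OF f(1) \<rho>] chain[OF f(2) \<rho>] chain[OF g(1) \<alpha>[OF r0]] chain[OF g(2) \<alpha>[OF r0]] lin quo)
  then show "(d has_real_derivative 4 * r\<^sup>2 * f2 (r\<^sup>2) * g \<theta> * p\<^sup>2 + 2 * f1 (r\<^sup>2) * g \<theta> * (p\<^sup>2 + q\<^sup>2)
       + 4 * f1 (r\<^sup>2) * g1 \<theta> * (p * q) + f (r\<^sup>2) * g2 \<theta> * q\<^sup>2 / r\<^sup>2 - 2 * f (r\<^sup>2) * g1 \<theta> * (p * q) / r\<^sup>2) (at 0)"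
    by (rule DERIV_cong) (use r in \<open>simp add: z power2_eq_square field_simps\<close>)
qed

abbreviation e_rad :: "real \<Rightarrow> real^2" where "e_rad \<theta> \<equiv> polar_point 1 \<theta>"
abbreviation e_ang :: "real \<Rightarrow> real^2" where "e_ang \<theta> \<equiv> polar_point 1 (\<theta> + pi / 2)"

lemma radial_part_inner: "radial_part \<theta> v = v \<bullet> e_rad \<theta>"
  by (simp add: radial_part_def inner_vec_def sum_2)

lemma angular_part_inner: "angular_part \<theta> v = v \<bullet> e_ang \<theta>"
  by (simp add: angular_part_def inner_vec_def sum_2 cos_add sin_add)

lemma quadratic_form_of_decomposition:
  fixes A :: "real^2^2"
  assumes "\<And>i j. A $ i $ j = v $ i * v $ j + w $ i * w $ j"
  shows "x \<bullet> (A *v y) = (v \<bullet> x) * (v \<bullet> y) + (w \<bullet> x) * (w \<bullet> y)"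
  by (simp add: inner_vec_def matrix_vector_mult_def sum_2 assms algebra_simps)

lemma (in spiral) polar_rad_in_cl:
  "l \<in> {0..1} \<Longrightarrow> \<theta> \<ge> \<theta>0 \<Longrightarrow> polar_point (rad l \<theta>) \<theta> \<in> spiral_cl r1 r2 \<theta>0"
  using rad_bounds[of l \<theta>] unfolding spiral_cl_def by blast

text \<open>Continuous polar coordinates near an interior point stay inside the domain. The parameter space
  is left general because both lines and full planar neighbourhoods are used.\<close>

lemma (in spiral) eventually_polar_interior:
  fixes R \<alpha> :: "'a::t2_space \<Rightarrow> real"
  assumes "S \<ge> \<theta>0" "S < \<theta>" "\<theta> < T" "l \<in> {0<..<1}"
    and R: "isCont R z" "R z = rad l \<theta>" and \<alpha>: "isCont \<alpha> z" "\<alpha> z = \<theta>"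
  shows "\<forall>\<^sub>F t in nhds z. S < \<alpha> t \<and> \<alpha> t < T \<and> r1 (\<alpha> t) < R t \<and> R t < r2 (\<alpha> t)"
proof -
  have t: "\<theta> > \<theta>0" using assms by simp
  have i: "\<theta> \<in> interior {\<theta>0..}" using t by (simp add: interior_real_atLeast)
  have c: "isCont r1 (\<alpha> z)" "isCont r2 (\<alpha> z)"
    using continuous_on_interior[OF cont_r1 i] continuous_on_interior[OF cont_r2 i] \<alpha> by auto
  have at0: "(h \<longlongrightarrow> h z) (nhds z)" if "isCont h z" for h :: "'a \<Rightarrow> real"
    using that unfolding isCont_def tendsto_at_iff_tendsto_nhds .
  note lims = at0[OF \<alpha>(1)] at0[OF R(1)] at0[OF isCont_o2[OF \<alpha>(1) c(1)]] at0[OF isCont_o2[OF \<alpha>(1) c(2)]]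
  have lim: "(\<alpha> \<longlongrightarrow> \<theta>) (nhds z)"
    "((\<lambda>t. r1 (\<alpha> t) - R t) \<longlongrightarrow> r1 \<theta> - rad l \<theta>) (nhds z)"
    "((\<lambda>t. r2 (\<alpha> t) - R t) \<longlongrightarrow> r2 \<theta> - rad l \<theta>) (nhds z)"
    using lims(1) tendsto_diff[OF lims(3) lims(2)] tendsto_diff[OF lims(4) lims(2)]
    unfolding \<alpha>(2) R(2) by - assumption+
  have b: "r1 \<theta> < rad l \<theta>" "rad l \<theta> < r2 \<theta>"
    using rad_interior_bounds[OF assms(4)] t by auto
  have "\<forall>\<^sub>F t in nhds z. S < \<alpha> t" by (rule order_tendstoD(1)[OF lim(1) assms(2)])
  moreover have "\<forall>\<^sub>F t in nhds z. \<alpha> t < T" by (rule order_tendstoD(2)[OF lim(1) assms(3)])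
  moreover have "\<forall>\<^sub>F t in nhds z. r1 (\<alpha> t) - R t < 0"
    by (rule order_tendstoD(2)[OF lim(2)]) (use b in simp)
  moreover have "\<forall>\<^sub>F t in nhds z. 0 < r2 (\<alpha> t) - R t"
    by (rule order_tendstoD(1)[OF lim(3)]) (use b in simp)
  ultimately show ?thesis by eventually_elim auto
qed

text \<open>Polar coordinates chosen by the arctangent depend continuously on the point, so they remain in
  the open region of parameters.\<close>

lemma (in spiral) open_spiral_dom: "open (spiral_dom r1 r2 \<theta>0)"
proof (subst open_subopen, intro ballI)
  fix x assume "x \<in> spiral_dom r1 r2 \<theta>0"
  then obtain r \<theta> where x: "x = polar_point r \<theta>" "\<theta> > \<theta>0" "r1 \<theta> < r" "r < r2 \<theta>"
    by (auto simp: spiral_dom_def)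
  obtain l where l: "l \<in> {0..1}" "r = rad l \<theta>" by (rule rad_surj[of \<theta> r]) (use x in auto)
  have "l \<noteq> 0" "l \<noteq> 1" using l x by (auto simp: rad_def)
  with l have li: "l \<in> {0<..<1}" by auto
  have r: "r > 0" using x r1_pos[of \<theta>] by simp
  have lin: "isCont (radial_part \<theta>) v" "isCont (angular_part \<theta>) v" for v
    unfolding radial_part_def angular_part_def by (intro continuous_intros)+
  define R where "R = (\<lambda>y. sqrt ((r + radial_part \<theta> (y - x))\<^sup>2 + (angular_part \<theta> (y - x))\<^sup>2))"
  define \<alpha> where "\<alpha> = (\<lambda>y. \<theta> + arctan (angular_part \<theta> (y - x) / (r + radial_part \<theta> (y - x))))"
  have z: "radial_part \<theta> 0 = 0" "angular_part \<theta> 0 = 0" by (simp_all add: radial_part_def angular_part_def)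
  have c: "isCont (\<lambda>y. radial_part \<theta> (y - x)) x" "isCont (\<lambda>y. angular_part \<theta> (y - x)) x"
    by (intro isCont_o2[OF _ lin(1)] isCont_o2[OF _ lin(2)] continuous_intros)+
  have "\<forall>\<^sub>F y in nhds x. \<theta>0 < \<alpha> y \<and> \<alpha> y < \<theta> + 1 \<and> r1 (\<alpha> y) < R y \<and> R y < r2 (\<alpha> y)"
  proof (rule eventually_polar_interior[OF order_refl _ _ li])
    show "isCont R x" unfolding R_def by (intro continuous_intros c)
    show "isCont \<alpha> x" unfolding \<alpha>_def using r by (intro continuous_intros c) (simp add: z)
  qed (use x l r in \<open>auto simp: R_def \<alpha>_def z\<close>)
  moreover have "\<forall>\<^sub>F y in nhds x. r + radial_part \<theta> (y - x) > 0"
  proof -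
    have "((\<lambda>y. r + radial_part \<theta> (y - x)) \<longlongrightarrow> r + radial_part \<theta> (x - x)) (nhds x)"
      using isCont_add[OF continuous_const c(1), of r]
        tendsto_at_iff_tendsto_nhds[of "\<lambda>y. r + radial_part \<theta> (y - x)" x]
      unfolding isCont_def by simp
    from order_tendstoD(1)[OF this, of 0] show ?thesis using r by (simp add: z)
  qed
  ultimately have "\<forall>\<^sub>F y in nhds x. y \<in> spiral_dom r1 r2 \<theta>0"
  proof eventually_elim
    case (elim y)
    have "x + 1 *\<^sub>R (y - x) = polar_point (R y) (\<alpha> y)"
      unfolding R_def \<alpha>_def x(1) using polar_line[of r 1 \<theta> "y - polar_point r \<theta>"] elim(2) by (simp add: x(1))
    then have "y = polar_point (R y) (\<alpha> y)" by simp
    then show ?case using elim(1) unfolding spiral_dom_def by blast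
  qed
  then show "\<exists>T. open T \<and> x \<in> T \<and> T \<subseteq> spiral_dom r1 r2 \<theta>0"
    unfolding eventually_nhds by blast
qed

locale elliptic_spiral = spiral +
  fixes A :: "real^2 \<Rightarrow> real^2^2" and b :: "real^2 \<Rightarrow> real^2" and c0 M1 M2 Rbar :: real
  assumes A_sym: "\<And>x. x \<in> spiral_dom r1 r2 \<theta>0 \<Longrightarrow> transpose (A x) = A x"
    and c0_pos: "c0 > 0"
    and A_elliptic: "\<And>x \<xi>. x \<in> spiral_dom r1 r2 \<theta>0 \<Longrightarrow> c0 * (norm \<xi>)\<^sup>2 \<le> \<xi> \<bullet> (A x *v \<xi>)"
    and A_trace: "\<And>x. x \<in> spiral_dom r1 r2 \<theta>0 \<Longrightarrow> trace (A x) \<le> M1"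
    and b_bound: "\<And>x. x \<in> spiral_dom r1 r2 \<theta>0 \<Longrightarrow> norm (b x) \<le> M2"
    and rad_le: "\<And>\<theta>. \<theta> \<ge> \<theta>0 \<Longrightarrow> r2 \<theta> \<le> Rbar"
begin

text \<open>The hypothesis \<open>super\<close> says that \<open>f (r\<^sup>2) * g \<theta>\<close> is a strict supersolution, written out in the
  orthonormal frame of polar coordinates; \<open>arr\<close>, \<open>art\<close>, \<open>att\<close> are the entries of \<open>A\<close> and \<open>br\<close>, \<open>bt\<close> those of
  \<open>b\<close> in this frame. The angle is not a function on the plane, so the difference is maximised over
  the rectangle of parameters \<open>(l, \<theta>)\<close>. A positive maximum can lie only in the interior of the
  rectangle. There the gradients agree and the Hessians are ordered along every direction, so that
  the operator is positive on \<open>u\<close>, a contradiction.\<close>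

lemma comparison:
  fixes u :: "real^2 \<Rightarrow> real" and f f1 f2 g g1 g2 :: "real \<Rightarrow> real"
  assumes f: "\<And>x. (f has_real_derivative f1 x) (at x)" "\<And>x. (f1 has_real_derivative f2 x) (at x)"
    and g: "\<And>x. (g has_real_derivative g1 x) (at x)" "\<And>x. (g1 has_real_derivative g2 x) (at x)"
    and ST: "\<theta>0 \<le> S" "S < T"
    and C2: "C2_on (spiral_dom r1 r2 \<theta>0) u" and cont: "continuous_on (spiral_cl r1 r2 \<theta>0) u"
    and sub: "\<And>x. x \<in> spiral_dom r1 r2 \<theta>0 \<Longrightarrow> elliptic_op A b u x \<le> 0"
    and super: "\<And>l \<theta> r arr art att br bt. \<lbrakk>l \<in> {0<..<1}; S < \<theta>; \<theta> < T; r = rad l \<theta>;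
      arr = e_rad \<theta> \<bullet> (A (curve l \<theta>) *v e_rad \<theta>); art = e_rad \<theta> \<bullet> (A (curve l \<theta>) *v e_ang \<theta>);
      att = e_ang \<theta> \<bullet> (A (curve l \<theta>) *v e_ang \<theta>); br = b (curve l \<theta>) \<bullet> e_rad \<theta>; bt = b (curve l \<theta>) \<bullet> e_ang \<theta>\<rbrakk> \<Longrightarrow>
        4 * r\<^sup>2 * f2 (r\<^sup>2) * g \<theta> * arr + 2 * f1 (r\<^sup>2) * g \<theta> * (arr + att) + 4 * f1 (r\<^sup>2) * g1 \<theta> * art
        + f (r\<^sup>2) * g2 \<theta> * att / r\<^sup>2 - 2 * f (r\<^sup>2) * g1 \<theta> * art / r\<^sup>2
        < 2 * r * f1 (r\<^sup>2) * g \<theta> * br + f (r\<^sup>2) * g1 \<theta> * bt / r"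
    and side: "\<And>\<theta> l. S \<le> \<theta> \<Longrightarrow> \<theta> \<le> T \<Longrightarrow> l = 0 \<or> l = 1 \<Longrightarrow> u (curve l \<theta>) \<le> f ((rad l \<theta>)\<^sup>2) * g \<theta>"
    and ends: "\<And>\<theta> l. \<theta> = S \<or> \<theta> = T \<Longrightarrow> l \<in> {0..1} \<Longrightarrow> u (curve l \<theta>) \<le> f ((rad l \<theta>)\<^sup>2) * g \<theta>"
    and l: "l \<in> {0..1}" and \<theta>: "S \<le> \<theta>" "\<theta> \<le> T"
  shows "u (curve l \<theta>) \<le> f ((rad l \<theta>)\<^sup>2) * g \<theta>"
proof (rule ccontr)
  assume neg: "\<not> ?thesis"
  define \<Phi> where "\<Phi> = (\<lambda>(l, \<theta>). u (curve l \<theta>) - f ((rad l \<theta>)\<^sup>2) * g \<theta>)"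
  define K where "K = {0..1::real} \<times> {S..T}"
  have cf: "continuous_on UNIV f" "continuous_on UNIV g"
    by (intro continuous_at_imp_continuous_on ballI DERIV_isCont[OF f(1)] DERIV_isCont[OF g(1)])+
  have "continuous_on K \<Phi>"
    unfolding \<Phi>_def case_prod_unfold K_def curve_eq
    by (intro continuous_intros continuous_on_compose2[OF cont] continuous_on_compose2[OF cf(1)]
        continuous_on_compose2[OF cf(2)])
       (use ST in \<open>auto intro: polar_rad_in_cl\<close>)
  moreover have "compact K" "K \<noteq> {}" using ST by (auto simp: K_def intro: compact_Times)
  ultimately have "\<exists>p\<in>K. \<forall>y\<in>K. \<Phi> y \<le> \<Phi> p" by (intro continuous_attains_sup)
  then obtain p where p: "p \<in> K" "\<And>y. y \<in> K \<Longrightarrow> \<Phi> y \<le> \<Phi> p" by blast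
  obtain l0 t0 where lt: "p = (l0, t0)" by (cases p)
  have "\<Phi> p > 0" using p(2)[of "(l, \<theta>)"] neg l \<theta> by (auto simp: K_def \<Phi>_def)
  then have int: "l0 \<in> {0<..<1}" "S < t0" "t0 < T"
    using side[of t0 l0] ends[of t0 l0] p(1) unfolding lt K_def \<Phi>_def by force+
  define r where "r = rad l0 t0"
  define x where "x = curve l0 t0"
  have t0: "t0 > \<theta>0" "l0 \<in> {0..1}" using int ST by auto
  have r: "r > 0" unfolding r_def using t0 by (intro rad_pos) auto
  have xU: "x \<in> spiral_dom r1 r2 \<theta>0" unfolding x_def using int t0 by (intro curve_interior) auto
  have xp: "x = polar_point r t0" by (simp add: x_def r_def curve_eq)
  \<comment> \<open>Near \<open>t = 0\<close> the line through \<open>x\<close> stays in the image of the rectangle, so \<open>t = 0\<close> is a local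
    maximum of the difference along it.\<close>
  have line: "v \<bullet> gradient u x = 2 * r * f1 (r\<^sup>2) * g t0 * (v \<bullet> e_rad t0) + f (r\<^sup>2) * g1 t0 * (v \<bullet> e_ang t0) / r \<and>
     (\<Sum>i\<in>UNIV. \<Sum>j\<in>UNIV. v $ i * v $ j * partial_deriv i (partial_deriv j u) x) \<le>
       4 * r\<^sup>2 * f2 (r\<^sup>2) * g t0 * (v \<bullet> e_rad t0)\<^sup>2 + 2 * f1 (r\<^sup>2) * g t0 * ((v \<bullet> e_rad t0)\<^sup>2 + (v \<bullet> e_ang t0)\<^sup>2)
       + 4 * f1 (r\<^sup>2) * g1 t0 * ((v \<bullet> e_rad t0) * (v \<bullet> e_ang t0)) + f (r\<^sup>2) * g2 t0 * (v \<bullet> e_ang t0)\<^sup>2 / r\<^sup>2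
       - 2 * f (r\<^sup>2) * g1 t0 * ((v \<bullet> e_rad t0) * (v \<bullet> e_ang t0)) / r\<^sup>2" (is "?grad \<and> ?D \<le> ?E") for v
  proof -
    define p where "p = v \<bullet> e_rad t0"
    define q where "q = v \<bullet> e_ang t0"
    define \<rho> where "\<rho> = (\<lambda>t. (r + t * p)\<^sup>2 + (t * q)\<^sup>2)"
    define \<alpha> where "\<alpha> = (\<lambda>t. t0 + arctan (t * q / (r + t * p)))"
    define d where "d = (\<lambda>t. f1 (\<rho> t) * (2 * p * (r + t * p) + 2 * t * q\<^sup>2) * g (\<alpha> t) + f (\<rho> t) * (g1 (\<alpha> t) * (r * q / \<rho> t)))"
    note H = polar_product_along_line[OF f g r, where p=p and q=q and \<theta>=t0]
    have H1: "((\<lambda>t. f (\<rho> t) * g (\<alpha> t)) has_real_derivative d t) (at t)" if "r + t * p > 0" for t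
      unfolding \<rho>_def \<alpha>_def d_def using that by (rule H(1))
    have H2: "d 0 = 2 * r * f1 (r\<^sup>2) * g t0 * p + f (r\<^sup>2) * g1 t0 * q / r"
      unfolding \<rho>_def \<alpha>_def d_def by (rule H(2))
    have H3: "(d has_real_derivative 4 * r\<^sup>2 * f2 (r\<^sup>2) * g t0 * p\<^sup>2 + 2 * f1 (r\<^sup>2) * g t0 * (p\<^sup>2 + q\<^sup>2)
       + 4 * f1 (r\<^sup>2) * g1 t0 * (p * q) + f (r\<^sup>2) * g2 t0 * q\<^sup>2 / r\<^sup>2 - 2 * f (r\<^sup>2) * g1 t0 * (p * q) / r\<^sup>2) (at 0)"
      unfolding \<rho>_def \<alpha>_def d_def by (rule H(3))
    have rp: "\<forall>\<^sub>F t in nhds 0. r + t * p > 0"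
    proof -
      have "((\<lambda>t. r + t * p) \<longlongrightarrow> r + 0 * p) (nhds 0)" by (intro tendsto_intros filterlim_ident)
      from order_tendstoD(1)[OF this, of 0] show ?thesis using r by simp
    qed
    have "isCont \<alpha> 0" unfolding \<alpha>_def using r by (intro continuous_intros) auto
    moreover have "isCont (\<lambda>t. sqrt (\<rho> t)) 0" unfolding \<rho>_def by (intro continuous_intros)
    moreover have "sqrt (\<rho> 0) = rad l0 t0" "\<alpha> 0 = t0" using r by (auto simp: \<rho>_def \<alpha>_def r_def)
    ultimately have inside: "\<forall>\<^sub>F t in nhds 0. S < \<alpha> t \<and> \<alpha> t < T \<and> r1 (\<alpha> t) < sqrt (\<rho> t) \<and> sqrt (\<rho> t) < r2 (\<alpha> t)"
      using int ST by (intro eventually_polar_interior) auto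
    have pos: "\<forall>\<^sub>F t in nhds 0. x + t *\<^sub>R v = polar_point (sqrt (\<rho> t)) (\<alpha> t)"
      using rp
    proof eventually_elim
      case (elim t)
      then show ?case using polar_line[of r t t0 v]
        unfolding radial_part_inner angular_part_inner xp \<rho>_def \<alpha>_def p_def q_def by simp
    qed
    define \<phi> where "\<phi> = (\<lambda>t. u (x + t *\<^sub>R v) - f (\<rho> t) * g (\<alpha> t))"
    define \<phi>' where "\<phi>' = (\<lambda>t. v \<bullet> gradient u (x + t *\<^sub>R v) - d t)"
    have z: "\<rho> 0 = r\<^sup>2" "\<alpha> 0 = t0" by (auto simp: \<rho>_def \<alpha>_def)
    have "\<phi>' 0 = 0 \<and> ?D - ?E \<le> 0"
    proof (rule second_derivative_test_max[of \<phi>])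
      show "\<forall>\<^sub>F t in nhds 0. (\<phi> has_real_derivative \<phi>' t) (at t)"
        using rp pos inside
      proof eventually_elim
        case (elim t)
        have "x + t *\<^sub>R v \<in> spiral_dom r1 r2 \<theta>0"
          unfolding elim(2) spiral_dom_def using elim(3) ST(1) by force
        then have "u differentiable (at (x + t *\<^sub>R v))" using C2 by (auto simp: C2_on_def)
        then show ?case unfolding \<phi>_def \<phi>'_def
          by (intro DERIV_diff differentiable_along_line H1 elim)
      qed
      show "(\<phi>' has_real_derivative ?D - ?E) (at 0)"
        unfolding \<phi>'_def using H3 unfolding p_def q_def
        by (intro DERIV_diff C2_second_derivative_along_line[OF C2 xU])
      show "\<forall>\<^sub>F t in nhds 0. \<phi> t \<le> \<phi> 0"
        using pos inside
      proof eventually_elim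
        case (elim t)
        then have "\<alpha> t \<ge> \<theta>0" "r1 (\<alpha> t) \<le> sqrt (\<rho> t)" "sqrt (\<rho> t) \<le> r2 (\<alpha> t)" using ST by auto
        then obtain l1 where l1: "l1 \<in> {0..1}" "sqrt (\<rho> t) = rad l1 (\<alpha> t)" by (rule rad_surj)
        have "(rad l1 (\<alpha> t))\<^sup>2 = \<rho> t" unfolding l1(2)[symmetric] by (simp add: \<rho>_def)
        then have "\<phi> t = \<Phi> (l1, \<alpha> t)" unfolding \<phi>_def \<Phi>_def elim(1) l1(2) by (simp add: curve_eq)
        also have "\<dots> \<le> \<Phi> (l0, t0)"
          using p(2)[of "(l1, \<alpha> t)"] l1 elim lt by (auto simp: K_def)
        also have "\<Phi> (l0, t0) = \<phi> 0" by (simp add: \<phi>_def \<Phi>_def z x_def r_def)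
        finally show ?case by simp
      qed
    qed
    then show ?thesis using H2 by (simp add: \<phi>'_def p_def q_def)
  qed
  obtain v w where vw: "\<And>i j. A x $ i $ j = v $ i * v $ j + w $ i * w $ j"
    using pos_def_2_decompose[OF A_sym[OF xU] A_elliptic[OF xU] c0_pos] by blast
  note Q = quadratic_form_of_decomposition[of "A x" v w, OF vw]
  have "(\<Sum>i\<in>UNIV. \<Sum>j\<in>UNIV. A x $ i $ j * partial_deriv i (partial_deriv j u) x) =
      (\<Sum>i\<in>UNIV. \<Sum>j\<in>UNIV. v $ i * v $ j * partial_deriv i (partial_deriv j u) x)
      + (\<Sum>i\<in>UNIV. \<Sum>j\<in>UNIV. w $ i * w $ j * partial_deriv i (partial_deriv j u) x)"
    by (simp add: vw distrib_right sum.distrib)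
  also have "\<dots> \<le> 4 * r\<^sup>2 * f2 (r\<^sup>2) * g t0 * (e_rad t0 \<bullet> (A x *v e_rad t0))
     + 2 * f1 (r\<^sup>2) * g t0 * (e_rad t0 \<bullet> (A x *v e_rad t0) + e_ang t0 \<bullet> (A x *v e_ang t0))
     + 4 * f1 (r\<^sup>2) * g1 t0 * (e_rad t0 \<bullet> (A x *v e_ang t0))
     + f (r\<^sup>2) * g2 t0 * (e_ang t0 \<bullet> (A x *v e_ang t0)) / r\<^sup>2
     - 2 * f (r\<^sup>2) * g1 t0 * (e_rad t0 \<bullet> (A x *v e_ang t0)) / r\<^sup>2"
    by (rule order_trans[OF add_mono[OF conjunct2[OF line[of v]] conjunct2[OF line[of w]]]])
       (simp add: Q power2_eq_square algebra_simps add_divide_distrib)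
  also have "\<dots> < 2 * r * f1 (r\<^sup>2) * g t0 * (b x \<bullet> e_rad t0) + f (r\<^sup>2) * g1 t0 * (b x \<bullet> e_ang t0) / r"
    by (rule super[OF int r_def, folded x_def]) (rule refl)+
  also have "\<dots> = b x \<bullet> gradient u x" using line[of "b x"] by simp
  finally have "elliptic_op A b u x > 0" by (simp add: elliptic_op_gradient)
  with sub[OF xU] show False by simp
qed

end

section \<open>Maximum principle and exponential barriers\<close>

text \<open>A quantitative two-sided decay: from the cross-sections \<open>S\<close> and \<open>T\<close> inwards the values fall off
  exponentially in the angle.\<close>

definition (in spiral) decays_between :: "real \<Rightarrow> (real^2 \<Rightarrow> real) \<Rightarrow> bool" where
  "decays_between \<Theta>1 v \<longleftrightarrow> (\<forall>S T m1 m2. \<Theta>1 \<le> S \<and> S < T \<and> 0 \<le> m1 \<and> 0 \<le> m2 \<and>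
     (\<forall>l\<in>{0..1}. v (curve l S) \<le> m1) \<and> (\<forall>l\<in>{0..1}. v (curve l T) \<le> m2) \<longrightarrow>
     (\<forall>l\<in>{0..1}. \<forall>\<theta>\<in>{S..T}. v (curve l \<theta>) \<le> 2 * (m1 * exp (S - \<theta>) + m2 * exp (\<theta> - T))))"

context elliptic_spiral
begin

text \<open>The mixed entry is controlled by the trace: in the factorised form of \<open>A\<close> this is the inequality
  between arithmetic and geometric mean.\<close>

lemma frame_bounds:
  assumes "x \<in> spiral_dom r1 r2 \<theta>0"
  shows "c0 \<le> e_rad \<theta> \<bullet> (A x *v e_rad \<theta>)" "c0 \<le> e_ang \<theta> \<bullet> (A x *v e_ang \<theta>)"
    "e_rad \<theta> \<bullet> (A x *v e_rad \<theta>) + e_ang \<theta> \<bullet> (A x *v e_ang \<theta>) \<le> M1"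
    "2 * \<bar>e_rad \<theta> \<bullet> (A x *v e_ang \<theta>)\<bar> \<le> M1"
    "\<bar>b x \<bullet> e_rad \<theta>\<bar> \<le> M2" "\<bar>b x \<bullet> e_ang \<theta>\<bar> \<le> M2"
proof -
  show "c0 \<le> e_rad \<theta> \<bullet> (A x *v e_rad \<theta>)" "c0 \<le> e_ang \<theta> \<bullet> (A x *v e_ang \<theta>)"
    using A_elliptic[OF assms, of "e_rad \<theta>"] A_elliptic[OF assms, of "e_ang \<theta>"] by (simp_all add: norm_polar_point)
  have s: "cos \<theta> * cos \<theta> = 1 - sin \<theta> * sin \<theta>"
    using sin_cos_squared_add[of \<theta>] by (simp add: power2_eq_square)
  have "e_rad \<theta> \<bullet> (A x *v e_rad \<theta>) + e_ang \<theta> \<bullet> (A x *v e_ang \<theta>) = A x $ 1 $ 1 + A x $ 2 $ 2"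
    unfolding inner_vec_def matrix_vector_mult_def sum_2
    by (simp add: cos_add sin_add) (use s in algebra)
  also have "\<dots> = trace (A x)" by (simp add: trace_def sum_2)
  finally show tr: "e_rad \<theta> \<bullet> (A x *v e_rad \<theta>) + e_ang \<theta> \<bullet> (A x *v e_ang \<theta>) \<le> M1"
    using A_trace[OF assms] by simp
  obtain v w where vw: "\<And>i j. A x $ i $ j = v $ i * v $ j + w $ i * w $ j"
    using pos_def_2_decompose[OF A_sym[OF assms] A_elliptic[OF assms] c0_pos] by blast
  note Q = quadratic_form_of_decomposition[of "A x" v w, OF vw]
  have "2 * \<bar>p * q + p' * q'\<bar> \<le> (p * p + p' * p') + (q * q + q' * q')" for p q p' q' :: real
  proof -
    have "0 \<le> (p - q)\<^sup>2 + (p' - q')\<^sup>2" "0 \<le> (p + q)\<^sup>2 + (p' + q')\<^sup>2" by simp_all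
    then show ?thesis
      by (cases "p * q + p' * q' \<ge> 0") (auto simp: power2_eq_square algebra_simps)
  qed
  then show "2 * \<bar>e_rad \<theta> \<bullet> (A x *v e_ang \<theta>)\<bar> \<le> M1"
    using tr unfolding Q by (meson order_trans)
  have "\<bar>b x \<bullet> e\<bar> \<le> M2" if "norm e = 1" for e
    using Cauchy_Schwarz_ineq2[of "b x" e] b_bound[OF assms] that by simp
  then show "\<bar>b x \<bullet> e_rad \<theta>\<bar> \<le> M2" "\<bar>b x \<bullet> e_ang \<theta>\<bar> \<le> M2"
    by (simp_all add: norm_polar_point)
qed

definition subsolution :: "(real^2 \<Rightarrow> real) \<Rightarrow> bool" where
  "subsolution u \<longleftrightarrow> C2_on (spiral_dom r1 r2 \<theta>0) u \<and> continuous_on (spiral_cl r1 r2 \<theta>0) u \<and>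
     (\<forall>x\<in>spiral_dom r1 r2 \<theta>0. elliptic_op A b u x \<le> 0) \<and> (\<forall>x\<in>spiral_side r1 r2 \<theta>0. u x \<le> 0)"

lemma subsolutionD:
  assumes "subsolution u"
  shows "C2_on (spiral_dom r1 r2 \<theta>0) u" "continuous_on (spiral_cl r1 r2 \<theta>0) u"
    "\<And>x. x \<in> spiral_dom r1 r2 \<theta>0 \<Longrightarrow> elliptic_op A b u x \<le> 0"
    "\<And>l \<theta>. \<theta>0 \<le> \<theta> \<Longrightarrow> l = 0 \<or> l = 1 \<Longrightarrow> u (curve l \<theta>) \<le> 0"
  using assms curve_side by (auto simp: subsolution_def)

text \<open>The function \<open>m + \<epsilon> * (K - exp (a * r\<^sup>2))\<close> is a strict supersolution on the whole domain when \<open>a\<close> is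
  large, because \<open>exp (a * r\<^sup>2)\<close> is a strict subsolution.\<close>

lemma maximum_principle:
  assumes u: "subsolution u" and T: "\<theta>0 < T" and m: "m \<ge> 0"
    and ends: "\<And>l \<theta>. l \<in> {0..1} \<Longrightarrow> \<theta> = \<theta>0 \<or> \<theta> = T \<Longrightarrow> u (curve l \<theta>) \<le> m"
    and l: "l \<in> {0..1}" and \<theta>: "\<theta>0 \<le> \<theta>" "\<theta> \<le> T"
  shows "u (curve l \<theta>) \<le> m"
proof -
  \<comment> \<open>The quadratic polynomial \<open>4 a c0 r\<^sup>2 + 4 c0 - 2 M2 r\<close> has negative discriminant once \<open>a > M2\<^sup>2 / (16 c0\<^sup>2)\<close>;
    the value below leaves room.\<close>
  define a where "a = 1 + M2\<^sup>2 / (4 * c0\<^sup>2)"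
  define K where "K = exp (a * Rbar\<^sup>2)"
  have a2: "M2\<^sup>2 / (4 * c0\<^sup>2) \<le> 2 * a"
  proof -
    have *: "y \<le> 2 * (1 + y)" if "y \<ge> 0" for y :: real using that by simp
    show ?thesis unfolding a_def by (rule *) simp
  qed
  have a: "a > 0" unfolding a_def by (intro add_pos_nonneg) auto
  \<comment> \<open>The barrier is strict only for \<open>\<epsilon> > 0\<close>.\<close>
  have "u (curve l \<theta>) \<le> m + \<epsilon> * K" if e: "\<epsilon> > 0" for \<epsilon>
  proof -
    let ?f = "\<lambda>x. m + \<epsilon> * (K - exp (a * x))"
    have f_lower: "m \<le> ?f ((rad l \<theta>)\<^sup>2)" if "l \<in> {0..1}" "\<theta>0 \<le> \<theta>" for l \<theta>
    proof -
      have "(rad l \<theta>)\<^sup>2 \<le> Rbar\<^sup>2"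
        using rad_pos[OF that] rad_bounds(2)[OF that] rad_le[OF that(2)] by (intro power_mono) auto
      then have "exp (a * (rad l \<theta>)\<^sup>2) \<le> K" unfolding K_def using a by simp
      then show ?thesis using e by simp
    qed
    have "u (curve l \<theta>) \<le> ?f ((rad l \<theta>)\<^sup>2) * 1"
    proof (rule comparison[where ?f1.0 = "\<lambda>x. - \<epsilon> * a * exp (a * x)" and ?f2.0 = "\<lambda>x. - \<epsilon> * a\<^sup>2 * exp (a * x)"
          and g = "\<lambda>_. 1" and ?g1.0 = "\<lambda>_. 0" and ?g2.0 = "\<lambda>_. 0" and S = \<theta>0 and T = T and u = u])
      show "(?f has_real_derivative - \<epsilon> * a * exp (a * x)) (at x)" for x
        by (auto intro!: derivative_eq_intros)
      show "((\<lambda>x. - \<epsilon> * a * exp (a * x)) has_real_derivative - \<epsilon> * a\<^sup>2 * exp (a * x)) (at x)" for x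
        by (auto intro!: derivative_eq_intros simp: power2_eq_square)
      fix l \<theta> r arr art att br bt
      assume l: "l \<in> {0<..<1}" and \<theta>: "\<theta>0 < \<theta>" "\<theta> < T" and r_eq: "r = rad l \<theta>"
        and eqs: "arr = e_rad \<theta> \<bullet> (A (curve l \<theta>) *v e_rad \<theta>)" "art = e_rad \<theta> \<bullet> (A (curve l \<theta>) *v e_ang \<theta>)"
          "att = e_ang \<theta> \<bullet> (A (curve l \<theta>) *v e_ang \<theta>)" "br = b (curve l \<theta>) \<bullet> e_rad \<theta>" "bt = b (curve l \<theta>) \<bullet> e_ang \<theta>"
      have r: "r > 0" unfolding r_eq using l \<theta> by (intro rad_pos) auto
      note fb = frame_bounds[OF curve_interior[OF l \<theta>(1)], of \<theta>, folded eqs]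
      have "(r * M2 - 2 * c0)\<^sup>2 \<ge> 0" by simp
      then have "r * M2 \<le> r\<^sup>2 * (M2\<^sup>2 / (4 * c0\<^sup>2)) * c0 + c0"
        using c0_pos by (simp add: field_simps power2_eq_square)
      also have "\<dots> < 2 * a * r\<^sup>2 * c0 + 2 * c0"
      proof -
        have "r\<^sup>2 * (M2\<^sup>2 / (4 * c0\<^sup>2)) * c0 \<le> r\<^sup>2 * (2 * a) * c0"
          using c0_pos by (intro mult_right_mono mult_left_mono a2) auto
        then show ?thesis using c0_pos by (simp add: mult_ac)
      qed
      also have "\<dots> \<le> 2 * a * r\<^sup>2 * arr + (arr + att)"
        using fb(1,2) a by (intro add_mono mult_left_mono) auto
      finally have "r * br < 2 * a * r\<^sup>2 * arr + (arr + att)"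
        using mult_left_mono[OF fb(5), of r] r abs_ge_self[of br] by (smt (verit) mult_left_mono)
      then have "0 < 2 * \<epsilon> * a * exp (a * r\<^sup>2) * (2 * a * r\<^sup>2 * arr + (arr + att) - r * br)"
        using e a by simp
      then show "4 * r\<^sup>2 * (- \<epsilon> * a\<^sup>2 * exp (a * r\<^sup>2)) * 1 * arr + 2 * (- \<epsilon> * a * exp (a * r\<^sup>2)) * 1 * (arr + att)
          + 4 * (- \<epsilon> * a * exp (a * r\<^sup>2)) * 0 * art + ?f (r\<^sup>2) * 0 * att / r\<^sup>2 - 2 * ?f (r\<^sup>2) * 0 * art / r\<^sup>2
          < 2 * r * (- \<epsilon> * a * exp (a * r\<^sup>2)) * 1 * br + ?f (r\<^sup>2) * 0 * bt / r"
        by (simp add: power2_eq_square algebra_simps)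
    next
      show "u (curve l \<theta>) \<le> ?f ((rad l \<theta>)\<^sup>2) * 1" if "\<theta>0 \<le> \<theta>" "\<theta> \<le> T" "l = 0 \<or> l = 1" for \<theta> l
        using subsolutionD(4)[OF u that(1,3)] f_lower[of l \<theta>] m that by force
      show "u (curve l \<theta>) \<le> ?f ((rad l \<theta>)\<^sup>2) * 1" if "\<theta> = \<theta>0 \<or> \<theta> = T" "l \<in> {0..1}" for \<theta> l
        using ends[OF that(2,1)] f_lower[of l \<theta>] that T by force
    qed (use subsolutionD[OF u] l \<theta> T in auto)
    also have "\<dots> \<le> m + \<epsilon> * K" using e by simp
    finally show ?thesis .
  qed
  then have "\<forall>\<^sub>F \<epsilon> in at_right 0. u (curve l \<theta>) \<le> m + \<epsilon> * K"
    by (auto simp: eventually_at_right_field intro!: exI[of _ 1])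
  moreover have "((\<lambda>\<epsilon>. m + \<epsilon> * K) \<longlongrightarrow> m + 0 * K) (at_right 0)" by (intro tendsto_intros)
  ultimately show ?thesis
    using tendsto_lowerbound[of "\<lambda>\<epsilon>. m + \<epsilon> * K" "m + 0 * K" "at_right 0" "u (curve l \<theta>)"] by simp
qed

text \<open>The barrier is \<open>(2 - N * (r\<^sup>2 - rstar\<^sup>2)\<^sup>2) * (m1 * exp (S - \<theta>) + m2 * exp (\<theta> - T))\<close>. Its radial factor
  contributes \<open>8 * N * r\<^sup>2 * c0\<close> with the good sign, and \<open>N\<close> is chosen to beat the terms in which derivatives fall on
  the exponentials, whose coefficients are bounded in terms of \<open>M1\<close>, \<open>M2\<close> and \<open>rstar\<close>. All remaining terms contain the derivative
  \<open>- 2 * N * (r\<^sup>2 - rstar\<^sup>2)\<close> of the radial factor, and they are harmless as soon as the turn is so late that \<open>r\<close> is close to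
  \<open>rstar\<close>. The threshold \<open>\<Theta>1\<close> does not depend on the subsolution.\<close>

lemma exponential_barrier:
  obtains \<Theta>1 where "\<Theta>1 \<ge> \<theta>0" "\<And>u. subsolution u \<Longrightarrow> decays_between \<Theta>1 u"
proof -
  define s where "s = rstar\<^sup>2"
  \<comment> \<open>The absolute values make \<open>N\<close> positive without knowing the signs of \<open>M1\<close> and \<open>M2\<close>.\<close>
  define N where "N = (1 + 4 * \<bar>M1\<bar> + 16 * \<bar>M1\<bar> / rstar\<^sup>2 + 4 * rstar * \<bar>M2\<bar> + 4 * \<bar>M2\<bar> / rstar) / (rstar\<^sup>2 * c0)"
  have num: "1 + 4 * \<bar>M1\<bar> + 16 * \<bar>M1\<bar> / rstar\<^sup>2 + 4 * rstar * \<bar>M2\<bar> + 4 * \<bar>M2\<bar> / rstar > 0"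
    using rstar_pos by (intro add_pos_nonneg) auto
  have N: "N > 0" unfolding N_def using num rstar_pos c0_pos by simp
  have N_eq: "N * rstar\<^sup>2 * c0 = 1 + 4 * \<bar>M1\<bar> + 16 * \<bar>M1\<bar> / rstar\<^sup>2 + 4 * rstar * \<bar>M2\<bar> + 4 * \<bar>M2\<bar> / rstar"
    unfolding N_def using rstar_pos c0_pos by simp
  define P where "P = (\<lambda>r. rstar / 2 < r \<and> r < 2 * rstar \<and> N * (r\<^sup>2 - s)\<^sup>2 < 1 \<and> \<bar>2 * N * (r\<^sup>2 - s)\<bar> < 1)"
  have evP: "\<forall>\<^sub>F r in nhds rstar. P r"
  proof -
    have "((\<lambda>r. N * (r\<^sup>2 - s)\<^sup>2) \<longlongrightarrow> N * (rstar\<^sup>2 - s)\<^sup>2) (nhds rstar)"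
      "((\<lambda>r. \<bar>2 * N * (r\<^sup>2 - s)\<bar>) \<longlongrightarrow> \<bar>2 * N * (rstar\<^sup>2 - s)\<bar>) (nhds rstar)"
      "((\<lambda>r. r) \<longlongrightarrow> rstar) (nhds rstar)"
      by (intro tendsto_intros filterlim_ident)+
    note L = order_tendstoD[OF this(1)] order_tendstoD[OF this(2)] order_tendstoD[OF this(3)]
    have "\<forall>\<^sub>F r in nhds rstar. N * (r\<^sup>2 - s)\<^sup>2 < 1" "\<forall>\<^sub>F r in nhds rstar. \<bar>2 * N * (r\<^sup>2 - s)\<bar> < 1"
      "\<forall>\<^sub>F r in nhds rstar. rstar / 2 < r" "\<forall>\<^sub>F r in nhds rstar. r < 2 * rstar"
      using L(2)[of 1] L(4)[of 1] L(5)[of "rstar / 2"] L(6)[of "2 * rstar"] rstar_pos by (simp_all add: s_def)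
    then show ?thesis unfolding P_def by eventually_elim auto
  qed
  obtain d where d: "d > 0" "\<And>r. \<bar>r - rstar\<bar> < d \<Longrightarrow> P r"
    using evP unfolding eventually_nhds_metric dist_real_def by blast
  have "\<forall>\<^sub>F \<theta> in at_top. rstar - d < r1 \<theta> \<and> r2 \<theta> < rstar + d"
    using d by (intro eventually_conj order_tendstoD(1)[OF lim_r1] order_tendstoD(2)[OF lim_r2]) auto
  then obtain T0 where T0: "\<And>\<theta>. \<theta> \<ge> T0 \<Longrightarrow> rstar - d < r1 \<theta> \<and> r2 \<theta> < rstar + d"
    by (auto simp: eventually_at_top_linorder)
  define \<Theta>1 where "\<Theta>1 = max T0 \<theta>0"
  have P: "P (rad l \<theta>)" if "l \<in> {0..1}" "\<theta> \<ge> \<Theta>1" for l \<theta>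
    using T0[of \<theta>] rad_bounds[OF that(1), of \<theta>] that(2) by (intro d) (auto simp: \<Theta>1_def)
  let ?f = "\<lambda>x. 2 - N * (x - s)\<^sup>2"
  have f_bounds: "1 \<le> ?f ((rad l \<theta>)\<^sup>2)" "?f ((rad l \<theta>)\<^sup>2) \<le> 2" if "l \<in> {0..1}" "\<theta> \<ge> \<Theta>1" for l \<theta>
    using P[OF that] N by (auto simp: P_def)
  show thesis
  proof (rule that[of \<Theta>1])
    show "\<Theta>1 \<ge> \<theta>0" by (simp add: \<Theta>1_def)
  next
    fix u :: "real^2 \<Rightarrow> real"
    assume u: "subsolution u"
    show "decays_between \<Theta>1 u"
      unfolding decays_between_def
    proof (intro allI impI ballI, elim conjE)
      fix S T m1 m2 l \<theta> :: real
      assume ST: "\<Theta>1 \<le> S" "S < T" and m: "(0::real) \<le> m1" "(0::real) \<le> m2"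
        and bS: "\<forall>l\<in>{0..1}. u (curve l S) \<le> m1" and bT: "\<forall>l\<in>{0..1}. u (curve l T) \<le> m2"
        and l: "l \<in> {0..1}" and "\<theta> \<in> {S..T}"
      then have \<theta>: "S \<le> \<theta>" "\<theta> \<le> T" by auto
      have S0: "\<theta>0 \<le> S" using ST by (simp add: \<Theta>1_def)
      \<comment> \<open>Adding \<open>\<epsilon>\<close> to the end values makes the angular factor positive, hence the barrier strict.\<close>
      have "u (curve l \<theta>) \<le> 2 * ((m1 + \<epsilon>) * exp (S - \<theta>) + (m2 + \<epsilon>) * exp (\<theta> - T))" if e: "\<epsilon> > 0" for \<epsilon>
      proof -
        let ?g = "\<lambda>\<theta>. (m1 + \<epsilon>) * exp (S - \<theta>) + (m2 + \<epsilon>) * exp (\<theta> - T)"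
        let ?g1 = "\<lambda>\<theta>. - (m1 + \<epsilon>) * exp (S - \<theta>) + (m2 + \<epsilon>) * exp (\<theta> - T)"
        have g_pos: "?g \<theta> > 0" for \<theta>
        proof -
          have "m1 + \<epsilon> > 0" "m2 + \<epsilon> > 0" using m e by auto
          then show ?thesis by (simp add: add_pos_pos)
        qed
        have "u (curve l \<theta>) \<le> ?f ((rad l \<theta>)\<^sup>2) * ?g \<theta>"
        proof (rule comparison[where ?f1.0 = "\<lambda>x. - 2 * N * (x - s)" and ?f2.0 = "\<lambda>x. - 2 * N"
              and ?g1.0 = ?g1 and ?g2.0 = ?g and S = S and T = T and u = u])
          show "(?f has_real_derivative - 2 * N * (x - s)) (at x)" for x
            by (auto intro!: derivative_eq_intros)
          show "((\<lambda>x. - 2 * N * (x - s)) has_real_derivative - 2 * N) (at x)" for x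
            by (auto intro!: derivative_eq_intros)
          show "(?g has_real_derivative ?g1 x) (at x)" for x
            by (auto intro!: derivative_eq_intros simp: algebra_simps)
          show "(?g1 has_real_derivative ?g x) (at x)" for x
            by (auto intro!: derivative_eq_intros simp: algebra_simps)
          fix l \<theta> r arr art att br bt
          assume l: "l \<in> {0<..<1}" and \<theta>: "S < \<theta>" "\<theta> < T" and r_eq: "r = rad l \<theta>"
            and eqs: "arr = e_rad \<theta> \<bullet> (A (curve l \<theta>) *v e_rad \<theta>)" "art = e_rad \<theta> \<bullet> (A (curve l \<theta>) *v e_ang \<theta>)"
              "att = e_ang \<theta> \<bullet> (A (curve l \<theta>) *v e_ang \<theta>)" "br = b (curve l \<theta>) \<bullet> e_rad \<theta>" "bt = b (curve l \<theta>) \<bullet> e_ang \<theta>"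
          have \<theta>1: "\<theta> \<ge> \<Theta>1" "\<theta>0 < \<theta>" using \<theta> ST S0 by auto
          have l': "l \<in> {0..1}" using l by auto
          note fb = frame_bounds[OF curve_interior[OF l \<theta>1(2)], of \<theta>, folded eqs]
          have Pr: "rstar / 2 < r" "r < 2 * rstar" "\<bar>- 2 * N * (r\<^sup>2 - s)\<bar> < 1"
            using P[OF l' \<theta>1(1)] by (auto simp: P_def r_eq)
          have r: "r > 0" using Pr rstar_pos by simp
          define F where "F = ?f (r\<^sup>2)"
          define F1 where "F1 = - 2 * N * (r\<^sup>2 - s)"
          define G where "G = ?g \<theta>"
          \<comment> \<open>The logarithmic derivative of the angular factor, so that \<open>?g \<theta>\<close> can be cancelled.\<close>
          define q where "q = ?g1 \<theta> / G"
          have G: "G > 0" using g_pos by (simp add: G_def)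
          have q: "?g1 \<theta> = q * G" using G by (simp add: q_def)
          have "\<bar>?g1 \<theta>\<bar> \<le> G"
          proof -
            have "0 \<le> (m1 + \<epsilon>) * exp (S - \<theta>)" "0 \<le> (m2 + \<epsilon>) * exp (\<theta> - T)"
              using m e by (intro mult_nonneg_nonneg; simp)+
            then show ?thesis unfolding G_def mult_minus_left by linarith
          qed
          then have q1: "\<bar>q\<bar> \<le> 1" unfolding q_def using G by (simp add: abs_divide)
          have F: "\<bar>F\<bar> \<le> 2" using f_bounds[OF l' \<theta>1(1)] by (simp add: F_def r_eq)
          have F1: "\<bar>F1\<bar> \<le> 1" using Pr(3) by (simp add: F1_def)
          have r2: "1 / r\<^sup>2 \<le> 4 / rstar\<^sup>2"
          proof -
            have "(rstar / 2)\<^sup>2 \<le> r\<^sup>2" using Pr rstar_pos by (intro power_mono) auto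
            then show ?thesis using rstar_pos r by (simp add: divide_simps power2_eq_square)
          qed
          have r1': "1 / r \<le> 2 / rstar" using Pr rstar_pos r by (simp add: divide_simps)
          have M: "M1 \<ge> 0" "M2 \<ge> 0" using fb(4,5) by linarith+
          have bnd: "\<bar>x * y\<bar> \<le> X * Y" if "\<bar>x\<bar> \<le> X" "\<bar>y\<bar> \<le> Y" for x y X Y :: real
            using that unfolding abs_mult by (intro mult_mono) auto
          have ir2: "\<bar>1 / r\<^sup>2\<bar> \<le> 4 / rstar\<^sup>2" and ir: "\<bar>1 / r\<bar> \<le> 2 / rstar" and rr: "\<bar>r\<bar> \<le> 2 * rstar"
            using r2 r1' r Pr by auto
          have aa: "\<bar>arr + att\<bar> \<le> M1" "\<bar>att\<bar> \<le> M1" "\<bar>art\<bar> \<le> M1 / 2"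
            using fb c0_pos by auto
          have t1: "\<bar>F1 * (arr + att)\<bar> \<le> 1 * M1" by (rule bnd[OF F1 aa(1)])
          have t2: "\<bar>F1 * (q * art)\<bar> \<le> 1 * (1 * (M1 / 2))" by (rule bnd[OF F1 bnd[OF q1 aa(3)]])
          have t3: "\<bar>F * (att * (1 / r\<^sup>2))\<bar> \<le> 2 * (M1 * (4 / rstar\<^sup>2))" by (rule bnd[OF F bnd[OF aa(2) ir2]])
          have t4: "\<bar>F * (q * (art * (1 / r\<^sup>2)))\<bar> \<le> 2 * (1 * (M1 / 2 * (4 / rstar\<^sup>2)))"
            by (rule bnd[OF F bnd[OF q1 bnd[OF aa(3) ir2]]])
          have t5: "\<bar>r * (F1 * br)\<bar> \<le> 2 * rstar * (1 * M2)" by (rule bnd[OF rr bnd[OF F1 fb(5)]])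
          have t6: "\<bar>F * (q * (bt * (1 / r)))\<bar> \<le> 2 * (1 * (M2 * (2 / rstar)))"
            by (rule bnd[OF F bnd[OF q1 bnd[OF fb(6) ir]]])
          have lead: "N * rstar\<^sup>2 * c0 \<le> 4 * (N * (r\<^sup>2 * arr))"
          proof -
            have "(rstar / 2)\<^sup>2 \<le> r\<^sup>2" using Pr rstar_pos by (intro power_mono) auto
            then have "rstar\<^sup>2 \<le> 4 * r\<^sup>2" by (simp add: power_divide)
            then have "rstar\<^sup>2 * c0 \<le> 4 * r\<^sup>2 * arr" using fb(1) c0_pos by (intro mult_mono) auto
            then have "N * (rstar\<^sup>2 * c0) \<le> N * (4 * r\<^sup>2 * arr)" using N by (intro mult_left_mono) auto
            then show ?thesis by (simp add: mult_ac)
          qed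
          have x1: "2 * (M1 * (4 / rstar\<^sup>2)) = 8 * (M1 / rstar\<^sup>2)" "2 * (1 * (M1 / 2 * (4 / rstar\<^sup>2))) = 4 * (M1 / rstar\<^sup>2)"
            "2 * (1 * (M2 * (2 / rstar))) = 4 * (M2 / rstar)" "2 * rstar * (1 * M2) = 2 * (rstar * M2)"
            by simp_all
          have lead2: "1 + 4 * M1 + 16 * (M1 / rstar\<^sup>2) + 4 * (rstar * M2) + 4 * (M2 / rstar) \<le> 4 * (N * (r\<^sup>2 * arr))"
            using lead M unfolding N_eq by simp
          have nn: "0 \<le> M1 / rstar\<^sup>2" "0 \<le> rstar * M2" "0 \<le> M2 / rstar" using M rstar_pos by simp_all
          have "- 8 * (N * (r\<^sup>2 * arr)) + 2 * (F1 * (arr + att)) + 4 * (F1 * (q * art)) + F * (att * (1 / r\<^sup>2))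
             - 2 * (F * (q * (art * (1 / r\<^sup>2)))) < 2 * (r * (F1 * br)) + F * (q * (bt * (1 / r)))"
            using t1 t2 t3 t4 t5 t6 lead2 nn M unfolding x1 abs_le_iff by linarith
          then have "(- 8 * (N * (r\<^sup>2 * arr)) + 2 * (F1 * (arr + att)) + 4 * (F1 * (q * art)) + F * (att * (1 / r\<^sup>2))
             - 2 * (F * (q * (art * (1 / r\<^sup>2))))) * G < (2 * (r * (F1 * br)) + F * (q * (bt * (1 / r)))) * G"
            using G by (rule mult_strict_right_mono)
          then show "4 * r\<^sup>2 * (- 2 * N) * ?g \<theta> * arr + 2 * (- 2 * N * (r\<^sup>2 - s)) * ?g \<theta> * (arr + att)
            + 4 * (- 2 * N * (r\<^sup>2 - s)) * ?g1 \<theta> * art + ?f (r\<^sup>2) * ?g \<theta> * att / r\<^sup>2 - 2 * ?f (r\<^sup>2) * ?g1 \<theta> * art / r\<^sup>2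
            < 2 * r * (- 2 * N * (r\<^sup>2 - s)) * ?g \<theta> * br + ?f (r\<^sup>2) * ?g1 \<theta> * bt / r"
            unfolding q F_def[symmetric] F1_def[symmetric] G_def[symmetric]
            by (simp add: algebra_simps)
        next
          have up: "?g \<theta> \<le> ?f ((rad l \<theta>)\<^sup>2) * ?g \<theta>" if "l \<in> {0..1}" "\<theta> \<ge> S" for l \<theta>
            using mult_right_mono[OF f_bounds(1)[of l \<theta>], of "?g \<theta>"] g_pos[of \<theta>] that ST by auto
          show "u (curve l \<theta>) \<le> ?f ((rad l \<theta>)\<^sup>2) * ?g \<theta>" if "S \<le> \<theta>" "\<theta> \<le> T" "l = 0 \<or> l = 1" for \<theta> l
          proof -
            have "u (curve l \<theta>) \<le> 0" using subsolutionD(4)[OF u, of \<theta> l] that S0 by auto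
            also have "0 \<le> ?g \<theta>" using g_pos[of \<theta>] by simp
            also have "\<dots> \<le> ?f ((rad l \<theta>)\<^sup>2) * ?g \<theta>" using that by (intro up) auto
            finally show ?thesis .
          qed
          show "u (curve l \<theta>) \<le> ?f ((rad l \<theta>)\<^sup>2) * ?g \<theta>" if "\<theta> = S \<or> \<theta> = T" "l \<in> {0..1}" for \<theta> l
          proof -
            have "u (curve l \<theta>) \<le> ?g \<theta>"
              using that(1)
            proof
              assume "\<theta> = S"
              moreover have "0 \<le> (m2 + \<epsilon>) * exp (S - T)" using m e by (intro mult_nonneg_nonneg) auto
              ultimately show ?thesis using bspec[OF bS that(2)] e by simp
            next
              assume "\<theta> = T"
              moreover have "0 \<le> (m1 + \<epsilon>) * exp (S - T)" using m e by (intro mult_nonneg_nonneg) auto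
              ultimately show ?thesis using bspec[OF bT that(2)] e by simp
            qed
            also have "\<dots> \<le> ?f ((rad l \<theta>)\<^sup>2) * ?g \<theta>" using that ST by (intro up) auto
            finally show ?thesis .
          qed
        qed (use subsolutionD[OF u] l \<theta> ST S0 in auto)
        also have "\<dots> \<le> 2 * ?g \<theta>"
          using f_bounds(2)[OF l, of \<theta>] \<theta> ST g_pos[of \<theta>] by (intro mult_right_mono) auto
        finally show ?thesis .
      qed
      then have ev: "\<forall>\<^sub>F \<epsilon> in at_right 0. u (curve l \<theta>) \<le> 2 * ((m1 + \<epsilon>) * exp (S - \<theta>) + (m2 + \<epsilon>) * exp (\<theta> - T))"
        by (auto simp: eventually_at_right_field intro!: exI[of _ 1])
      have lim: "((\<lambda>\<epsilon>. 2 * ((m1 + \<epsilon>) * exp (S - \<theta>) + (m2 + \<epsilon>) * exp (\<theta> - T)))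
          \<longlongrightarrow> 2 * ((m1 + 0) * exp (S - \<theta>) + (m2 + 0) * exp (\<theta> - T))) (at_right 0)"
        by (intro tendsto_intros)
      have "u (curve l \<theta>) \<le> 2 * ((m1 + 0) * exp (S - \<theta>) + (m2 + 0) * exp (\<theta> - T))"
        by (rule tendsto_lowerbound[OF lim ev]) simp
      then show "u (curve l \<theta>) \<le> 2 * (m1 * exp (S - \<theta>) + m2 * exp (\<theta> - T))" by simp
    qed
  qed
qed

end

section \<open>Growth or decay\<close>

context spiral
begin

definition section_max :: "(real^2 \<Rightarrow> real) \<Rightarrow> real \<Rightarrow> real" where
  "section_max v \<theta> = (SUP y\<in>cross_section r1 r2 \<theta>. v y)"

lemma section_max_attained:
  assumes v: "continuous_on (spiral_cl r1 r2 \<theta>0) v" and \<theta>: "\<theta> \<ge> \<theta>0"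
  obtains l where "l \<in> {0..1}" "section_max v \<theta> = v (curve l \<theta>)"
    "\<And>k. k \<in> {0..1} \<Longrightarrow> v (curve k \<theta>) \<le> section_max v \<theta>"
proof -
  have "continuous_on {0..1} (\<lambda>l. v (curve l \<theta>))"
    unfolding curve_eq using \<theta>
    by (intro continuous_on_compose2[OF v] continuous_intros) (auto intro: polar_rad_in_cl)
  then have "\<exists>l\<in>{0..1}. \<forall>k\<in>{0..1}. v (curve k \<theta>) \<le> v (curve l \<theta>)"
    by (intro continuous_attains_sup) auto
  then obtain l where l: "l \<in> {0..1}" "\<And>k. k \<in> {0..1} \<Longrightarrow> v (curve k \<theta>) \<le> v (curve l \<theta>)" by blast
  have "section_max v \<theta> = v (curve l \<theta>)"
    unfolding section_max_def cross_section_eq[OF \<theta>] image_image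
    by (rule cSup_eq_maximum) (use l in auto)
  then show thesis using that l by simp
qed

lemma section_max_upper:
  assumes "continuous_on (spiral_cl r1 r2 \<theta>0) v" "\<theta> \<ge> \<theta>0" "l \<in> {0..1}"
  shows "v (curve l \<theta>) \<le> section_max v \<theta>"
  using section_max_attained[OF assms(1,2)] assms(3) by metis

text \<open>If the maxima over the cross-sections do not grow like \<open>exp \<theta>\<close>, there are arbitrarily large \<open>T\<close> for which
  \<open>section_max v T * exp (- T)\<close> is as small as desired. Sending \<open>T\<close> to infinity along them removes the second
  term of the two-sided estimate and leaves decay from \<open>\<Theta>1\<close> on. The maxima then tend to zero, and the
  maximum principle on \<open>{\<theta>0..T}\<close> bounds everything by the initial cross-section.\<close>

lemma phragmen_lindeloef_dichotomy:
  assumes v: "continuous_on (spiral_cl r1 r2 \<theta>0) v" and nonneg: "\<And>x. v x \<ge> 0" and \<Theta>1: "\<Theta>1 \<ge> \<theta>0"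
    and max: "\<And>T m l \<theta>. \<lbrakk>\<theta>0 < T; 0 \<le> m; \<And>l. l \<in> {0..1} \<Longrightarrow> v (curve l \<theta>0) \<le> m;
      \<And>l. l \<in> {0..1} \<Longrightarrow> v (curve l T) \<le> m; l \<in> {0..1}; \<theta>0 \<le> \<theta>; \<theta> \<le> T\<rbrakk> \<Longrightarrow> v (curve l \<theta>) \<le> m"
    and barrier: "decays_between \<Theta>1 v"
  shows "(\<forall>l\<in>{0..1}. \<forall>\<theta>\<ge>\<theta>0. v (curve l \<theta>) \<le> section_max v \<theta>0 \<and>
            v (curve l \<theta>) \<le> 2 * section_max v \<theta>0 * exp (\<Theta>1 - \<theta>)) \<or>
         (\<exists>c>0. \<exists>t\<ge>\<theta>0. \<forall>\<theta>\<ge>t. c * exp \<theta> \<le> section_max v \<theta>)"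
proof (rule disjCI)
  let ?M = "section_max v"
  assume "\<not> (\<exists>c>0. \<exists>t\<ge>\<theta>0. \<forall>\<theta>\<ge>t. c * exp \<theta> \<le> ?M \<theta>)"
  then have small: "\<exists>\<theta>\<ge>t. ?M \<theta> < c * exp \<theta>" if "c > 0" "t \<ge> \<theta>0" for c t
    using that by (meson not_le)
  have M_nonneg: "?M \<theta> \<ge> 0" if "\<theta> \<ge> \<theta>0" for \<theta>
    using section_max_attained[OF v that] nonneg by metis
  have upper: "v (curve l \<theta>) \<le> ?M \<theta>" if "l \<in> {0..1}" "\<theta> \<ge> \<theta>0" for l \<theta>
    using section_max_upper[OF v that(2,1)] .
  have decay: "v (curve l \<theta>) \<le> 2 * ?M \<Theta>1 * exp (\<Theta>1 - \<theta>)" if l: "l \<in> {0..1}" and \<theta>: "\<theta> \<ge> \<Theta>1" for l \<theta>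
  proof (rule field_le_epsilon)
    fix e :: real assume e: "e > 0"
    define c where "c = e / (2 * exp \<theta>)"
    have c: "c > 0" using e by (simp add: c_def)
    obtain T where T: "T \<ge> \<theta> + 1" "?M T < c * exp T" using small[OF c, of "\<theta> + 1"] \<theta> \<Theta>1 by auto
    have "v (curve l \<theta>) \<le> 2 * (?M \<Theta>1 * exp (\<Theta>1 - \<theta>) + (c * exp T) * exp (\<theta> - T))"
    proof -
      have "v (curve k \<Theta>1) \<le> ?M \<Theta>1" if "k \<in> {0..1}" for k using upper[OF that \<Theta>1] .
      moreover have "v (curve k T) \<le> c * exp T" if "k \<in> {0..1}" for k
        using upper[OF that, of T] T \<theta> \<Theta>1 by simp
      moreover have "\<Theta>1 < T" "0 \<le> c * exp T" "0 \<le> ?M \<Theta>1" "\<theta> \<in> {\<Theta>1..T}" using T \<theta> \<Theta>1 c M_nonneg by auto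
      ultimately show ?thesis
        using barrier[unfolded decays_between_def, rule_format, of \<Theta>1 T "?M \<Theta>1" "c * exp T" l \<theta>] l by blast
    qed
    also have "(c * exp T) * exp (\<theta> - T) = c * exp \<theta>" by (simp add: exp_diff)
    also have "\<dots> = e / 2" by (simp add: c_def)
    finally show "v (curve l \<theta>) \<le> 2 * ?M \<Theta>1 * exp (\<Theta>1 - \<theta>) + e" by (simp add: algebra_simps)
  qed
  have bounded: "v (curve l \<theta>) \<le> ?M \<theta>0" if l: "l \<in> {0..1}" and \<theta>: "\<theta> \<ge> \<theta>0" for l \<theta>
  proof (rule field_le_epsilon)
    fix e :: real assume e: "e > 0"
    have "((\<lambda>T. 2 * ?M \<Theta>1 * exp (\<Theta>1 - T)) \<longlongrightarrow> 2 * ?M \<Theta>1 * 0) at_top"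
    proof (intro tendsto_intros filterlim_compose[OF exp_at_bot])
      have "filterlim (\<lambda>T. T - \<Theta>1) at_top at_top"
        using filterlim_tendsto_add_at_top[OF tendsto_const[of "- \<Theta>1"] filterlim_ident] by simp
      then show "filterlim (\<lambda>T. \<Theta>1 - T) at_bot at_top" by (simp add: filterlim_uminus_at_bot)
    qed
    then have "\<forall>\<^sub>F T in at_top. 2 * ?M \<Theta>1 * exp (\<Theta>1 - T) < e"
      using e by (intro order_tendstoD(2)) auto
    then obtain T0 where T0: "\<And>T. T \<ge> T0 \<Longrightarrow> 2 * ?M \<Theta>1 * exp (\<Theta>1 - T) < e"
      by (auto simp: eventually_at_top_linorder)
    define T where "T = max T0 (max \<theta> \<Theta>1 + 1)"
    have T: "T \<ge> T0" "T > \<theta>" "T > \<Theta>1" by (auto simp: T_def)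
    show "v (curve l \<theta>) \<le> ?M \<theta>0 + e"
    proof (rule max)
      show "v (curve k \<theta>0) \<le> ?M \<theta>0 + e" if "k \<in> {0..1}" for k using upper[OF that] e by (simp add: add_increasing2)
      show "v (curve k T) \<le> ?M \<theta>0 + e" if "k \<in> {0..1}" for k
        using decay[OF that, of T] T0[OF T(1)] T M_nonneg[of \<theta>0] by simp
    qed (use T \<theta> l e M_nonneg[of \<theta>0] in auto)
  qed
  have "v (curve l \<theta>) \<le> 2 * ?M \<theta>0 * exp (\<Theta>1 - \<theta>)" if l: "l \<in> {0..1}" and \<theta>: "\<theta> \<ge> \<theta>0" for l \<theta>
  proof (cases "\<theta> \<ge> \<Theta>1")
    case True
    obtain k where "k \<in> {0..1}" "?M \<Theta>1 = v (curve k \<Theta>1)" using section_max_attained[OF v \<Theta>1] by metis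
    then have "?M \<Theta>1 \<le> ?M \<theta>0" using bounded \<Theta>1 by simp
    then have "2 * ?M \<Theta>1 * exp (\<Theta>1 - \<theta>) \<le> 2 * ?M \<theta>0 * exp (\<Theta>1 - \<theta>)"
      by (intro mult_right_mono) auto
    then show ?thesis by (rule order_trans[OF decay[OF l True]])
  next
    case False
    have "?M \<theta>0 * 1 \<le> ?M \<theta>0 * (2 * exp (\<Theta>1 - \<theta>))"
    proof (rule mult_left_mono)
      have "1 \<le> exp (\<Theta>1 - \<theta>)" using False by simp
      then show "1 \<le> 2 * exp (\<Theta>1 - \<theta>)" by linarith
    qed (simp add: M_nonneg)
    then show ?thesis using bounded[OF l \<theta>] by simp
  qed
  with bounded show "\<forall>l\<in>{0..1}. \<forall>\<theta>\<ge>\<theta>0. v (curve l \<theta>) \<le> ?M \<theta>0 \<and> v (curve l \<theta>) \<le> 2 * ?M \<theta>0 * exp (\<Theta>1 - \<theta>)"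
    by blast
qed

end

context rectifiable_spiral
begin

lemma rstar_le: "rstar \<le> Rbar"
proof (rule tendsto_upperbound[OF lim_r2])
  show "\<forall>\<^sub>F x in at_top. r2 x \<le> Rbar"
    using r2_le by (auto simp: eventually_at_top_linorder)
qed simp

text \<open>The whole cross-section at the angle \<open>l / rstar\<close> has arc-distances between \<open>\<kappa> * (l / rstar - T)\<close> and
  \<open>c + (Rbar + \<mu>) * (l / rstar - \<theta>0)\<close>. The second is \<open>(Rbar + \<mu>) / rstar * l\<close> up to a constant. For large \<open>l\<close>
  the first exceeds \<open>l\<close> divided by \<open>(Rbar + \<mu>) / rstar + \<epsilon>\<close>, since this divisor is at least \<open>1 + \<epsilon>\<close> and \<open>\<kappa>\<close> is close to
  \<open>rstar\<close>.\<close>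

lemma section_in_arc_layer:
  assumes \<epsilon>: "\<epsilon> > 0"
  obtains l1 where "l1 \<ge> 0" "\<And>l k. l \<ge> l1 \<Longrightarrow> k \<in> {0..1} \<Longrightarrow> l / rstar \<ge> t \<and> curve k (l / rstar) \<in>
    arc_layer r1 r2 \<theta>0 {inverse ((Rbar + \<mu>) / rstar + \<epsilon>) * l .. ((Rbar + \<mu>) / rstar + \<epsilon>) * l}"
proof -
  define K where "K = (Rbar + \<mu>) / rstar"
  have K: "K \<ge> 1" unfolding K_def using rstar_le rstar_pos D_bound(2) by simp
  obtain c where c: "\<And>l \<theta>. l \<in> {0..1} \<Longrightarrow> \<theta> \<ge> \<theta>0 \<Longrightarrow> curve_length r1 r2 \<theta>0 l \<theta> \<le> c + (Rbar + \<mu>) * (\<theta> - \<theta>0)"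
    using curve_length_upper by blast
  \<comment> \<open>Any value strictly between \<open>rstar / (1 + \<epsilon>)\<close> and \<open>rstar\<close> would do.\<close>
  define \<kappa> where "\<kappa> = rstar / (1 + \<epsilon> / 2)"
  have \<kappa>: "0 \<le> \<kappa>" "\<kappa> < rstar" using \<epsilon> rstar_pos by (auto simp: \<kappa>_def divide_less_eq)
  obtain T where T: "T \<ge> \<theta>0" "\<And>l \<theta>. l \<in> {0..1} \<Longrightarrow> \<theta> \<ge> \<theta>0 \<Longrightarrow> \<kappa> * (\<theta> - T) \<le> curve_length r1 r2 \<theta>0 l \<theta>"
    using curve_length_lower[OF \<kappa>] by blast
  define \<delta> where "\<delta> = \<kappa> / rstar - inverse (1 + \<epsilon>)"
  have \<delta>: "\<delta> > 0" using \<epsilon> rstar_pos by (simp add: \<delta>_def \<kappa>_def divide_simps)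
  define l1 where "l1 = Max {0, rstar * t, rstar * \<theta>0, (c - (Rbar + \<mu>) * \<theta>0) / \<epsilon>, \<kappa> * T / \<delta>}"
  show thesis
  proof (rule that[of l1])
    show "l1 \<ge> 0" by (simp add: l1_def)
    fix l k assume "l1 \<le> l" and k: "k \<in> {0..1::real}"
    then have l: "0 \<le> l" "rstar * t \<le> l" "rstar * \<theta>0 \<le> l" "(c - (Rbar + \<mu>) * \<theta>0) / \<epsilon> \<le> l" "\<kappa> * T / \<delta> \<le> l"
      by (auto simp: l1_def)
    have t: "t \<le> l / rstar" "\<theta>0 \<le> l / rstar" using l rstar_pos by (simp_all add: le_divide_eq mult.commute)
    have "curve_length r1 r2 \<theta>0 k (l / rstar) \<le> c + (Rbar + \<mu>) * (l / rstar - \<theta>0)" by (rule c[OF k t(2)])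
    also have "\<dots> = K * l + (c - (Rbar + \<mu>) * \<theta>0)" by (simp add: K_def algebra_simps)
    also have "\<dots> \<le> K * l + l * \<epsilon>" using l(4) \<epsilon> by (simp add: divide_le_eq)
    finally have up: "curve_length r1 r2 \<theta>0 k (l / rstar) \<le> (K + \<epsilon>) * l" by (simp add: algebra_simps)
    have "inverse (K + \<epsilon>) * l \<le> inverse (1 + \<epsilon>) * l"
      using K \<epsilon> l by (intro mult_right_mono le_imp_inverse_le) auto
    also have "\<dots> = \<kappa> / rstar * l - \<delta> * l" by (simp add: \<delta>_def algebra_simps)
    also have "\<dots> \<le> \<kappa> / rstar * l - \<kappa> * T" using l(5) \<delta> by (simp add: divide_le_eq mult.commute)
    also have "\<dots> = \<kappa> * (l / rstar - T)" by (simp add: algebra_simps)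
    also have "\<dots> \<le> curve_length r1 r2 \<theta>0 k (l / rstar)" by (rule T(2)[OF k t(2)])
    finally have low: "inverse (K + \<epsilon>) * l \<le> curve_length r1 r2 \<theta>0 k (l / rstar)" .
    have "curve k (l / rstar) \<in> spiral_cl r1 r2 \<theta>0" using k t(2) by (auto simp: curve_eq intro: polar_rad_in_cl)
    then show "t \<le> l / rstar \<and> curve k (l / rstar) \<in>
       arc_layer r1 r2 \<theta>0 {inverse ((Rbar + \<mu>) / rstar + \<epsilon>) * l .. ((Rbar + \<mu>) / rstar + \<epsilon>) * l}"
      using t(1) up low arc_dist_curve[OF k t(2)] by (simp add: arc_layer_def K_def)
  qed
qed

text \<open>Decay in the angle is decay in the arc-distance at the rate \<open>1 / (Rbar + \<mu>)\<close> by the upper length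
  bound. Growth in the angle is seen in the layer that contains the cross-section at angle
  \<open>l / rstar\<close>, and \<open>l / rstar\<close> is at least \<open>l / (Rbar + \<mu>)\<close>.\<close>

lemma arc_distance_dichotomy:
  fixes \<Theta>1 c :: real and v :: "real^2 \<Rightarrow> real"
  assumes c: "\<And>l \<theta>. l \<in> {0..1} \<Longrightarrow> \<theta> \<ge> \<theta>0 \<Longrightarrow> curve_length r1 r2 \<theta>0 l \<theta> \<le> c + (Rbar + \<mu>) * (\<theta> - \<theta>0)"
    and v: "continuous_on (spiral_cl r1 r2 \<theta>0) v" "\<And>x. v x \<ge> 0"
    and dich: "(\<forall>l\<in>{0..1}. \<forall>\<theta>\<ge>\<theta>0. v (curve l \<theta>) \<le> section_max v \<theta>0 \<and>
            v (curve l \<theta>) \<le> 2 * section_max v \<theta>0 * exp (\<Theta>1 - \<theta>)) \<or>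
     (\<exists>c>0. \<exists>t\<ge>\<theta>0. \<forall>\<theta>\<ge>t. c * exp \<theta> \<le> section_max v \<theta>)"
  defines "C \<equiv> 2 * exp (\<Theta>1 - \<theta>0 + c / (Rbar + \<mu>))"
  shows "(\<forall>x\<in>spiral_cl r1 r2 \<theta>0. v x \<le> section_max v \<theta>0 \<and>
        v x \<le> C * section_max v \<theta>0 * exp (- (1 / (Rbar + \<mu>)) * arc_dist r1 r2 \<theta>0 x)) \<or>
     (\<exists>C1>0. \<forall>\<epsilon>>0. \<exists>l1\<ge>0. \<forall>l\<ge>l1.
        (SUP x\<in>arc_layer r1 r2 \<theta>0 {inverse ((Rbar + \<mu>) / rstar + \<epsilon>) * l .. ((Rbar + \<mu>) / rstar + \<epsilon>) * l}.
           ereal (v x)) \<ge> ereal (C1 * exp (1 / (Rbar + \<mu>) * l)))"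
proof -
  define k where "k = Rbar + \<mu>"
  have k: "k > 0" "rstar \<le> k" unfolding k_def using rstar_le rstar_pos D_bound(2) by auto
  note c = c[folded k_def]
  let ?M = "section_max v"
  have M: "?M \<theta>0 \<ge> 0" using section_max_attained[OF v(1) order_refl] v(2) by metis
  from dich show ?thesis (is "?A \<or> ?B")
  proof (elim disjE)
    assume P: "\<forall>l\<in>{0..1}. \<forall>\<theta>\<ge>\<theta>0. v (curve l \<theta>) \<le> ?M \<theta>0 \<and> v (curve l \<theta>) \<le> 2 * ?M \<theta>0 * exp (\<Theta>1 - \<theta>)"
    have "\<forall>x\<in>spiral_cl r1 r2 \<theta>0. v x \<le> ?M \<theta>0 \<and> v x \<le> C * ?M \<theta>0 * exp (- (1 / k) * arc_dist r1 r2 \<theta>0 x)"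
    proof
      fix x assume "x \<in> spiral_cl r1 r2 \<theta>0"
      then obtain l \<theta> where x: "x = curve l \<theta>" "l \<in> {0..1}" "\<theta> \<ge> \<theta>0" by (auto simp: spiral_cl_eq)
      have "arc_dist r1 r2 \<theta>0 x / k \<le> c / k + (\<theta> - \<theta>0)"
      proof -
        have "arc_dist r1 r2 \<theta>0 x / k \<le> (c + k * (\<theta> - \<theta>0)) / k"
          using c[OF x(2,3)] k arc_dist_curve[OF x(2,3)] x(1) by (intro divide_right_mono) auto
        also have "\<dots> = c / k + (\<theta> - \<theta>0)" using k by (simp add: add_divide_distrib)
        finally show ?thesis .
      qed
      then have "exp (\<Theta>1 - \<theta>) \<le> exp ((\<Theta>1 - \<theta>0 + c / k) + (- (1 / k) * arc_dist r1 r2 \<theta>0 x))" by simp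
      also have "\<dots> = exp (\<Theta>1 - \<theta>0 + c / k) * exp (- (1 / k) * arc_dist r1 r2 \<theta>0 x)" by (rule exp_add)
      finally have "2 * ?M \<theta>0 * exp (\<Theta>1 - \<theta>) \<le> 2 * ?M \<theta>0 * (exp (\<Theta>1 - \<theta>0 + c / k) * exp (- (1 / k) * arc_dist r1 r2 \<theta>0 x))"
        using M by (intro mult_left_mono) auto
      then have "2 * ?M \<theta>0 * exp (\<Theta>1 - \<theta>) \<le> C * ?M \<theta>0 * exp (- (1 / k) * arc_dist r1 r2 \<theta>0 x)"
        by (simp add: C_def k_def mult_ac)
      then show "v x \<le> ?M \<theta>0 \<and> v x \<le> C * ?M \<theta>0 * exp (- (1 / k) * arc_dist r1 r2 \<theta>0 x)"
        using P x by (metis order_trans)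
    qed
    then show "?A \<or> ?B" unfolding k_def[symmetric] ..
  next
    assume "\<exists>c>0. \<exists>t\<ge>\<theta>0. \<forall>\<theta>\<ge>t. c * exp \<theta> \<le> ?M \<theta>"
    then obtain C1 t where C1: "C1 > 0" "t \<ge> \<theta>0" "\<And>\<theta>. \<theta> \<ge> t \<Longrightarrow> C1 * exp \<theta> \<le> ?M \<theta>" by blast
    have "\<exists>l1\<ge>0. \<forall>l\<ge>l1. ereal (C1 * exp (1 / k * l)) \<le>
      (SUP x\<in>arc_layer r1 r2 \<theta>0 {inverse (k / rstar + \<epsilon>) * l .. (k / rstar + \<epsilon>) * l}. ereal (v x))" if \<epsilon>: "\<epsilon> > 0" for \<epsilon>
    proof -
      obtain l1 where l1: "l1 \<ge> 0" "\<And>l j. l \<ge> l1 \<Longrightarrow> j \<in> {0..1} \<Longrightarrow> l / rstar \<ge> t \<and> curve j (l / rstar) \<in>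
         arc_layer r1 r2 \<theta>0 {inverse (k / rstar + \<epsilon>) * l .. (k / rstar + \<epsilon>) * l}"
        using section_in_arc_layer[OF \<epsilon>, of t] unfolding k_def by blast
      show ?thesis
      proof (intro exI[of _ l1] conjI l1(1) allI impI)
        fix l assume l: "l1 \<le> l"
        have t: "t \<le> l / rstar" using l1(2)[OF l, of 0] by simp
        obtain j where j: "j \<in> {0..1}" "?M (l / rstar) = v (curve j (l / rstar))"
          using section_max_attained[OF v(1), of "l / rstar"] t C1(2) by (metis order_trans)
        have "1 / k * l \<le> l / rstar" using k rstar_pos l l1(1) by (simp add: frac_le)
        then have "C1 * exp (1 / k * l) \<le> C1 * exp (l / rstar)" using C1(1) by simp
        also have "\<dots> \<le> v (curve j (l / rstar))" using C1(3)[OF t] j(2) by simp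
        finally have "ereal (C1 * exp (1 / k * l)) \<le> ereal (v (curve j (l / rstar)))" by simp
        also have "\<dots> \<le> (SUP x\<in>arc_layer r1 r2 \<theta>0 {inverse (k / rstar + \<epsilon>) * l .. (k / rstar + \<epsilon>) * l}. ereal (v x))"
          using l1(2)[OF l j(1)] by (intro SUP_upper) auto
        finally show "ereal (C1 * exp (1 / k * l)) \<le>
          (SUP x\<in>arc_layer r1 r2 \<theta>0 {inverse (k / rstar + \<epsilon>) * l .. (k / rstar + \<epsilon>) * l}. ereal (v x))" .
      qed
    qed
    then show "?A \<or> ?B" unfolding k_def[symmetric] using C1(1) by blast
  qed
qed

end

text \<open>The essential supremum of an absolute value over a half-line is nonnegative because the half-line
  is not a null set; so conversion to a real number loses nothing.\<close>

lemma deriv_Linf_bound: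
  assumes "deriv_Linf T f"
  shows "0 \<le> deriv_Linf_norm T f" "deriv_Linf_norm T f < \<infinity>"
    "AE t in lebesgue. T < t \<longrightarrow> \<bar>deriv f t\<bar> \<le> real_of_ereal (deriv_Linf_norm T f)"
proof -
  let ?n = "deriv_Linf_norm T f"
  show fin: "?n < \<infinity>" using assms by (simp add: deriv_Linf_def)
  have "AE t in lebesgue_on {T<..}. ereal \<bar>deriv f t\<bar> \<le> ?n"
    unfolding deriv_Linf_norm_def by (rule esssup_AE)
  then have ae: "AE t in lebesgue. T < t \<longrightarrow> ereal \<bar>deriv f t\<bar> \<le> ?n"
    by (subst (asm) AE_restrict_space_iff) auto
  show nonneg: "0 \<le> ?n"
  proof (rule ccontr)
    assume neg: "\<not> 0 \<le> ?n"
    from ae have "AE t in lebesgue. t \<notin> {T<..<T + 1}"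
    proof eventually_elim
      case (elim t)
      have "(0::ereal) \<le> ereal \<bar>deriv f t\<bar>" by simp
      then show ?case using elim neg by (meson greaterThanLessThan_iff order_trans)
    qed
    then have "{T<..<T + 1} \<in> null_sets lebesgue"
      by (subst (asm) AE_iff_null_sets[symmetric]) auto
    then show False by (auto simp: null_sets_def)
  qed
  show "AE t in lebesgue. T < t \<longrightarrow> \<bar>deriv f t\<bar> \<le> real_of_ereal ?n"
    using ae
  proof eventually_elim
    case (elim t)
    then show ?case using fin nonneg by (cases ?n) auto
  qed
qed

theorem corollary4p3:
  fixes \<theta>0 \<Theta> rstar Rbar c0 M1 M2 :: real
    and r1 r2 :: "real \<Rightarrow> real"
    and A :: "real^2 \<Rightarrow> real^2^2"
    and b :: "real^2 \<Rightarrow> real^2"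
  defines "U \<equiv> spiral_dom r1 r2 \<theta>0"
    and "Ucl \<equiv> spiral_cl r1 r2 \<theta>0"
    and "\<gamma> \<equiv> spiral_side r1 r2 \<theta>0"
    and "S0 \<equiv> cross_section r1 r2 \<theta>0"
    and "\<L> \<equiv> arc_dist r1 r2 \<theta>0"
    and "kstar \<equiv> layer_ratio r1 r2 \<Theta> Rbar rstar"
  assumes "continuous_on {\<theta>0..} r1" and "continuous_on {\<theta>0..} r2"
    and "\<forall>\<theta>\<ge>\<theta>0. 0 < r1 \<theta> \<and> 0 < r2 \<theta>"
    and "\<forall>\<theta>\<ge>\<theta>0. r2 (\<theta> + 2 * pi) < r1 \<theta> \<and> r1 \<theta> < r2 \<theta>"
    and "rstar > 0" and "(r1 \<longlongrightarrow> rstar) at_top" and "(r2 \<longlongrightarrow> rstar) at_top"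
    and "Rbar > 0" and "\<forall>\<theta>\<ge>\<theta>0. r2 \<theta> \<le> Rbar"
    and "\<forall>x\<in>U. transpose (A x) = A x"
    and "c0 > 0" and "M1 > 0"
    and "\<forall>x\<in>U. \<forall>\<xi>. \<xi> \<bullet> (A x *v \<xi>) \<ge> c0 * (norm \<xi>)\<^sup>2"
    and "\<forall>x\<in>U. trace (A x) \<le> M1"
    and "M2 \<ge> 0" and "\<forall>x\<in>U. norm (b x) \<le> M2"
    and "abs_continuous_on {\<theta>0..} r1" and "abs_continuous_on {\<theta>0..} r2"
    and "\<Theta> \<ge> \<theta>0" and "deriv_Linf \<Theta> r1" and "deriv_Linf \<Theta> r2"
  shows "\<exists>C>0. \<exists>\<nu>>0. \<forall>u :: real^2 \<Rightarrow> real. C2_on U u \<and> continuous_on Ucl u \<longrightarrow>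
    ((\<forall>x\<in>U. elliptic_op A b u x \<le> 0) \<and> (\<forall>x\<in>\<gamma>. u x \<le> 0) \<longrightarrow>
       (\<forall>x\<in>Ucl.
          max 0 (u x) \<le> (SUP y\<in>S0. max 0 (u y)) \<and>
          max 0 (u x) \<le> C * (SUP y\<in>S0. max 0 (u y)) * exp (- \<nu> * \<L> x))
       \<or>
       (\<exists>C1>0. \<forall>\<epsilon>>0. \<exists>l1\<ge>0. \<forall>l\<ge>l1.
          (SUP x\<in>arc_layer r1 r2 \<theta>0 {inverse (kstar + \<epsilon>) * l .. (kstar + \<epsilon>) * l}.
             ereal (max 0 (u x))) \<ge> ereal (C1 * exp (\<nu> * l))))
    \<and>
    ((\<forall>x\<in>U. elliptic_op A b u x = 0) \<and> (\<forall>x\<in>\<gamma>. u x = 0) \<longrightarrow>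
       (\<forall>x\<in>Ucl.
          \<bar>u x\<bar> \<le> (SUP y\<in>S0. \<bar>u y\<bar>) \<and>
          \<bar>u x\<bar> \<le> C * (SUP y\<in>S0. \<bar>u y\<bar>) * exp (- \<nu> * \<L> x))
       \<or>
       (\<exists>C1>0. \<forall>\<epsilon>>0. \<exists>l1\<ge>0. \<forall>l\<ge>l1.
          (SUP x\<in>arc_layer r1 r2 \<theta>0 {inverse (kstar + \<epsilon>) * l .. (kstar + \<epsilon>) * l}.
             ereal \<bar>u x\<bar>) \<ge> ereal (C1 * exp (\<nu> * l))))"
proof -
  note hyps = assms(7-)
  interpret spiral r1 r2 \<theta>0 rstar
    using hyps by unfold_locales auto
  interpret elliptic_spiral r1 r2 \<theta>0 rstar A b c0 M1 M2 Rbar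
    using hyps unfolding U_def by unfold_locales auto
  obtain D1 where D1: "D1 \<in> borel_measurable borel" "\<And>s t. set_integrable lborel {s..t} D1"
    "negligible {x \<in> {\<theta>0..}. \<not> (r1 has_real_derivative D1 x) (at x)}"
    using abs_continuous_derivative[OF \<open>abs_continuous_on {\<theta>0..} r1\<close>] by blast
  obtain D2 where D2: "D2 \<in> borel_measurable borel" "\<And>s t. set_integrable lborel {s..t} D2"
    "negligible {x \<in> {\<theta>0..}. \<not> (r2 has_real_derivative D2 x) (at x)}"
    using abs_continuous_derivative[OF \<open>abs_continuous_on {\<theta>0..} r2\<close>] by blast
  define \<mu> where "\<mu> = real_of_ereal (max (deriv_Linf_norm \<Theta> r1) (deriv_Linf_norm \<Theta> r2))"
  note n1 = deriv_Linf_bound[OF \<open>deriv_Linf \<Theta> r1\<close>] and n2 = deriv_Linf_bound[OF \<open>deriv_Linf \<Theta> r2\<close>]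
  have \<mu>: "\<mu> \<ge> 0" "real_of_ereal (deriv_Linf_norm \<Theta> r1) \<le> \<mu>" "real_of_ereal (deriv_Linf_norm \<Theta> r2) \<le> \<mu>"
    using n1(1,2) n2(1,2) unfolding \<mu>_def
    by (cases "deriv_Linf_norm \<Theta> r1"; cases "deriv_Linf_norm \<Theta> r2"; simp add: max_def)+
  have ND: "{x \<in> {\<theta>0..}. \<not> (r1 has_real_derivative D1 x) (at x)} \<in> null_sets lebesgue"
    "{x \<in> {\<theta>0..}. \<not> (r2 has_real_derivative D2 x) (at x)} \<in> null_sets lebesgue"
    using D1(3) D2(3) unfolding negligible_iff_null_sets .
  have aeD: "AE x in lebesgue. \<Theta> < x \<longrightarrow> \<bar>D1 x\<bar> \<le> \<mu> \<and> \<bar>D2 x\<bar> \<le> \<mu>"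
    using n1(3) n2(3) ND[THEN AE_not_in]
  proof eventually_elim
    case (elim x)
    show ?case
    proof
      assume x: "\<Theta> < x"
      then have "deriv r1 x = D1 x" "deriv r2 x = D2 x"
        using elim(3,4) \<open>\<theta>0 \<le> \<Theta>\<close> by (auto intro!: DERIV_imp_deriv)
      then show "\<bar>D1 x\<bar> \<le> \<mu> \<and> \<bar>D2 x\<bar> \<le> \<mu>" using elim(1,2) x \<mu> by auto
    qed
  qed
  interpret rectifiable_spiral r1 r2 \<theta>0 rstar D1 D2 Rbar \<mu> \<Theta>
    using D1 D2 aeD \<mu>(1) hyps by unfold_locales auto
  have kstar: "kstar = (Rbar + \<mu>) / rstar" by (simp add: kstar_def layer_ratio_def \<mu>_def)
  have \<nu>: "1 / (Rbar + \<mu>) > 0" using rstar_le rstar_pos \<mu>(1) by simp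
  obtain \<Theta>1 where \<Theta>1: "\<Theta>1 \<ge> \<theta>0" "\<And>u. subsolution u \<Longrightarrow> decays_between \<Theta>1 u"
    using exponential_barrier by blast
  obtain c where c: "\<And>l \<theta>. l \<in> {0..1} \<Longrightarrow> \<theta> \<ge> \<theta>0 \<Longrightarrow> curve_length r1 r2 \<theta>0 l \<theta> \<le> c + (Rbar + \<mu>) * (\<theta> - \<theta>0)"
    using curve_length_upper by blast
  define C where "C = 2 * exp (\<Theta>1 - \<theta>0 + c / (Rbar + \<mu>))"
  have C: "C > 0" by (simp add: C_def)
  \<comment> \<open>Both parts at once: \<open>v\<close> is the pointwise maximum of \<open>0\<close> and the subsolutions in \<open>F\<close>, which is
    \<open>{u}\<close> for the positive part and \<open>{u, - u}\<close> for the absolute value.\<close>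
  have sup_dich: "(\<forall>x\<in>Ucl. v x \<le> (SUP y\<in>S0. v y) \<and> v x \<le> C * (SUP y\<in>S0. v y) * exp (- (1 / (Rbar + \<mu>)) * \<L> x)) \<or>
     (\<exists>C1>0. \<forall>\<epsilon>>0. \<exists>l1\<ge>0. \<forall>l\<ge>l1.
        (SUP x\<in>arc_layer r1 r2 \<theta>0 {inverse (kstar + \<epsilon>) * l .. (kstar + \<epsilon>) * l}. ereal (v x))
          \<ge> ereal (C1 * exp (1 / (Rbar + \<mu>) * l)))"
    if v: "continuous_on Ucl v" "\<And>x. v x \<ge> 0"
      and F: "\<And>w. w \<in> F \<Longrightarrow> subsolution w" "\<And>w x. w \<in> F \<Longrightarrow> w x \<le> v x"
        "\<And>x m. (\<And>w. w \<in> F \<Longrightarrow> w x \<le> m) \<Longrightarrow> 0 \<le> m \<Longrightarrow> v x \<le> m" for v F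
  proof -
    have v': "continuous_on (spiral_cl r1 r2 \<theta>0) v" using v(1) by (simp add: Ucl_def)
    have dich: "(\<forall>l\<in>{0..1}. \<forall>\<theta>\<ge>\<theta>0. v (curve l \<theta>) \<le> section_max v \<theta>0 \<and>
            v (curve l \<theta>) \<le> 2 * section_max v \<theta>0 * exp (\<Theta>1 - \<theta>)) \<or>
         (\<exists>c>0. \<exists>t\<ge>\<theta>0. \<forall>\<theta>\<ge>t. c * exp \<theta> \<le> section_max v \<theta>)"
    proof (rule phragmen_lindeloef_dichotomy[OF v' v(2) \<Theta>1(1)])
      fix T m l \<theta> :: real
      assume *: "\<theta>0 < T" "(0::real) \<le> m" "\<And>l. l \<in> {0..1} \<Longrightarrow> v (curve l \<theta>0) \<le> m"
        "\<And>l. l \<in> {0..1} \<Longrightarrow> v (curve l T) \<le> m" "l \<in> {0..1}" "\<theta>0 \<le> \<theta>" "\<theta> \<le> T"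
      show "v (curve l \<theta>) \<le> m"
      proof (rule F(3)[OF _ *(2)])
        fix w assume w: "w \<in> F"
        show "w (curve l \<theta>) \<le> m"
          by (rule maximum_principle[OF F(1)[OF w] *(1,2) _ *(5-7)])
             (use *(3,4) order_trans[OF F(2)[OF w]] in blast)
      qed
    next
      show "decays_between \<Theta>1 v"
        unfolding decays_between_def
      proof (intro allI impI ballI, elim conjE)
        fix S T m1 m2 l \<theta> :: real
        assume *: "\<Theta>1 \<le> S" "S < T" "0 \<le> m1" "0 \<le> m2"
          "\<forall>l\<in>{0..1}. v (curve l S) \<le> m1" "\<forall>l\<in>{0..1}. v (curve l T) \<le> m2"
          "l \<in> {0..1}" "\<theta> \<in> {S..T}"
        show "v (curve l \<theta>) \<le> 2 * (m1 * exp (S - \<theta>) + m2 * exp (\<theta> - T))"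
        proof (rule F(3))
          fix w assume w: "w \<in> F"
          have "\<forall>l\<in>{0..1}. w (curve l S) \<le> m1" "\<forall>l\<in>{0..1}. w (curve l T) \<le> m2"
            using *(5,6) order_trans[OF F(2)[OF w]] by blast+
          then show "w (curve l \<theta>) \<le> 2 * (m1 * exp (S - \<theta>) + m2 * exp (\<theta> - T))"
            using \<Theta>1(2)[OF F(1)[OF w], unfolded decays_between_def, rule_format, of S T m1 m2 l \<theta>] *(1-4,7,8)
            by blast
        qed (use *(3,4) in simp)
      qed
    qed
    show ?thesis
      using arc_distance_dichotomy[OF c v' v(2) dich, folded C_def] unfolding kstar Ucl_def S0_def \<L>_def section_max_def .
  qed
  show ?thesis
  proof (rule exI[of _ C], rule conjI[OF C], rule exI[of _ "1 / (Rbar + \<mu>)"], rule conjI[OF \<nu>], intro allI impI conjI)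
    fix u :: "real^2 \<Rightarrow> real"
    assume "C2_on U u \<and> continuous_on Ucl u" and *: "(\<forall>x\<in>U. elliptic_op A b u x \<le> 0) \<and> (\<forall>x\<in>\<gamma>. u x \<le> 0)"
    then have "subsolution u" "continuous_on Ucl u" by (simp_all add: subsolution_def U_def Ucl_def \<gamma>_def)
    then show "(\<forall>x\<in>Ucl. max 0 (u x) \<le> (SUP y\<in>S0. max 0 (u y)) \<and>
          max 0 (u x) \<le> C * (SUP y\<in>S0. max 0 (u y)) * exp (- (1 / (Rbar + \<mu>)) * \<L> x)) \<or>
       (\<exists>C1>0. \<forall>\<epsilon>>0. \<exists>l1\<ge>0. \<forall>l\<ge>l1.
          (SUP x\<in>arc_layer r1 r2 \<theta>0 {inverse (kstar + \<epsilon>) * l .. (kstar + \<epsilon>) * l}. ereal (max 0 (u x)))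
            \<ge> ereal (C1 * exp (1 / (Rbar + \<mu>) * l)))"
      by (intro sup_dich[where F = "{u}"] continuous_on_max continuous_on_const) auto
  next
    fix u :: "real^2 \<Rightarrow> real"
    assume u: "C2_on U u \<and> continuous_on Ucl u" and *: "(\<forall>x\<in>U. elliptic_op A b u x = 0) \<and> (\<forall>x\<in>\<gamma>. u x = 0)"
    then have "subsolution u" by (simp add: subsolution_def U_def Ucl_def \<gamma>_def)
    moreover have "subsolution (\<lambda>x. - u x)"
      using u * elliptic_op_uminus[OF open_spiral_dom, of u _ A b]
      by (auto simp: subsolution_def U_def Ucl_def \<gamma>_def C2_on_uminus[OF open_spiral_dom] intro!: continuous_intros)
    ultimately show "(\<forall>x\<in>Ucl. \<bar>u x\<bar> \<le> (SUP y\<in>S0. \<bar>u y\<bar>) \<and>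
          \<bar>u x\<bar> \<le> C * (SUP y\<in>S0. \<bar>u y\<bar>) * exp (- (1 / (Rbar + \<mu>)) * \<L> x)) \<or>
       (\<exists>C1>0. \<forall>\<epsilon>>0. \<exists>l1\<ge>0. \<forall>l\<ge>l1.
          (SUP x\<in>arc_layer r1 r2 \<theta>0 {inverse (kstar + \<epsilon>) * l .. (kstar + \<epsilon>) * l}. ereal \<bar>u x\<bar>)
            \<ge> ereal (C1 * exp (1 / (Rbar + \<mu>) * l)))"
      using u by (intro sup_dich[where F = "{u, \<lambda>x. - u x}"] continuous_on_rabs) (auto simp: abs_le_iff)
  qed
qed

end
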